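(* Let $X=V(f)\subseteq\mathbb{V}$, $\dim\mathbb{V}=n$, be a generic hypersurface of degree $d$. Then $$\mathrm{vHDdeg}(X)\leq d^2\sum_{k=0}^{n-1}\binom{n-1}{k}^2(d-1)^{2k}.$$
   Context: $\mathbb{V}\cong\mathbb{C}^n$ with fixed basis. For an irreducible affine variety $X=V(I_X)\subseteq\mathbb{V}$ of codimension $c$ with prime ideal $I_X=\langle f_1,\dots,f_s\rangle\subseteq\mathbb{C}[\mathbf{z}]$ and Jacobian $J(f)$, put $I_{X_{\mathrm{sing}}}=I_X+\langle c\text{-minors of }J(f)\rangle$. Let $\ast$ be the antilinear ring involution of $\mathbb{C}[\mathbf{z},\mathbf{w},\mathbf{u},\mathbf{v}]$ with $z_k\leftrightarrow w_k$, $u_k\leftrightarrow v_k$ and $a^\ast=\bar a$ for $a\in\mathbb{C}$. With $I_X'=\left\langle (c+1)\text{-minors of }\begin{bmatrix}\mathbf{v}-\mathbf{w}\\ J_{\mathbf{z}}(f)\end{bmatrix}\right\rangle$, the Hermitian critical ideal of $X$ is $$\left(I_X+(I_X)^\ast+I_X'+(I_X')^\ast\right):\left(I_{X_{\mathrm{sing}}}\cdot(I_{X_{\mathrm{sing}}})^\ast\right)^\infty ;$$ for fixed $(\mathbf{u},\mathbf{v})\in\mathbb{V}^2$ it is considered as an ideal of $\mathbb{C}[\mathbf{z},\mathbf{w}]$. The virtual Hermitian Distance degree $\mathrm{vHDdeg}(X)$ is the number of zeros in $\mathbb{V}^2$ of the Hermitian critical ideal of $(\mathbf{u},\mathbf{v})$,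 constant for $(\mathbf{u},\mathbf{v})$ in a Zariski-open dense subset of $\mathbb{V}^2$ (extended additively over irreducible components if $X$ is reducible). "Generic hypersurface of degree $d$" means that $f$ is a generic polynomial of degree $d$ in $n$ variables. *)

theory Defs
  imports
    "HOL-Library.Cardinality"
    "HOL-Library.Poly_Mapping"
    "HOL-Library.Set_Algebras"
    "Jordan_Normal_Form.Determinant"
begin

section \<open>Multivariate polynomials\<close>

text \<open>Complex polynomials in variables \<open>'v\<close> are finitely supported functions from monomials
  to coefficients, where a monomial is its finitely supported exponent function.\<close>

type_synonym 'v mpoly = "('v \<Rightarrow>\<^sub>0 nat) \<Rightarrow>\<^sub>0 complex"

definition Const :: "complex \<Rightarrow> 'v mpoly" where
  "Const a = Poly_Mapping.single 0 a"

definition Var :: "'v \<Rightarrow> 'v mpoly" where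
  "Var v = Poly_Mapping.single (Poly_Mapping.single v 1) 1"

text \<open>For a ring homomorphism \<open>\<phi>\<close> on the coefficients, \<open>subst \<phi> x\<close> is the ring
  homomorphism extending \<open>\<phi>\<close> that sends each variable \<open>v\<close> to \<open>x v\<close>.\<close>

definition subst :: "(complex \<Rightarrow> 'r::comm_ring_1) \<Rightarrow> ('v \<Rightarrow> 'r) \<Rightarrow> 'v mpoly \<Rightarrow> 'r" where
  "subst \<phi> x p =
     (\<Sum>m\<in>Poly_Mapping.keys p. \<phi> (Poly_Mapping.lookup p m) *
        (\<Prod>v\<in>Poly_Mapping.keys m. x v ^ Poly_Mapping.lookup m v))"

definition poly_eval :: "('v \<Rightarrow> complex) \<Rightarrow> 'v mpoly \<Rightarrow> complex" where
  "poly_eval x p = subst (\<lambda>a. a) x p"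

definition partial_deriv :: "'v \<Rightarrow> 'v mpoly \<Rightarrow> 'v mpoly" where
  "partial_deriv v p =
     (\<Sum>m\<in>Poly_Mapping.keys p.
        Poly_Mapping.single (m - Poly_Mapping.single v 1)
          (of_nat (Poly_Mapping.lookup m v) * Poly_Mapping.lookup p m))"

definition monom_degree :: "('v \<Rightarrow>\<^sub>0 nat) \<Rightarrow> nat" where
  "monom_degree m = (\<Sum>v\<in>Poly_Mapping.keys m. Poly_Mapping.lookup m v)"

definition total_deg :: "'v mpoly \<Rightarrow> nat" where
  "total_deg p = Max (insert 0 (monom_degree ` Poly_Mapping.keys p))"


section \<open>Ideals and minors\<close>

text \<open>The generated ideal is the span in the ring regarded as a module over itself. The sum of
  two ideals is the elementwise sum \<open>I + J\<close> of sets.\<close>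

definition ideal_gen :: "'a::comm_ring_1 set \<Rightarrow> 'a set" where
  "ideal_gen S = module.span (*) S"

definition ideal_mult :: "'a::comm_ring_1 set \<Rightarrow> 'a set \<Rightarrow> 'a set" where
  "ideal_mult I J = ideal_gen {a * b | a b. a \<in> I \<and> b \<in> J}"

primrec ideal_power :: "'a::comm_ring_1 set \<Rightarrow> nat \<Rightarrow> 'a set" where
  "ideal_power J 0 = UNIV"
| "ideal_power J (Suc k) = ideal_mult J (ideal_power J k)"

definition saturation :: "'a::comm_ring_1 set \<Rightarrow> 'a set \<Rightarrow> 'a set" where
  "saturation I J = {p. \<exists>k. \<forall>q\<in>ideal_power J k. p * q \<in> I}"

text \<open>The \<open>k\<close>-minors of a matrix given by its list of rows, with columns indexed by \<open>'n\<close>. There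
  is no order on the columns, so \<open>s\<close> (and likewise \<open>r\<close>) ranges over all enumerations of
  \<open>k\<close> distinct indices; this adds only the negatives of minors.\<close>

definition minors :: "nat \<Rightarrow> ('n \<Rightarrow> 'a::comm_ring_1) list \<Rightarrow> 'a set" where
  "minors k A =
     {det (mat k k (\<lambda>(i, j). (A ! r i) (s j))) | (r :: nat \<Rightarrow> nat) (s :: nat \<Rightarrow> 'n).
        inj_on r {..<k} \<and> r ` {..<k} \<subseteq> {..<length A} \<and> inj_on s {..<k}}"


section \<open>Affine varieties and the Zariski topology\<close>

definition zero_locus :: "'v mpoly set \<Rightarrow> ('v \<Rightarrow> complex) set" where
  "zero_locus P = {x. \<forall>p\<in>P. poly_eval x p = 0}"

definition algebraic_set :: "('v \<Rightarrow> complex) set \<Rightarrow> bool" where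
  "algebraic_set X \<longleftrightarrow> (\<exists>P. X = zero_locus P)"

text \<open>Openness and density in the Zariski topology induced on a set \<open>A\<close> of points.\<close>

definition zariski_open_in :: "('v \<Rightarrow> complex) set \<Rightarrow> ('v \<Rightarrow> complex) set \<Rightarrow> bool" where
  "zariski_open_in A U \<longleftrightarrow> (\<exists>P. U = A - zero_locus P)"

definition zariski_dense_in :: "('v \<Rightarrow> complex) set \<Rightarrow> ('v \<Rightarrow> complex) set \<Rightarrow> bool" where
  "zariski_dense_in A U \<longleftrightarrow>
     U \<subseteq> A \<and> (\<forall>W. zariski_open_in A W \<and> W \<noteq> {} \<longrightarrow> U \<inter> W \<noteq> {})"

definition irreducible_variety :: "('v \<Rightarrow> complex) set \<Rightarrow> bool" where
  "irreducible_variety X \<longleftrightarrow>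
     algebraic_set X \<and> X \<noteq> {} \<and>
     (\<forall>Y Z. algebraic_set Y \<and> algebraic_set Z \<and> X = Y \<union> Z \<longrightarrow> Y = X \<or> Z = X)"

definition irreducible_components :: "('v \<Rightarrow> complex) set \<Rightarrow> ('v \<Rightarrow> complex) set set" where
  "irreducible_components X =
     {Y. irreducible_variety Y \<and> Y \<subseteq> X \<and>
         (\<forall>Y'. irreducible_variety Y' \<and> Y \<subseteq> Y' \<and> Y' \<subseteq> X \<longrightarrow> Y' = Y)}"

text \<open>Codimension of an irreducible variety in affine space: the supremum of the lengths \<open>k\<close> of
  chains \<open>X = Y 0 \<subset> \<dots> \<subset> Y k\<close> of irreducible closed subsets. These lengths are bounded by
  the number of variables, so the supremum in \<open>nat\<close> is a maximum.\<close>

definition codimension :: "('n::finite \<Rightarrow> complex) set \<Rightarrow> nat" where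
  "codimension X =
     Sup {k. \<exists>Y. Y 0 = X \<and> (\<forall>i\<le>k. irreducible_variety (Y i)) \<and> (\<forall>i<k. Y i \<subset> Y (Suc i))}"

definition vanishing_ideal :: "('v \<Rightarrow> complex) set \<Rightarrow> 'v mpoly set" where
  "vanishing_ideal X = {p. \<forall>x\<in>X. poly_eval x p = 0}"

text \<open>The chosen generators \<open>f\<^sub>1, \<dots>, f\<^sub>s\<close> of the ideal of \<open>X\<close>. The ideals
  \<open>sing_ideal X\<close> and \<open>hermitian_critical_ideal X\<close> below do not depend on this choice.\<close>

definition generators :: "('n::finite \<Rightarrow> complex) set \<Rightarrow> 'n mpoly list" where
  "generators X = (SOME fs. ideal_gen (set fs) = vanishing_ideal X)"

definition jacobian :: "'n mpoly list \<Rightarrow> ('n \<Rightarrow> 'n mpoly) list" where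
  "jacobian fs = map (\<lambda>f k. partial_deriv k f) fs"

definition sing_ideal :: "('n::finite \<Rightarrow> complex) set \<Rightarrow> 'n mpoly set" where
  "sing_ideal X =
     vanishing_ideal X + ideal_gen (minors (codimension X) (jacobian (generators X)))"


section \<open>The Hermitian critical ideal\<close>

text \<open>The variables of the ring \<open>\<complex>[z, w, u, v]\<close>, each block being indexed by \<open>'n\<close>.\<close>

datatype 'n zwuv = Z 'n | W 'n | U 'n | V 'n

fun swap_var :: "'n zwuv \<Rightarrow> 'n zwuv" where
  "swap_var (Z k) = W k"
| "swap_var (W k) = Z k"
| "swap_var (U k) = V k"
| "swap_var (V k) = U k"

definition star :: "'n zwuv mpoly \<Rightarrow> 'n zwuv mpoly" where
  "star p = subst (\<lambda>a. Const (cnj a)) (\<lambda>x. Var (swap_var x)) p"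

definition embed_z :: "'n mpoly \<Rightarrow> 'n zwuv mpoly" where
  "embed_z p = subst Const (\<lambda>k. Var (Z k)) p"

definition extend_z :: "'n mpoly set \<Rightarrow> 'n zwuv mpoly set" where
  "extend_z I = ideal_gen (embed_z ` I)"

definition crit_ideal :: "('n::finite \<Rightarrow> complex) set \<Rightarrow> 'n zwuv mpoly set" where
  "crit_ideal X =
     ideal_gen (minors (codimension X + 1)
       ((\<lambda>k. Var (V k) - Var (W k)) #
        map (\<lambda>row k. embed_z (row k)) (jacobian (generators X))))"

definition hermitian_critical_ideal :: "('n::finite \<Rightarrow> complex) set \<Rightarrow> 'n zwuv mpoly set" where
  "hermitian_critical_ideal X =
     saturation
       (extend_z (vanishing_ideal X) + star ` extend_z (vanishing_ideal X) +
        crit_ideal X + star ` crit_ideal X)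
       (ideal_mult (extend_z (sing_ideal X)) (star ` extend_z (sing_ideal X)))"

text \<open>For fixed \<open>(u, v)\<close> the ideal is read in \<open>\<complex>[z, w]\<close>, whose variables \<open>z\<^sub>k\<close> and \<open>w\<^sub>k\<close>
  are \<open>Inl k\<close> and \<open>Inr k\<close>.\<close>

definition specialize ::
    "('n \<Rightarrow> complex) \<Rightarrow> ('n \<Rightarrow> complex) \<Rightarrow> 'n zwuv mpoly \<Rightarrow> ('n + 'n) mpoly" where
  "specialize u v p =
     subst Const
       (\<lambda>x. case x of Z k \<Rightarrow> Var (Inl k) | W k \<Rightarrow> Var (Inr k)
                    | U k \<Rightarrow> Const (u k) | V k \<Rightarrow> Const (v k)) p"

text \<open>Points of \<open>V \<times> V\<close> are functions on \<open>'n + 'n\<close>; the pair \<open>(u, v)\<close> is \<open>case_sum u v\<close>.\<close>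

definition critical_points ::
    "('n::finite \<Rightarrow> complex) set \<Rightarrow> ('n \<Rightarrow> complex) \<Rightarrow> ('n \<Rightarrow> complex) \<Rightarrow> ('n + 'n \<Rightarrow> complex) set"
  where
  "critical_points X u v = zero_locus (specialize u v ` hermitian_critical_ideal X)"

definition vHDdeg_irreducible :: "('n::finite \<Rightarrow> complex) set \<Rightarrow> nat" where
  "vHDdeg_irreducible X =
     (THE m. \<exists>\<Omega>. zariski_open_in UNIV \<Omega> \<and> zariski_dense_in UNIV \<Omega> \<and>
        (\<forall>u v. case_sum u v \<in> \<Omega> \<longrightarrow>
           finite (critical_points X u v) \<and> card (critical_points X u v) = m))"

definition vHDdeg :: "('n::finite \<Rightarrow> complex) set \<Rightarrow> nat" where
  "vHDdeg X = (\<Sum>Y\<in>irreducible_components X. vHDdeg_irreducible Y)"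


section \<open>Generic polynomials\<close>

text \<open>The coefficient space of polynomials of degree at most \<open>d\<close>: the coordinates are indexed by
  monomials, and those of degree greater than \<open>d\<close> are zero.\<close>

definition coeff_space :: "nat \<Rightarrow> (('n::finite \<Rightarrow>\<^sub>0 nat) \<Rightarrow> complex) set" where
  "coeff_space d = Poly_Mapping.lookup ` {f :: 'n mpoly. total_deg f \<le> d}"

definition for_generic_poly :: "nat \<Rightarrow> ('n::finite mpoly \<Rightarrow> bool) \<Rightarrow> bool" where
  "for_generic_poly d P \<longleftrightarrow>
     (\<exists>\<Omega>. zariski_open_in (coeff_space d) \<Omega> \<and> zariski_dense_in (coeff_space d) \<Omega> \<and>
        (\<forall>f. Poly_Mapping.lookup f \<in> \<Omega> \<and> total_deg f = d \<longrightarrow> P f))"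

end

theory Submission
  imports
    Defs
    "HOL-Computational_Algebra.Polynomial_Factorial"
    "HOL-Computational_Algebra.Field_as_Ring"
    "HOL-Computational_Algebra.Fundamental_Theorem_Algebra"
begin

text \<open>Let \<open>g\<close> be \<open>f\<close> with conjugated coefficients. If \<open>X = V(f)\<close> is smooth, the critical points of
  \<open>(u, v)\<close> are the pairs \<open>(z, w)\<close> with \<open>f(z) = g(w) = 0\<close>, \<open>v = w + \<lambda> \<nabla>f(z)\<close> and
  \<open>u = z + \<mu> \<nabla>g(w)\<close> for some \<open>\<lambda>\<close> and \<open>\<mu>\<close>. For fixed \<open>u\<close> with \<open>f(u) \<noteq> 0\<close> the last equation
  eliminates \<open>z\<close>, and counting monomials in \<open>w, \<mu>, \<lambda>\<close> modulo the two remaining equations shows that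
  every linear form in \<open>w, \<mu>\<close> is a root of a polynomial of degree at most
  \<open>d\<^sup>2 (1 + (d - 1)\<^sup>2 + \<dots> + (d - 1)\<^sup>2\<^sup>(\<^sup>n\<^sup>-\<^sup>1\<^sup>))\<close> over \<open>\<complex>[v]\<close>. A generic \<open>v\<close> therefore has at most that
  many critical points. By quantifier elimination the number of critical points is constant on a
  dense open set, so the virtual degree is well defined and obeys this bound.

  That a generic \<open>f\<close> is smooth and irreducible follows from the fact that a polynomial map into a
  space of larger dimension has its image in a hypersurface: it is applied to the singular
  polynomials and to the products of two bivariate ones. Irreducibility passes from
  planes through a coordinate axis to all dimensions, where unique factorization is not
  available. For \<open>n = 1\<close> the components are points of degree one.\<close>

section \<open>Evaluation of polynomials\<close>

text \<open>The degree bound is an asymptotic ratio. After reduction, the products of degree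
  \<open>q\<close> in \<open>v\<close> involve only monomials whose exponent \<open>s\<close> of
  \<lambda> is at most \<open>q\<close>. For each \<open>s\<close> the exponents of \<mu> and of one
  coordinate of \<open>w\<close> take at most \<open>d\<close> values each, and the other
  \<open>n - 1\<close> coordinates of \<open>w\<close> have total degree at most about
  \<open>(q - s) + (d - 1)^2 s\<close>. Summing over \<open>s\<close> gives \<open>q^n / n!\<close>
  times \<open>d^2 (1 + (d - 1)^2 + ... + (d - 1)^(2 (n - 1)))\<close>, against
  \<open>q^n / n!\<close> monomials in \<open>v\<close>; a large \<open>q\<close> absorbs all
  lower-order terms.

  The reduction needs in each of its two equations a monomial with a constant nonzero coefficient.
  For one this is a pure power, present for generic \<open>f\<close>; for the other it is the
  constant term \<open>f(u)\<close>. That is why \<open>u\<close> is fixed and only \<open>v\<close>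
  varies in the count. Generic pairs are reached indirectly: if almost all pairs had more critical
  points, so would almost all \<open>v\<close> for a suitable fixed \<open>u\<close>.

  Every property of a generic \<open>f\<close> is tied to the nonvanishing of one polynomial in its
  coefficients. Such a polynomial is never computed: comparing numbers of parameters shows that it
  exists.\<close>

abbreviation keys where "keys \<equiv> Poly_Mapping.keys"
abbreviation lookup where "lookup \<equiv> Poly_Mapping.lookup"
abbreviation single where "single \<equiv> Poly_Mapping.single"

definition mval :: "('v \<Rightarrow> 'r::comm_ring_1) \<Rightarrow> ('v \<Rightarrow>\<^sub>0 nat) \<Rightarrow> 'r" where
  "mval x m = (\<Prod>v\<in>keys m. x v ^ lookup m v)"

lemma mval_superset:
  assumes "finite A" "keys m \<subseteq> A"
  shows "mval x m = (\<Prod>v\<in>A. x v ^ lookup m v)"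
  unfolding mval_def using assms
  by (intro prod.mono_neutral_left) (auto simp: in_keys_iff)

lemma mval_0 [simp]: "mval x 0 = 1"
  by (simp add: mval_def)

lemma mval_single [simp]: "mval x (single v k) = x v ^ k"
  by (cases "k = 0") (simp_all add: mval_def)

lemma mval_add: "mval x (m + m') = mval x m * mval x m'"
proof -
  let ?A = "keys m \<union> keys m'"
  have "keys (m + m') \<subseteq> ?A" by (rule Poly_Mapping.keys_add)
  then have "mval x (m + m') = (\<Prod>v\<in>?A. x v ^ lookup (m + m') v)"
    by (intro mval_superset) auto
  also have "\<dots> = (\<Prod>v\<in>?A. x v ^ lookup m v) * (\<Prod>v\<in>?A. x v ^ lookup m' v)"
    by (simp add: lookup_add power_add prod.distrib)
  also have "\<dots> = mval x m * mval x m'"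
    by (subst (1 2) mval_superset[of ?A]) auto
  finally show ?thesis .
qed

lemma mval_sum: "finite A \<Longrightarrow> mval x (sum g A) = (\<Prod>a\<in>A. mval x (g a))"
  by (induction A rule: finite_induct) (auto simp: mval_add)

lemma mpoly_sum_single: "(\<Sum>m\<in>keys p. single m (lookup p m)) = p"
  by (rule poly_mapping_eqI)
    (auto simp: lookup_sum lookup_single when_def in_keys_iff sum.delta)

lemma subst_superset:
  assumes "\<phi> 0 = 0" "finite A" "keys p \<subseteq> A"
  shows "subst \<phi> x p = (\<Sum>m\<in>A. \<phi> (lookup p m) * mval x m)"
  unfolding subst_def mval_def[symmetric] using assms
  by (intro sum.mono_neutral_left) (auto simp: in_keys_iff)

text \<open>One proof of multiplicativity serves evaluation, where coefficients stay as they are,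
  and also restriction to a line or a plane and the reading of a polynomial as univariate in one
  variable, where they become constant polynomials.\<close>

locale coeff_hom = comm_ring_hom hom for hom :: "complex \<Rightarrow> 'r::comm_ring_1"
begin

lemma subst_0 [simp]: "subst hom x 0 = 0"
  by (simp add: subst_def)

lemma subst_single [simp]: "subst hom x (single m a) = hom a * mval x m"
  using subst_superset[of hom "{m}" "single m a" x] by (auto split: if_splits)

lemma subst_1 [simp]: "subst hom x 1 = 1"
  using subst_single[of x 0 1] by simp

lemma subst_add: "subst hom x (p + q) = subst hom x p + subst hom x q"
proof -
  let ?A = "keys p \<union> keys q"
  have "keys (p + q) \<subseteq> ?A" by (rule Poly_Mapping.keys_add)
  then show ?thesis
    by (subst (1 2 3) subst_superset[of hom ?A])
      (auto simp: lookup_add hom_add ring_distribs sum.distrib)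
qed

lemma subst_sum: "subst hom x (sum g A) = (\<Sum>a\<in>A. subst hom x (g a))"
  by (induction A rule: infinite_finite_induct) (auto simp: subst_add)

lemma subst_mult: "subst hom x (p * q) = subst hom x p * subst hom x q"
proof -
  have 1: "subst hom x (single m a * single m' b) = subst hom x (single m a) * subst hom x (single m' b)"
    for m m' a b by (simp add: mult_single hom_mult mval_add ac_simps)
  have "subst hom x (p * q) = subst hom x
      ((\<Sum>m\<in>keys p. single m (lookup p m)) * (\<Sum>m\<in>keys q. single m (lookup q m)))"
    by (simp only: mpoly_sum_single)
  also have "\<dots> = (\<Sum>m\<in>keys p. subst hom x (single m (lookup p m)))
      * (\<Sum>m\<in>keys q. subst hom x (single m (lookup q m)))"
    by (simp only: sum_product subst_sum 1)
  also have "\<dots> = subst hom x p * subst hom x q"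
    by (simp only: subst_sum[symmetric] mpoly_sum_single)
  finally show ?thesis .
qed

lemma comm_ring_hom_subst: "comm_ring_hom (subst hom x)"
  by unfold_locales (simp_all add: subst_add subst_mult)

lemma subst_Const [simp]: "subst hom x (Const a) = hom a"
  by (simp add: Const_def)

lemma subst_Var [simp]: "subst hom x (Var v) = x v"
  by (simp add: Var_def)

end

lemma hom_mval: "comm_ring_hom h \<Longrightarrow> h (mval x m) = mval (\<lambda>v. h (x v)) m"
proof -
  assume "comm_ring_hom h"
  then interpret comm_ring_hom h .
  show ?thesis by (simp add: mval_def hom_prod hom_power)
qed

lemma hom_subst:
  assumes "comm_ring_hom h"
  shows "h (subst \<phi> x p) = subst (\<lambda>a. h (\<phi> a)) (\<lambda>v. h (x v)) p"
proof -
  interpret comm_ring_hom h by fact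
  show ?thesis
    by (simp add: subst_def mval_def[symmetric] hom_sum hom_mult hom_mval[OF assms])
qed

lemma comm_ring_hom_id: "comm_ring_hom (\<lambda>a. a::'a::comm_ring_1)"
  by unfold_locales auto

lemma comm_ring_hom_Const: "comm_ring_hom Const"
  by unfold_locales (auto simp: Const_def mult_single single_add single_diff)

lemma comm_ring_hom_cnj: "comm_ring_hom cnj"
  by unfold_locales auto

lemma comm_ring_hom_pCons: "comm_ring_hom (\<lambda>a::'a::comm_ring_1. [:a:])"
  by unfold_locales (auto simp: pCons_one)

lemma coeff_homI: "comm_ring_hom h \<Longrightarrow> coeff_hom h"
  by (simp add: coeff_hom_def)

lemma comm_ring_hom_comp:
  assumes "comm_ring_hom f" "comm_ring_hom g"
  shows "comm_ring_hom (\<lambda>a. f (g a))"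
proof -
  interpret f: comm_ring_hom f by fact
  interpret g: comm_ring_hom g by fact
  show ?thesis by unfold_locales (auto simp: g.hom_add f.hom_add g.hom_mult f.hom_mult)
qed

global_interpretation Const: comm_ring_hom Const by (rule comm_ring_hom_Const)

lemma poly_eval_superset:
  assumes "finite A" "keys p \<subseteq> A"
  shows "poly_eval x p = (\<Sum>m\<in>A. lookup p m * mval x m)"
  unfolding poly_eval_def using assms by (intro subst_superset) auto

lemma poly_eval_alt: "poly_eval x p = (\<Sum>m\<in>keys p. lookup p m * mval x m)"
  by (rule poly_eval_superset) auto

lemma comm_ring_hom_poly_eval: "comm_ring_hom (poly_eval x)"
  using coeff_hom.comm_ring_hom_subst[OF coeff_homI, OF comm_ring_hom_id, of x]
  unfolding poly_eval_def[abs_def] .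

global_interpretation eval: comm_ring_hom "poly_eval x" for x
  by (rule comm_ring_hom_poly_eval)

lemma poly_eval_Const [simp]: "poly_eval x (Const a) = a"
  unfolding poly_eval_def by (rule coeff_hom.subst_Const[OF coeff_homI, OF comm_ring_hom_id])

lemma poly_eval_Var [simp]: "poly_eval x (Var v) = x v"
  unfolding poly_eval_def by (rule coeff_hom.subst_Var[OF coeff_homI, OF comm_ring_hom_id])

lemma poly_eval_single [simp]: "poly_eval x (single m a) = a * mval x m"
  unfolding poly_eval_def by (rule coeff_hom.subst_single[OF coeff_homI, OF comm_ring_hom_id])

lemma poly_eval_mval [simp]: "poly_eval x (mval y m) = mval (\<lambda>v. poly_eval x (y v)) m"
  by (rule hom_mval[OF comm_ring_hom_poly_eval])

lemma poly_eval_subst: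
  "poly_eval x (subst \<phi> y p) = subst (\<lambda>a. poly_eval x (\<phi> a)) (\<lambda>v. poly_eval x (y v)) p"
  by (rule hom_subst[OF comm_ring_hom_poly_eval])

lemma poly_eval_subst_Const [simp]:
  "poly_eval x (subst Const y p) = poly_eval (\<lambda>v. poly_eval x (y v)) p"
  by (simp add: poly_eval_subst poly_eval_def[symmetric])

lemma poly_eval_cong:
  assumes "\<And>m v. m \<in> keys p \<Longrightarrow> v \<in> keys m \<Longrightarrow> x v = y v"
  shows "poly_eval x p = poly_eval y p"
  unfolding poly_eval_alt mval_def using assms by (intro sum.cong prod.cong arg_cong2[where f="(*)"]) auto

section \<open>Polynomials along a line\<close>

definition line_poly :: "('v \<Rightarrow> complex) \<Rightarrow> ('v \<Rightarrow> complex) \<Rightarrow> 'v mpoly \<Rightarrow> complex poly" where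
  "line_poly a b p = subst (\<lambda>c. [:c:]) (\<lambda>v. [:a v, b v:]) p"

lemma poly_line_poly [simp]: "poly (line_poly a b p) t = poly_eval (\<lambda>v. a v + t * b v) p"
proof -
  have "comm_ring_hom (\<lambda>q. poly q t :: complex)" by unfold_locales auto
  from hom_subst[OF this, of "\<lambda>c. [:c:]" "\<lambda>v. [:a v, b v:]" p] show ?thesis
    unfolding line_poly_def poly_eval_def by simp
qed

global_interpretation line: comm_ring_hom "line_poly a b" for a b
  using coeff_hom.comm_ring_hom_subst[OF coeff_homI, OF comm_ring_hom_pCons]
  unfolding line_poly_def[abs_def] .

text \<open>Both restrictions to the line through \<open>a\<close> and \<open>b\<close> are nonzero
  univariate polynomials, as \<open>t = 0\<close> and \<open>t = 1\<close> show, and so is their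
  product. The witness is kept on this line because it must later stay inside a linear space of
  coefficient vectors.\<close>

lemma common_nonzero_on_line:
  assumes "poly_eval a p \<noteq> 0" "poly_eval b q \<noteq> 0"
  obtains t where "poly_eval (\<lambda>v. a v + t * (b v - a v)) p \<noteq> 0"
    "poly_eval (\<lambda>v. a v + t * (b v - a v)) q \<noteq> 0"
proof -
  let ?L = "\<lambda>p. line_poly a (\<lambda>v. b v - a v) p"
  have "poly (?L p) 0 \<noteq> 0" "poly (?L q) 1 \<noteq> 0" using assms by auto
  then have "?L p \<noteq> 0" "?L q \<noteq> 0" by (metis poly_0)+
  then have "?L p * ?L q \<noteq> 0" by simp
  then obtain t where "poly (?L p * ?L q) t \<noteq> 0" by (metis poly_all_0_iff_0)
  then show ?thesis using that[of t] by auto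
qed

lemma common_nonzero:
  assumes "\<exists>x. poly_eval x p \<noteq> 0" "\<exists>x. poly_eval x q \<noteq> 0"
  shows "\<exists>x. poly_eval x p \<noteq> 0 \<and> poly_eval x q \<noteq> 0"
proof -
  obtain a where a: "poly_eval a p \<noteq> 0" using assms(1) ..
  obtain b where b: "poly_eval b q \<noteq> 0" using assms(2) ..
  show ?thesis
  proof (rule common_nonzero_on_line[OF a b])
    fix t
    let ?y = "\<lambda>v. a v + t * (b v - a v)"
    assume "poly_eval ?y p \<noteq> 0" "poly_eval ?y q \<noteq> 0"
    then have "poly_eval ?y p \<noteq> 0 \<and> poly_eval ?y q \<noteq> 0" by (rule conjI)
    then show ?thesis by (rule exI[of _ ?y])
  qed
qed

lemma common_nonzero_finite:
  assumes "finite A" "\<And>a. a \<in> A \<Longrightarrow> \<exists>x. poly_eval x (g a) \<noteq> 0"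
  shows "\<exists>x. \<forall>a\<in>A. poly_eval x (g a) \<noteq> 0"
proof -
  have "\<exists>x. poly_eval x (\<Prod>a\<in>A. g a) \<noteq> 0" using assms
  proof (induction A rule: finite_induct)
    case (insert a A)
    then have "\<exists>x. poly_eval x (g a) \<noteq> 0 \<and> poly_eval x (\<Prod>a\<in>A. g a) \<noteq> 0"
      by (intro common_nonzero) auto
    then show ?case using insert.hyps by (simp add: eval.hom_mult)
  qed auto
  then obtain x where "poly_eval x (\<Prod>a\<in>A. g a) \<noteq> 0" ..
  then show ?thesis using assms(1) by (intro exI[of _ x]) (simp add: eval.hom_prod)
qed

text \<open>Linear independence of monomials as functions. With the other coordinates fixed, the sum
  is a univariate polynomial in the new variable \<open>v\<close>, so each of its coefficients
  vanishes; these are sums in fewer variables.\<close>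

lemma mval_sum_eq_0_imp:
  fixes c :: "('v \<Rightarrow>\<^sub>0 nat) \<Rightarrow> complex"
  assumes "finite S" "finite M" "\<And>m. m \<in> M \<Longrightarrow> keys m \<subseteq> S" "\<And>x. (\<Sum>m\<in>M. c m * mval x m) = 0"
    "m \<in> M"
  shows "c m = 0"
  using assms
proof (induction S arbitrary: M c m rule: finite_induct)
  case empty
  have "m' = 0" if "m' \<in> M" for m'
  proof (rule poly_mapping_eqI)
    have "keys m' = {}" using empty.prems(2)[OF that] by blast
    then show "lookup m' k = lookup 0 k" for k using in_keys_iff[of k m'] by simp
  qed
  then have "M = {0}" using empty.prems(4) by blast
  then show ?case using empty.prems(3)[of undefined] empty.prems(4) by simp
next
  case (insert v S)
  let ?k = "lookup m v"
  let ?r = "\<lambda>m'::'v \<Rightarrow>\<^sub>0 nat. m' - single v (lookup m' v)"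
  have dec: "m' = single v (lookup m' v) + ?r m'" for m' :: "'v \<Rightarrow>\<^sub>0 nat"
    by (rule poly_mapping_eqI) (auto simp: lookup_add lookup_minus lookup_single when_def)
  have rv: "lookup (?r m') v = 0" for m' :: "'v \<Rightarrow>\<^sub>0 nat" by (simp add: lookup_minus)
  let ?M = "{m'\<in>M. lookup m' v = ?k}"
  have inj: "inj_on ?r ?M"
  proof (rule inj_onI)
    fix m1 m2 assume "m1 \<in> ?M" "m2 \<in> ?M" "?r m1 = ?r m2"
    then have "single v (lookup m1 v) + ?r m1 = single v (lookup m2 v) + ?r m2" by simp
    then show "m1 = m2" by (simp only: dec[symmetric])
  qed
  have key: "(\<Sum>m'\<in>?M. c m' * mval x (?r m')) = 0" for x
  proof -
    let ?x = "\<lambda>t. x(v := t)"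
    let ?P = "\<Sum>m'\<in>M. monom (c m' * mval x (?r m')) (lookup m' v)"
    have "poly ?P t = (\<Sum>m'\<in>M. c m' * mval (?x t) m')" for t
    proof -
      have "mval (?x t) m' = t ^ lookup m' v * mval x (?r m')" for m'
      proof -
        have "mval (?x t) (?r m') = mval x (?r m')"
          unfolding mval_def using rv[of m'] by (intro prod.cong) (auto simp: in_keys_iff)
        then have "mval (?x t) (single v (lookup m' v) + ?r m') = t ^ lookup m' v * mval x (?r m')"
          by (simp add: mval_add)
        then show ?thesis by (simp only: dec[symmetric])
      qed
      then show ?thesis by (simp add: poly_sum poly_monom ac_simps)
    qed
    then have "poly ?P t = 0" for t using insert.prems(3) by simp
    then have "?P = 0" by (intro iffD1[OF poly_all_0_iff_0] allI)
    then have "coeff ?P ?k = 0" by simp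
    then show ?thesis
      by (simp only: coeff_sum coeff_monom sum.inter_filter[OF insert.prems(1)])
  qed
  \<comment> \<open>The monomials in \<open>?M\<close> agree in the exponent of \<open>v\<close>, so
    stripping it is injective and the coefficient can be recovered from the stripped
    monomial.\<close>
  define c' where "c' m' = c (m' + single v ?k)" for m'
  have c': "c' (?r m') = c m'" if "m' \<in> ?M" for m'
    using that dec[of m', symmetric] by (simp add: c'_def add.commute)
  have "c' (?r m) = 0"
  proof (rule insert.IH[of "?r ` ?M"])
    show "finite (?r ` ?M)" using insert.prems by auto
    show "keys m' \<subseteq> S" if "m' \<in> ?r ` ?M" for m'
    proof -
      from that obtain m'' where m'': "m'' \<in> M" "m' = ?r m''" by blast
      have "keys m' \<subseteq> keys m''" using m'' by (auto simp: in_keys_iff lookup_minus)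
      moreover have "v \<notin> keys m'" using rv m'' by (auto simp: in_keys_iff)
      ultimately show ?thesis using insert.prems(2)[OF m''(1)] by auto
    qed
    show "(\<Sum>m\<in>?r ` ?M. c' m * mval x m) = 0" for x
    proof -
      have "(\<Sum>m'\<in>?M. c' (?r m') * mval x (?r m')) = (\<Sum>m'\<in>?M. c m' * mval x (?r m'))"
        using c' by (intro sum.cong) auto
      then have "(\<Sum>m'\<in>?M. c' (?r m') * mval x (?r m')) = 0" by (simp only: key)
      then show ?thesis by (simp only: sum.reindex[OF inj] comp_def)
    qed
    show "?r m \<in> ?r ` ?M" using insert.prems by auto
  qed
  then show ?case using c'[of m] insert.prems(4) by simp
qed

text \<open>Identities may be tested at points, even for infinitely many variables, since a
  polynomial involves only finitely many. The coefficients of \<open>f\<close> will themselves be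
  coordinates of a point, indexed by all monomials.\<close>

lemma mpoly_eq_0_iff: "p = 0 \<longleftrightarrow> (\<forall>x. poly_eval x p = 0)"
proof
  assume *: "\<forall>x. poly_eval x p = 0"
  have "lookup p m = 0" if "m \<in> keys p" for m
  proof (rule mval_sum_eq_0_imp[of "\<Union>m\<in>keys p. keys m" "keys p"])
    show "(\<Sum>m\<in>keys p. lookup p m * mval x m) = 0" for x
      using * by (simp add: poly_eval_alt)
  qed (use that in auto)
  then show "p = 0" by (intro poly_mapping_eqI) (auto simp: in_keys_iff)
qed auto

lemma mpoly_eqI: "(\<And>x. poly_eval x p = poly_eval x q) \<Longrightarrow> p = q"
  using mpoly_eq_0_iff[of "p - q"] by (auto simp: eval.hom_minus)

lemma mpoly_mult_eq_0_iff: "(p :: 'v mpoly) * q = 0 \<longleftrightarrow> p = 0 \<or> q = 0"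
proof
  assume *: "p * q = 0"
  show "p = 0 \<or> q = 0"
  proof (rule ccontr)
    assume "\<not> (p = 0 \<or> q = 0)"
    then have "\<exists>x. poly_eval x p \<noteq> 0" "\<exists>x. poly_eval x q \<noteq> 0"
      using mpoly_eq_0_iff[of p] mpoly_eq_0_iff[of q] by blast+
    from common_nonzero[OF this] obtain x where "poly_eval x (p * q) \<noteq> 0"
      by (auto simp: eval.hom_mult)
    with * show False by simp
  qed
qed auto

section \<open>Counting monomials and linear dependence\<close>

text \<open>Gaussian elimination: a pivot solves one equation for one unknown, which lowers both
  numbers by one.\<close>

lemma homogeneous_system_nontrivial:
  fixes a :: "'j \<Rightarrow> 'k \<Rightarrow> complex"
  assumes "finite G" "finite J" "card G < card J"
  shows "\<exists>c. (\<exists>j\<in>J. c j \<noteq> 0) \<and> (\<forall>k\<in>G. (\<Sum>j\<in>J. c j * a j k) = 0)"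
  using assms
proof (induction G arbitrary: J a rule: finite_induct)
  case empty
  then have "J \<noteq> {}" by auto
  then show ?case by (intro exI[of _ "\<lambda>_. 1"]) auto
next
  case (insert k G)
  show ?case
  proof (cases "\<forall>j\<in>J. a j k = 0")
    case True
    have "card G < card J" using insert by simp
    from insert.IH[OF insert.prems(1) this, of a] obtain c where
      c: "\<exists>j\<in>J. c j \<noteq> 0" "\<forall>k\<in>G. (\<Sum>j\<in>J. c j * a j k) = 0" by blast
    have "(\<Sum>j\<in>J. c j * a j k) = 0" using True by (intro sum.neutral) simp
    then show ?thesis using c by (intro exI[of _ c]) simp
  next
    case False
    then obtain j0 where j0: "j0 \<in> J" "a j0 k \<noteq> 0" by blast
    let ?J = "J - {j0}"
    define a' where "a' j l = a j l - a j k / a j0 k * a j0 l" for j l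
    have "card G < card ?J" using insert j0 by simp
    from insert.IH[OF _ this, of a'] insert.prems(1) obtain c where
      c: "\<exists>j\<in>?J. c j \<noteq> 0" "\<forall>l\<in>G. (\<Sum>j\<in>?J. c j * a' j l) = 0" by auto
    let ?s = "- (\<Sum>j\<in>?J. c j * a j k) / a j0 k"
    let ?c = "c(j0 := ?s)"
    have sumJ: "(\<Sum>j\<in>J. ?c j * b j) = ?s * b j0 + (\<Sum>j\<in>?J. c j * b j)" for b :: "'j \<Rightarrow> complex"
    proof -
      have "(\<Sum>j\<in>?J. ?c j * b j) = (\<Sum>j\<in>?J. c j * b j)" by (intro sum.cong) auto
      then show ?thesis using sum.remove[OF insert.prems(1) j0(1), of "\<lambda>j. ?c j * b j"] by simp
    qed
    have "(\<Sum>j\<in>J. ?c j * a j l) = 0" if "l \<in> G" for l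
    proof -
      have "0 = (\<Sum>j\<in>?J. c j * a' j l)" using c(2) that by simp
      also have "\<dots> = (\<Sum>j\<in>?J. c j * a j l) - (\<Sum>j\<in>?J. c j * a j k) * (a j0 l / a j0 k)"
        unfolding a'_def sum_distrib_right sum_subtractf[symmetric]
        by (intro sum.cong) (auto simp: field_simps)
      finally have "(\<Sum>j\<in>?J. c j * a j l) = (\<Sum>j\<in>?J. c j * a j k) * (a j0 l / a j0 k)" by simp
      then show ?thesis by (simp only: sumJ) simp
    qed
    moreover have "(\<Sum>j\<in>J. ?c j * a j k) = 0" by (simp only: sumJ) (simp add: j0)
    moreover have "\<exists>j\<in>J. ?c j \<noteq> 0" using c(1) by auto
    ultimately show ?thesis by (intro exI[of _ ?c]) simp
  qed
qed

text \<open>The expansions are required only on \<open>E\<close>: on the slice a product becomes a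
  combination of few monomials only by means of the equations of the slice.\<close>

lemma functions_linear_dependent:
  fixes g :: "'j \<Rightarrow> 'x \<Rightarrow> complex" and h :: "'k \<Rightarrow> 'x \<Rightarrow> complex"
  assumes "finite G" "finite J" "card G < card J"
    and "\<And>j. j \<in> J \<Longrightarrow> \<exists>a. \<forall>x\<in>E. g j x = (\<Sum>k\<in>G. a k * h k x)"
  obtains c where "\<exists>j\<in>J. c j \<noteq> 0" "\<And>x. x \<in> E \<Longrightarrow> (\<Sum>j\<in>J. c j * g j x) = 0"
proof -
  from assms(4) obtain a where a: "\<And>j x. j \<in> J \<Longrightarrow> x \<in> E \<Longrightarrow> g j x = (\<Sum>k\<in>G. a j k * h k x)"
    by metis
  from homogeneous_system_nontrivial[OF assms(1-3), of a] obtain c where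
    c: "\<exists>j\<in>J. c j \<noteq> 0" "\<forall>k\<in>G. (\<Sum>j\<in>J. c j * a j k) = 0" by blast
  have "(\<Sum>j\<in>J. c j * g j x) = 0" if "x \<in> E" for x
  proof -
    have "(\<Sum>j\<in>J. c j * g j x) = (\<Sum>j\<in>J. \<Sum>k\<in>G. c j * a j k * h k x)"
      using a that by (intro sum.cong) (auto simp: sum_distrib_left mult.assoc)
    also have "\<dots> = (\<Sum>k\<in>G. (\<Sum>j\<in>J. c j * a j k) * h k x)"
      by (subst sum.swap) (simp add: sum_distrib_right)
    also have "\<dots> = 0" using c(2) by simp
    finally show ?thesis .
  qed
  with c(1) show ?thesis by (rule that)
qed

section \<open>Monomials of bounded degree and their number\<close>

lemma monom_degree_superset:
  "finite A \<Longrightarrow> keys m \<subseteq> A \<Longrightarrow> monom_degree m = (\<Sum>v\<in>A. lookup m v)"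
  unfolding monom_degree_def by (intro sum.mono_neutral_left) (auto simp: in_keys_iff)

lemma monom_degree_0 [simp]: "monom_degree 0 = 0"
  by (simp add: monom_degree_def)

lemma monom_degree_single [simp]: "monom_degree (single v k) = k"
  by (cases "k = 0") (simp_all add: monom_degree_def)

lemma monom_degree_add [simp]: "monom_degree (m + m') = monom_degree m + monom_degree m'"
proof -
  have "keys (m + m') \<subseteq> keys m \<union> keys m'" by (rule Poly_Mapping.keys_add)
  then show ?thesis
    by (simp add: monom_degree_superset[of "keys m \<union> keys m'"] lookup_add sum.distrib)
qed

lemma keys_add_nat: "keys (m + m' :: 'v \<Rightarrow>\<^sub>0 nat) = keys m \<union> keys m'"
  by (auto simp: in_keys_iff lookup_add)

lemma lookup_le_monom_degree: "lookup m v \<le> monom_degree m"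
  unfolding monom_degree_def
  by (cases "v \<in> keys m") (auto intro: member_le_sum simp: in_keys_iff)

definition monoms :: "'v set \<Rightarrow> nat \<Rightarrow> ('v \<Rightarrow>\<^sub>0 nat) set" where
  "monoms A q = {m. keys m \<subseteq> A \<and> monom_degree m \<le> q}"

lemma monom_split: "m = single v (lookup m v) + (m - single v (lookup m v))"
  for m :: "'v \<Rightarrow>\<^sub>0 nat"
  by (rule poly_mapping_eqI) (auto simp: lookup_add lookup_minus lookup_single when_def)

lemma monom_split_le: "k \<le> lookup m v \<Longrightarrow> m = single v k + (m - single v k)"
  for m :: "'v \<Rightarrow>\<^sub>0 nat"
  by (rule poly_mapping_eqI) (auto simp: lookup_add lookup_minus lookup_single when_def)

lemma monoms_insert:
  assumes "v \<notin> A"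
  shows "bij_betw (\<lambda>(k, m). single v k + m) (SIGMA k:{..q}. monoms A (q - k)) (monoms (insert v A) q)"
proof (intro bij_betwI[where g = "\<lambda>m. (lookup m v, m - single v (lookup m v))"])
  show "(\<lambda>(k, m). single v k + m) \<in> (SIGMA k:{..q}. monoms A (q - k)) \<rightarrow> monoms (insert v A) q"
    by (auto simp: monoms_def keys_add_nat split: if_splits)
  show "(\<lambda>m. (lookup m v, m - single v (lookup m v)))
      \<in> monoms (insert v A) q \<rightarrow> (SIGMA k:{..q}. monoms A (q - k))"
  proof (rule funcsetI)
    fix m assume m: "m \<in> monoms (insert v A) q"
    then have mq: "keys m \<subseteq> insert v A" "monom_degree m \<le> q" by (auto simp: monoms_def)
    have "x \<in> keys m \<and> x \<noteq> v" if "x \<in> keys (m - single v (lookup m v))" for x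
      using that by (auto simp: in_keys_iff lookup_minus lookup_single when_def)
    then have 1: "keys (m - single v (lookup m v)) \<subseteq> A" using mq(1) by blast
    have "monom_degree m = monom_degree (single v (lookup m v) + (m - single v (lookup m v)))"
      by (simp only: monom_split[symmetric])
    then have 2: "monom_degree m = lookup m v + monom_degree (m - single v (lookup m v))"
      by simp
    show "(lookup m v, m - single v (lookup m v)) \<in> (SIGMA k:{..q}. monoms A (q - k))"
      using mq(2) 1 unfolding monoms_def 2 by simp
  qed
  show "(\<lambda>m. (lookup m v, m - single v (lookup m v))) (case p of (k, m) \<Rightarrow> single v k + m) = p"
    if "p \<in> (SIGMA k:{..q}. monoms A (q - k))" for p
  proof -
    obtain k m where p: "p = (k, m)" by fastforce
    have "lookup m v = 0" using that assms by (auto simp: p monoms_def in_keys_iff)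
    then show ?thesis by (simp add: p lookup_add)
  qed
  show "(\<lambda>(k, m). single v k + m) (lookup m v, m - single v (lookup m v)) = m"
    if "m \<in> monoms (insert v A) q" for m
    by (simp add: monom_split[symmetric])
qed

lemma monoms_empty [simp]: "monoms {} q = {0 :: 'v \<Rightarrow>\<^sub>0 nat}"
proof -
  have "m = 0" if "keys m = {}" for m :: "'v \<Rightarrow>\<^sub>0 nat"
  proof (rule poly_mapping_eqI)
    show "lookup m k = lookup 0 k" for k using that in_keys_iff[of k m] by simp
  qed
  then show ?thesis unfolding monoms_def by fastforce
qed

text \<open>Splitting off the exponent of one variable turns the count into a hockey-stick
  sum.\<close>

lemma card_finite_monoms:
  assumes "finite A"
  shows "finite (monoms A q) \<and> card (monoms A q) = (q + card A) choose card A"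
  using assms
proof (induction A arbitrary: q rule: finite_induct)
  case (insert v A)
  note bij = monoms_insert[OF insert.hyps(2), of q]
  have fin: "finite (SIGMA k:{..q}. monoms A (q - k))" using insert.IH by auto
  have "card (monoms (insert v A) q) = card (SIGMA k:{..q}. monoms A (q - k))"
    using bij_betw_same_card[OF bij] by simp
  also have "\<dots> = (\<Sum>k\<le>q. (q - k + card A) choose card A)"
    using insert.IH by (simp add: card_SigmaI)
  also have "\<dots> = (\<Sum>j\<le>q. (card A + j) choose card A)"
    by (rule sum.reindex_bij_witness[of _ "\<lambda>j. q - j" "\<lambda>j. q - j"]) (auto simp: add.commute)
  also have "\<dots> = (card A + q + 1) choose (card A + 1)" by (rule choose_rising_sum(1))
  finally show ?case
    using bij_betw_finite[OF bij] fin insert.hyps by (simp add: add.commute)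
qed auto

lemmas finite_monoms = card_finite_monoms[THEN conjunct1]
lemmas card_monoms = card_finite_monoms[THEN conjunct2]

section \<open>Supports of sums, products and substitutions\<close>

lemma keys_mult_graded:
  assumes "\<And>a b. a \<in> A \<Longrightarrow> b \<in> B \<Longrightarrow> a + b \<in> C" "keys p \<subseteq> A" "keys p' \<subseteq> B"
  shows "keys (p * p') \<subseteq> C"
proof
  fix m assume "m \<in> keys (p * p')"
  then obtain a b where "m = a + b" "a \<in> keys p" "b \<in> keys p'"
    using Poly_Mapping.keys_mult[of p p'] by blast
  then show "m \<in> C" using assms by blast
qed

lemma keys_add_subset: "keys p \<subseteq> A \<Longrightarrow> keys p' \<subseteq> A \<Longrightarrow> keys (p + p') \<subseteq> A"
  using Poly_Mapping.keys_add[of p p'] by blast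

lemma keys_diff_subset:
  fixes p p' :: "'v mpoly"
  shows "keys p \<subseteq> A \<Longrightarrow> keys p' \<subseteq> A \<Longrightarrow> keys (p - p') \<subseteq> A"
  by (intro subsetI) (metis in_keys_iff lookup_minus diff_0_right subset_iff)

lemma keys_sum_subset: "(\<And>i. i \<in> I \<Longrightarrow> keys (p i) \<subseteq> A) \<Longrightarrow> keys (sum p I) \<subseteq> A"
  by (induction I rule: infinite_finite_induct) (auto intro!: keys_add_subset simp: keys_add_subset)

lemma keys_Const: "keys (Const c) \<subseteq> {0}"
  by (simp add: Const_def)

lemma keys_Var: "keys (Var v) = {single v 1}"
  by (simp add: Var_def)

text \<open>Total degree, the weighted degrees on the slice and membership in a set of variables
  pass through products, powers and substitutions for one common reason: they are filtrations of the
  monoid of monomials.\<close>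

locale monom_grading =
  fixes A :: "nat \<Rightarrow> ('v \<Rightarrow>\<^sub>0 nat) set"
  assumes zero: "0 \<in> A 0"
    and add: "a \<in> A i \<Longrightarrow> b \<in> A j \<Longrightarrow> a + b \<in> A (i + j)"
    and mono: "i \<le> j \<Longrightarrow> A i \<subseteq> A j"
begin

lemma keys_power: "keys p \<subseteq> A 1 \<Longrightarrow> keys (p ^ k) \<subseteq> A k"
proof (induction k)
  case (Suc k)
  then have "keys (p * p ^ k) \<subseteq> A (1 + k)"
    by (intro keys_mult_graded[of "A 1" "A k" "A (1 + k)" p "p ^ k"] add) auto
  then show ?case by simp
qed (simp add: zero)

lemma keys_prod:
  assumes "finite B" "\<And>b. b \<in> B \<Longrightarrow> keys (y b) \<subseteq> A (n b)"
  shows "keys (\<Prod>b\<in>B. y b) \<subseteq> A (\<Sum>b\<in>B. n b)"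
  using assms
proof (induction B rule: finite_induct)
  case (insert b B)
  then show ?case
    using keys_mult_graded[of "A (n b)" "A (\<Sum>b\<in>B. n b)" "A (n b + (\<Sum>b\<in>B. n b))" "y b" "\<Prod>b\<in>B. y b"] add
    by simp
qed (simp add: zero)

lemma keys_mval:
  assumes "\<And>j. j \<in> keys \<alpha> \<Longrightarrow> keys (y j) \<subseteq> A 1"
  shows "keys (mval y \<alpha>) \<subseteq> A (monom_degree \<alpha>)"
  unfolding mval_def monom_degree_def by (intro keys_prod keys_power assms) auto

lemma keys_subst:
  assumes "keys p \<subseteq> monoms B n" "\<And>v. v \<in> B \<Longrightarrow> keys (y v) \<subseteq> A 1"
  shows "keys (subst Const y p) \<subseteq> A n"
  unfolding subst_def mval_def[symmetric]
proof (rule keys_sum_subset)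
  fix m assume "m \<in> keys p"
  then have m: "keys m \<subseteq> B" "monom_degree m \<le> n" using assms(1) by (auto simp: monoms_def)
  have "keys (mval y m) \<subseteq> A (monom_degree m)" using m assms(2) by (intro keys_mval) auto
  moreover have "A (monom_degree m) \<subseteq> A n" using m by (intro mono)
  ultimately have "keys (mval y m) \<subseteq> A n" by blast
  then show "keys (Const (lookup p m) * mval y m) \<subseteq> A n"
    by (intro keys_mult_graded[of "{0}" "A n" "A n" "Const (lookup p m)" "mval y m"] keys_Const) auto
qed

end

lemma keys_mval_monoms:
  assumes "\<And>j. j \<in> keys \<alpha> \<Longrightarrow> keys (g j) \<subseteq> monoms A e"
  shows "keys (mval g \<alpha>) \<subseteq> monoms A (monom_degree \<alpha> * e)"
proof -
  interpret monom_grading "\<lambda>i. monoms A (i * e)"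
    by unfold_locales (auto simp: monoms_def keys_add_nat algebra_simps intro: order.trans)
  show ?thesis using assms by (intro keys_mval) simp
qed

lemma monoms_mono: "n \<le> n' \<Longrightarrow> A \<subseteq> A' \<Longrightarrow> monoms A n \<subseteq> monoms A' n'"
  by (auto simp: monoms_def)

text \<open>Each of the factors \<open>q + 1\<close>, ..., \<open>q + j\<close> is at least
  \<open>q + 1\<close>. This bounds from below the number of monomials of degree at most
  \<open>q\<close> in \<open>j\<close> variables.\<close>

lemma power_le_fact_binomial: "(q + 1) ^ j \<le> fact j * ((q + j) choose j)"
proof (induction j)
  case (Suc j)
  have "(q + 1) ^ Suc j \<le> (q + j + 1) * (fact j * ((q + j) choose j))"
    using mult_le_mono[OF _ Suc, of "q + 1" "q + j + 1"] by simp
  also have "\<dots> = fact j * (Suc (q + j) * ((q + j) choose j))" by (simp add: algebra_simps)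
  also have "\<dots> = fact j * (Suc j * (Suc (q + j) choose Suc j))"
    by (simp only: Suc_times_binomial)
  also have "\<dots> = fact (Suc j) * ((q + Suc j) choose Suc j)" by (simp add: algebra_simps)
  finally show ?case .
qed auto

text \<open>The monomials of degree at most \<open>q\<close> in the \<open>g j\<close> number about
  \<open>q ^ card J\<close>, but they lie in a space of dimension about \<open>q ^ card A\<close>.
  For large \<open>q\<close> they are linearly dependent.\<close>

theorem algebraic_dependence:
  fixes g :: "'j \<Rightarrow> 'v mpoly"
  assumes "finite J" "finite A" "card A < card J"
    and "\<And>j m. j \<in> J \<Longrightarrow> m \<in> keys (g j) \<Longrightarrow> keys m \<subseteq> A"
  obtains Q :: "'j mpoly" where "Q \<noteq> 0" "\<And>m. m \<in> keys Q \<Longrightarrow> keys m \<subseteq> J"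
    "\<And>x. poly_eval (\<lambda>j. poly_eval x (g j)) Q = 0"
proof -
  define e where "e = (\<Sum>j\<in>J. \<Sum>m\<in>keys (g j). monom_degree m)"
  have g: "keys (g j) \<subseteq> monoms A e" if j: "j \<in> J" for j
  proof
    fix m assume m: "m \<in> keys (g j)"
    have "monom_degree m \<le> (\<Sum>m\<in>keys (g j). monom_degree m)"
      using m by (intro member_le_sum) auto
    also have "\<dots> \<le> e" unfolding e_def using j assms(1) by (intro member_le_sum) auto
    finally show "m \<in> monoms A e" using assms(4)[OF j m] by (simp add: monoms_def)
  qed
  define a where "a = card A"
  define N where "N = (fact (card J) :: nat)"
  \<comment> \<open>\<open>N\<close> compares binomials with powers. The second factor makes
    \<open>N\<close> times the number of available monomials at most \<open>q * (q + 1) ^ a\<close>,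
    just below the next power of \<open>q + 1\<close>.\<close>
  define q where "q = N * (e + a) ^ a"
  have "N * (((q * e + a) choose a)) \<le> N * (q * e + a) ^ a"
    by (intro mult_le_mono binomial_le_pow) auto
  also have "\<dots> \<le> N * ((q + 1) * (e + a)) ^ a"
    by (intro mult_le_mono power_mono) (auto simp: algebra_simps)
  also have "\<dots> = q * (q + 1) ^ a" unfolding q_def by (simp only: power_mult_distrib ac_simps)
  also have "\<dots> < (q + 1) ^ (a + 1)" by simp
  also have "\<dots> \<le> (q + 1) ^ card J" using assms(3) by (intro power_increasing) (auto simp: a_def)
  also have "\<dots> \<le> N * ((q + card J) choose card J)"
    unfolding N_def by (rule power_le_fact_binomial)
  finally have less: "card (monoms A (q * e)) < card (monoms J q)"
    using assms(1,2) by (simp add: card_monoms a_def)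
  have ex: "\<exists>c. \<forall>x\<in>UNIV. poly_eval x (mval g \<alpha>) = (\<Sum>m\<in>monoms A (q * e). c m * mval x m)"
    if \<alpha>: "\<alpha> \<in> monoms J q" for \<alpha>
  proof -
    have "keys (mval g \<alpha>) \<subseteq> monoms A (monom_degree \<alpha> * e)"
      using \<alpha> by (intro keys_mval_monoms g) (auto simp: monoms_def)
    also have "\<dots> \<subseteq> monoms A (q * e)" using \<alpha> by (intro monoms_mono) (auto simp: monoms_def)
    finally have "poly_eval x (mval g \<alpha>) = (\<Sum>m\<in>monoms A (q * e). lookup (mval g \<alpha>) m * mval x m)" for x
      by (intro poly_eval_superset finite_monoms assms(2))
    then show ?thesis by blast
  qed
  show ?thesis
  proof (rule functions_linear_dependent[OF finite_monoms[OF assms(2)] finite_monoms[OF assms(1)] less ex])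
    fix c assume c: "\<exists>j\<in>monoms J q. c j \<noteq> 0"
      "\<And>x. x \<in> UNIV \<Longrightarrow> (\<Sum>\<alpha>\<in>monoms J q. c \<alpha> * poly_eval x (mval g \<alpha>)) = 0"
    define Q where "Q = (\<Sum>\<alpha>\<in>monoms J q. single \<alpha> (c \<alpha>))"
    have Q: "lookup Q \<alpha> = (if \<alpha> \<in> monoms J q then c \<alpha> else 0)" for \<alpha>
      unfolding Q_def lookup_sum lookup_single when_def
      using finite_monoms[OF assms(1)] by (simp add: sum.delta)
    show ?thesis
    proof (rule that[of Q])
      from c(1) obtain \<alpha> where "\<alpha> \<in> monoms J q" "c \<alpha> \<noteq> 0" by blast
      then have "lookup Q \<alpha> \<noteq> 0" by (simp add: Q)
      then show "Q \<noteq> 0" by auto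
      show "keys m \<subseteq> J" if "m \<in> keys Q" for m
        using that Q[of m] by (auto simp: in_keys_iff monoms_def split: if_splits)
      show "poly_eval (\<lambda>j. poly_eval x (g j)) Q = 0" for x
        using c(2)[of x] by (simp add: Q_def eval.hom_sum)
    qed
  qed
qed

section \<open>Quantifier elimination\<close>

lemma comm_ring_hom_map_poly:
  fixes h :: "'a::comm_ring_1 \<Rightarrow> 'b::comm_ring_1"
  assumes "comm_ring_hom h"
  shows "comm_ring_hom (map_poly h)"
proof -
  interpret comm_ring_hom h by fact
  show ?thesis
    by unfold_locales
      (auto intro!: poly_eqI simp: coeff_map_poly coeff_mult hom_add hom_mult hom_sum)
qed

definition peval :: "('v \<Rightarrow> complex) \<Rightarrow> 'v mpoly poly \<Rightarrow> complex poly" where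
  "peval x = map_poly (poly_eval x)"

lemma coeff_peval [simp]: "coeff (peval x p) k = poly_eval x (coeff p k)"
  by (simp add: peval_def coeff_map_poly)

global_interpretation peval: comm_ring_hom "peval x" for x
  unfolding peval_def by (rule comm_ring_hom_map_poly[OF comm_ring_hom_poly_eval])

lemma peval_smult [simp]: "peval x (smult a p) = smult (poly_eval x a) (peval x p)"
  by (rule poly_eqI) (simp add: eval.hom_mult)

lemma peval_pCons [simp]: "peval x (pCons a p) = pCons (poly_eval x a) (peval x p)"
  by (rule poly_eqI) (simp add: coeff_pCons split: nat.splits)

lemma peval_monom [simp]: "peval x (monom a k) = monom (poly_eval x a) k"
  by (rule poly_eqI) simp

definition as_poly :: "'v \<Rightarrow> 'v mpoly \<Rightarrow> 'v mpoly poly" where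
  "as_poly i = subst (\<lambda>a. [:Const a:]) (\<lambda>v. if v = i then [:0, 1:] else [:Var v:])"

global_interpretation as_poly: comm_ring_hom "as_poly i" for i
  unfolding as_poly_def
  by (intro coeff_hom.comm_ring_hom_subst coeff_homI
    comm_ring_hom_comp[OF comm_ring_hom_pCons comm_ring_hom_Const])

lemma poly_peval_as_poly [simp]:
  "poly (peval x (as_poly i p)) t = poly_eval (x(i := t)) p"
proof -
  have hom: "comm_ring_hom (\<lambda>q. poly (peval x q) t)"
    by unfold_locales (auto simp: peval.hom_add peval.hom_mult)
  have "poly (peval x (as_poly i p)) t = subst (\<lambda>a. poly (peval x [:Const a:]) t)
      (\<lambda>v. poly (peval x (if v = i then [:0, 1:] else [:Var v:])) t) p"
    unfolding as_poly_def by (rule hom_subst[OF hom])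
  also have "\<dots> = poly_eval (x(i := t)) p"
    unfolding poly_eval_def by (intro arg_cong2[where f = "\<lambda>a b. subst a b p"]) auto
  finally show ?thesis .
qed

text \<open>A Boolean combination of polynomial equations, encoded without syntax: \<beta> sees only
  which members of \<open>F\<close> vanish at the point.\<close>

definition constructible :: "(('v \<Rightarrow> complex) \<Rightarrow> bool) \<Rightarrow> bool" where
  "constructible \<phi> \<longleftrightarrow>
     (\<exists>F \<beta>. finite F \<and> (\<forall>x. \<phi> x \<longleftrightarrow> \<beta> {p\<in>F. poly_eval x p = 0}))"

lemma constructible_zero: "constructible (\<lambda>x. poly_eval x p = 0)"
  unfolding constructible_def by (intro exI[of _ "{p}"] exI[of _ "\<lambda>S. p \<in> S"]) auto

lemma constructible_not: "constructible \<phi> \<Longrightarrow> constructible (\<lambda>x. \<not> \<phi> x)"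
proof -
  assume "constructible \<phi>"
  then obtain F \<beta> where "finite F" "\<forall>x. \<phi> x \<longleftrightarrow> \<beta> {p\<in>F. poly_eval x p = 0}"
    unfolding constructible_def by blast
  then show ?thesis unfolding constructible_def
    by (intro exI[of _ F] exI[of _ "\<lambda>S. \<not> \<beta> S"]) simp
qed

lemma constructible_conj:
  assumes "constructible \<phi>" "constructible \<psi>"
  shows "constructible (\<lambda>x. \<phi> x \<and> \<psi> x)"
proof -
  from assms(1) obtain F \<beta> where 1: "finite F" "\<And>x. \<phi> x \<longleftrightarrow> \<beta> {p\<in>F. poly_eval x p = 0}"
    unfolding constructible_def by blast
  from assms(2) obtain F' \<beta>' where 2: "finite F'" "\<And>x. \<psi> x \<longleftrightarrow> \<beta>' {p\<in>F'. poly_eval x p = 0}"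
    unfolding constructible_def by blast
  have *: "{p\<in>F \<union> F'. poly_eval x p = 0} \<inter> F = {p\<in>F. poly_eval x p = 0}"
    "{p\<in>F \<union> F'. poly_eval x p = 0} \<inter> F' = {p\<in>F'. poly_eval x p = 0}" for x by auto
  show ?thesis unfolding constructible_def
    by (intro exI[of _ "F \<union> F'"] exI[of _ "\<lambda>S. \<beta> (S \<inter> F) \<and> \<beta>' (S \<inter> F')"])
      (simp only: * 1 2 finite_Un simp_thms)
qed

lemma constructible_disj:
  assumes "constructible \<phi>" "constructible \<psi>"
  shows "constructible (\<lambda>x. \<phi> x \<or> \<psi> x)"
  using constructible_not[OF constructible_conj[OF assms[THEN constructible_not]]] by simp

lemma constructible_const: "constructible (\<lambda>x. b)"
  unfolding constructible_def by (intro exI[of _ "{}"] exI[of _ "\<lambda>S. b"]) simp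

lemma constructible_ball:
  "finite A \<Longrightarrow> (\<And>a. a \<in> A \<Longrightarrow> constructible (\<phi> a)) \<Longrightarrow> constructible (\<lambda>x. \<forall>a\<in>A. \<phi> a x)"
proof (induction A rule: finite_induct)
  case empty
  then show ?case using constructible_const[of True] by simp
next
  case (insert a A)
  then show ?case using constructible_conj[of "\<phi> a" "\<lambda>x. \<forall>a\<in>A. \<phi> a x"] by simp
qed

lemma constructible_bex:
  assumes "finite A" "\<And>a. a \<in> A \<Longrightarrow> constructible (\<phi> a)"
  shows "constructible (\<lambda>x. \<exists>a\<in>A. \<phi> a x)"
  using constructible_not[OF constructible_ball[OF assms(1), of "\<lambda>a x. \<not> \<phi> a x"]]
    constructible_not[OF assms(2)] by simp

lemma constructible_peval_eq_0: "constructible (\<lambda>x. peval x q = 0)"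
proof -
  have "peval x q = 0 \<longleftrightarrow> (\<forall>k\<in>{..degree q}. poly_eval x (coeff q k) = 0)" for x
  proof
    assume *: "\<forall>k\<in>{..degree q}. poly_eval x (coeff q k) = 0"
    show "peval x q = 0"
    proof (rule poly_eqI)
      show "coeff (peval x q) k = coeff 0 k" for k
        using * by (cases "k \<le> degree q") (auto simp: coeff_eq_0)
    qed
  qed (auto simp flip: coeff_peval)
  then show ?thesis by (simp only:) (intro constructible_ball constructible_zero finite_atMost)
qed

lemma pseudo_remainder:
  fixes f g :: "'a::comm_ring_1 poly"
  assumes "g \<noteq> 0"
  obtains k q r where "smult (lead_coeff g ^ k) f = g * q + r" "r = 0 \<or> degree r < degree g"
  using pseudo_divmod[OF assms, of f "fst (pseudo_divmod f g)" "snd (pseudo_divmod f g)"]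
  by (metis prod.collapse)

text \<open>Every step either deletes a leading term or replaces a polynomial by its
  pseudo-remainder modulo one of smallest degree; a single remaining equation is decided by
  the univariate Nullstellensatz.\<close>

lemma constructible_ex_root:
  fixes P :: "'v mpoly poly set"
  assumes "finite P"
  shows "constructible (\<lambda>x. \<exists>t. (\<forall>p\<in>P. poly (peval x p) t = 0) \<and> poly (peval x q) t \<noteq> 0)"
  using assms
proof (induction "\<Sum>p\<in>P. if p = 0 then 0 else Suc (degree p)" arbitrary: P rule: less_induct)
  case less
  \<comment> \<open>The successor makes a nonzero constant heavier than the zero polynomial, so that
    deleting its only term is progress too.\<close>
  define \<mu> where "\<mu> p = (if p = 0 then 0 else Suc (degree p))" for p :: "'v mpoly poly"
  define \<phi> where
    "\<phi> P = (\<lambda>x. \<exists>t. (\<forall>p\<in>P. poly (peval x p) t = 0) \<and> poly (peval x q) t \<noteq> 0)"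
    for P :: "'v mpoly poly set"
  have IH: "constructible (\<phi> (insert r' (P - {r})))" if "r \<in> P" "\<mu> r' < \<mu> r" for r r'
  proof -
    have "(\<Sum>p\<in>insert r' (P - {r}). \<mu> p) \<le> \<mu> r' + (\<Sum>p\<in>P - {r}. \<mu> p)"
      using less.prems by (cases "r' \<in> P - {r}") (auto simp: insert_absorb)
    also have "\<dots> < (\<Sum>p\<in>P. \<mu> p)"
      using that sum.remove[OF less.prems that(1), of \<mu>] by simp
    finally show ?thesis
      unfolding \<phi>_def \<mu>_def using less.prems by (intro less.hyps) auto
  qed
  have "constructible (\<phi> P)"
  proof (cases "\<exists>p\<in>P. p \<noteq> 0")
    case False
    have "\<phi> P x \<longleftrightarrow> \<not> peval x q = 0" for x
    proof -
      have "poly (peval x p) t = 0" if "p \<in> P" for p t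
      proof -
        have "p = 0" using False that by blast
        then show ?thesis by simp
      qed
      then have "\<phi> P x \<longleftrightarrow> (\<exists>t. poly (peval x q) t \<noteq> 0)" by (simp add: \<phi>_def)
      then show ?thesis by (simp only: poly_all_0_iff_0[symmetric] not_all)
    qed
    then have "\<phi> P = (\<lambda>x. \<not> peval x q = 0)" by (rule ext)
    then show ?thesis using constructible_not[OF constructible_peval_eq_0] by simp
  next
    case True
    then obtain p0 where "p0 \<in> P \<and> p0 \<noteq> 0" by blast
    from ex_has_least_nat[of "\<lambda>p. p \<in> P \<and> p \<noteq> 0", OF this, of degree]
    obtain p where p: "p \<in> P" "p \<noteq> 0" "\<And>r. r \<in> P \<Longrightarrow> r \<noteq> 0 \<Longrightarrow> degree p \<le> degree r"
      by blast
    define c where "c = lead_coeff p"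
    define p' where "p' = p - monom c (degree p)"
    have "\<mu> p' < \<mu> p"
    proof (cases "p' = 0")
      case False
      have "degree p' < degree p"
      proof -
        have "degree p' \<le> degree p" unfolding p'_def by (rule degree_diff_le) (auto intro: degree_monom_le)
        moreover have "coeff p' (degree p) = 0" by (simp add: p'_def c_def)
        ultimately show ?thesis using False
          by (metis le_neq_implies_less leading_coeff_0_iff)
      qed
      then show ?thesis using p(2) by (simp add: \<mu>_def)
    qed (use p in \<open>simp add: \<mu>_def\<close>)
    from IH[OF p(1) this] have 1: "constructible (\<phi> (insert p' (P - {p})))" .
    have eq1: "\<phi> P x \<longleftrightarrow> \<phi> (insert p' (P - {p})) x" if "poly_eval x c = 0" for x
    proof -
      have "peval x p' = peval x p" using that by (simp add: p'_def peval.hom_minus)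
      moreover have "(\<forall>p\<in>P. poly (peval x p) t = 0) \<longleftrightarrow>
          poly (peval x p) t = 0 \<and> (\<forall>p\<in>P - {p}. poly (peval x p) t = 0)" for t
        using p(1) by blast
      ultimately show ?thesis by (simp add: \<phi>_def)
    qed
    have "\<exists>\<psi>. constructible \<psi> \<and> (\<forall>x. poly_eval x c \<noteq> 0 \<longrightarrow> (\<phi> P x \<longleftrightarrow> \<psi> x))"
    proof (cases "\<exists>r\<in>P - {p}. r \<noteq> 0")
      case True
      then obtain r where r: "r \<in> P" "r \<noteq> p" "r \<noteq> 0" by blast
      obtain k a r' where r': "smult (c ^ k) r = p * a + r'" "r' = 0 \<or> degree r' < degree p"
        using pseudo_remainder[OF p(2)] unfolding c_def by blast
      have "\<mu> r' < \<mu> r" using r' p(3)[OF r(1,3)] r(3) by (auto simp: \<mu>_def)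
      from IH[OF r(1) this] have 2: "constructible (\<phi> (insert r' (P - {r})))" .
      have "\<phi> P x \<longleftrightarrow> \<phi> (insert r' (P - {r})) x" if c: "poly_eval x c \<noteq> 0" for x
      proof -
        have "smult (poly_eval x c ^ k) (peval x r) = peval x p * peval x a + peval x r'"
          using arg_cong[OF r'(1), of "peval x"]
          by (simp add: peval.hom_add peval.hom_mult eval.hom_power)
        then have *: "poly_eval x c ^ k * poly (peval x r) t
            = poly (peval x p) t * poly (peval x a) t + poly (peval x r') t" for t
          by (metis poly_add poly_mult poly_smult)
        have "poly (peval x r) t = 0 \<longleftrightarrow> poly (peval x r') t = 0"
          if "poly (peval x p) t = 0" for t using *[of t] that c by auto
        moreover have "p \<in> P - {r}" using p r by blast
        ultimately have "(\<forall>p\<in>P. poly (peval x p) t = 0) \<longleftrightarrow>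
            (\<forall>p\<in>insert r' (P - {r}). poly (peval x p) t = 0)" for t
          using r(1) by blast
        then show ?thesis by (simp only: \<phi>_def)
      qed
      with 2 show ?thesis by blast
    next
      case False
      \<comment> \<open>The degree bounds the multiplicities of the roots, so every root of
        \<open>p\<close> is a root of \<open>q\<close> iff \<open>p\<close> divides this power of
        \<open>q\<close>. Pseudo-division tests this uniformly in \<open>x\<close>, as long as the
        leading coefficient survives.\<close>
      obtain k a r where r: "smult (c ^ k) (q ^ degree p) = p * a + r" "r = 0 \<or> degree r < degree p"
        using pseudo_remainder[OF p(2)] unfolding c_def by blast
      have "\<phi> P x \<longleftrightarrow> \<not> peval x r = 0" if c: "poly_eval x c \<noteq> 0" for x
      proof -
        have "degree (peval x p) \<le> degree p"
          by (rule degree_le) (auto simp: coeff_eq_0)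
        moreover have "coeff (peval x p) (degree p) \<noteq> 0" using c by (simp add: c_def)
        ultimately have deg: "degree (peval x p) = degree p" and nz: "peval x p \<noteq> 0"
          using le_degree[of "peval x p" "degree p"] by (auto simp del: coeff_peval)
        have "(\<forall>p\<in>P. poly (peval x p) t = 0) \<longleftrightarrow> poly (peval x p) t = 0" for t
        proof
          assume "poly (peval x p) t = 0"
          moreover have "p' = p \<or> p' = 0" if "p' \<in> P" for p' using False that by blast
          ultimately show "\<forall>p\<in>P. poly (peval x p) t = 0" by fastforce
        qed (use p(1) in blast)
        then have "\<phi> P x \<longleftrightarrow> \<not> (\<forall>t. poly (peval x p) t = 0 \<longrightarrow> poly (peval x q) t = 0)"
          unfolding \<phi>_def by simp
        also have "\<dots> \<longleftrightarrow> \<not> peval x p dvd peval x q ^ degree p"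
          using nz by (simp only: nullstellensatz_univariate deg) simp
        also have "peval x p dvd peval x q ^ degree p \<longleftrightarrow> peval x r = 0"
        proof -
          have *: "smult (poly_eval x c ^ k) (peval x q ^ degree p) = peval x p * peval x a + peval x r"
            using arg_cong[OF r(1), of "peval x"]
            by (simp add: peval.hom_add peval.hom_mult peval.hom_power eval.hom_power)
          have "peval x p dvd peval x q ^ degree p \<longleftrightarrow>
              peval x p dvd smult (poly_eval x c ^ k) (peval x q ^ degree p)"
            using c by (simp add: dvd_smult_iff)
          also have "\<dots> \<longleftrightarrow> peval x p dvd peval x r"
            unfolding * by (rule dvd_add_right_iff) simp
          also have "\<dots> \<longleftrightarrow> peval x r = 0"
          proof
            assume "peval x p dvd peval x r"
            show "peval x r = 0"
            proof (rule ccontr)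
              assume nz': "peval x r \<noteq> 0"
              have "degree (peval x r) \<le> degree r" by (rule degree_le) (auto simp: coeff_eq_0)
              moreover have "degree (peval x p) \<le> degree (peval x r)"
                using \<open>peval x p dvd peval x r\<close> nz' by (rule dvd_imp_degree_le)
              moreover have "r \<noteq> 0" using nz' by auto
              ultimately show False using r(2) deg by simp
            qed
          qed simp
          finally show ?thesis .
        qed
        finally show ?thesis .
      qed
      then show ?thesis using constructible_not[OF constructible_peval_eq_0[of r]] by blast
    qed
    then obtain \<psi> where \<psi>: "constructible \<psi>"
      "\<And>x. poly_eval x c \<noteq> 0 \<Longrightarrow> \<phi> P x \<longleftrightarrow> \<psi> x" by blast
    have "\<phi> P = (\<lambda>x. poly_eval x c = 0 \<and> \<phi> (insert p' (P - {p})) x \<or> \<not> poly_eval x c = 0 \<and> \<psi> x)"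
      using eq1 \<psi>(2) by (intro ext) blast
    then show ?thesis
      using constructible_disj[OF constructible_conj[OF constructible_zero 1]
        constructible_conj[OF constructible_not[OF constructible_zero] \<psi>(1)]] by simp
  qed
  then show ?case by (simp only: \<phi>_def)
qed

text \<open>Split by the set \<open>S\<close> of those members of \<open>F\<close> that vanish. For
  each \<open>S\<close> this is a system of equations with a single inequation, the product of the
  remaining members.\<close>

lemma constructible_ex:
  assumes "constructible \<phi>"
  shows "constructible (\<lambda>x. \<exists>t. \<phi> (x(i := t)))"
proof -
  from assms obtain F \<beta> where F: "finite F" "\<And>x. \<phi> x \<longleftrightarrow> \<beta> {p\<in>F. poly_eval x p = 0}"
    unfolding constructible_def by blast
  define \<chi> where "\<chi> S = (\<lambda>x. \<exists>t. (\<forall>p\<in>as_poly i ` S. poly (peval x p) t = 0) \<and>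
      poly (peval x (as_poly i (\<Prod>p\<in>F - S. p))) t \<noteq> 0)" for S
  have \<chi>: "\<chi> S x \<longleftrightarrow> (\<exists>t. {p\<in>F. poly_eval (x(i := t)) p = 0} = S)" if "S \<subseteq> F" for S x
  proof -
    have "(\<forall>p\<in>as_poly i ` S. poly (peval x p) t = 0) \<and>
        poly (peval x (as_poly i (\<Prod>p\<in>F - S. p))) t \<noteq> 0
      \<longleftrightarrow> (\<forall>p\<in>S. poly_eval (x(i := t)) p = 0) \<and> (\<forall>p\<in>F - S. poly_eval (x(i := t)) p \<noteq> 0)" for t
      using F(1) by (simp add: eval.hom_prod)
    also have "\<dots> t \<longleftrightarrow> {p\<in>F. poly_eval (x(i := t)) p = 0} = S" for t using that by blast
    finally show ?thesis by (simp only: \<chi>_def)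
  qed
  have "(\<exists>t. \<phi> (x(i := t))) \<longleftrightarrow> (\<exists>S\<in>{S\<in>Pow F. \<beta> S}. \<chi> S x)" for x
  proof
    assume "\<exists>t. \<phi> (x(i := t))"
    then obtain t where "\<phi> (x(i := t))" ..
    then show "\<exists>S\<in>{S\<in>Pow F. \<beta> S}. \<chi> S x"
      using F(2) by (intro bexI[of _ "{p\<in>F. poly_eval (x(i := t)) p = 0}"]) (auto simp: \<chi>)
  next
    assume "\<exists>S\<in>{S\<in>Pow F. \<beta> S}. \<chi> S x"
    then show "\<exists>t. \<phi> (x(i := t))" using F(2) by (auto simp: \<chi>)
  qed
  moreover have "constructible (\<lambda>x. \<exists>S\<in>{S\<in>Pow F. \<beta> S}. \<chi> S x)"
    unfolding \<chi>_def using F(1)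
    by (intro constructible_bex constructible_ex_root) (auto intro: finite_subset)
  ultimately show ?thesis by simp
qed

lemma constructible_ex_finite:
  assumes "finite I" "constructible \<phi>"
  shows "constructible (\<lambda>x. \<exists>y. \<phi> (\<lambda>v. if v \<in> I then y v else x v))"
  using assms
proof (induction I arbitrary: \<phi> rule: finite_induct)
  case (insert i I)
  have "constructible (\<lambda>x. \<exists>y. \<exists>t. \<phi> ((\<lambda>v. if v \<in> I then y v else x v)(i := t)))"
    by (intro insert.IH constructible_ex insert.prems)
  moreover have "(\<exists>y. \<exists>t. \<phi> ((\<lambda>v. if v \<in> I then y v else x v)(i := t))) \<longleftrightarrow>
      (\<exists>y. \<phi> (\<lambda>v. if v \<in> insert i I then y v else x v))" for x
  proof
    assume "\<exists>y. \<exists>t. \<phi> ((\<lambda>v. if v \<in> I then y v else x v)(i := t))"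
    then obtain y t where *: "\<phi> ((\<lambda>v. if v \<in> I then y v else x v)(i := t))" by blast
    have "(\<lambda>v. if v \<in> I then y v else x v)(i := t)
        = (\<lambda>v. if v \<in> insert i I then (y(i := t)) v else x v)"
      by (auto simp: fun_eq_iff)
    with * show "\<exists>y. \<phi> (\<lambda>v. if v \<in> insert i I then y v else x v)"
      by (intro exI[of _ "y(i := t)"]) (simp only:)
  next
    assume "\<exists>y. \<phi> (\<lambda>v. if v \<in> insert i I then y v else x v)"
    then obtain y where *: "\<phi> (\<lambda>v. if v \<in> insert i I then y v else x v)" ..
    have "(\<lambda>v. if v \<in> insert i I then y v else x v)
        = (\<lambda>v. if v \<in> I then y v else x v)(i := y i)" by (auto simp: fun_eq_iff)
    with * show "\<exists>y. \<exists>t. \<phi> ((\<lambda>v. if v \<in> I then y v else x v)(i := t))"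
      by (intro exI[of _ y] exI[of _ "y i"]) (simp only:)
  qed
  ultimately show ?case by simp
qed simp

text \<open>Where no nonzero member of \<open>F\<close> vanishes, the set of vanishing members is
  constant, hence so is the truth value.\<close>

lemma constructible_dichotomy:
  assumes "constructible \<phi>"
  obtains p where "p \<noteq> 0"
    "(\<forall>x. poly_eval x p \<noteq> 0 \<longrightarrow> \<phi> x) \<or> (\<forall>x. poly_eval x p \<noteq> 0 \<longrightarrow> \<not> \<phi> x)"
proof -
  from assms obtain F \<beta> where F: "finite F" "\<And>x. \<phi> x \<longleftrightarrow> \<beta> {p\<in>F. poly_eval x p = 0}"
    unfolding constructible_def by blast
  define p where "p = (\<Prod>p\<in>F - {0}. p)"
  have "\<exists>x. \<forall>p\<in>F - {0}. poly_eval x p \<noteq> 0"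
    using F(1) by (intro common_nonzero_finite) (auto simp: mpoly_eq_0_iff)
  then obtain x0 where "\<forall>p\<in>F - {0}. poly_eval x0 p \<noteq> 0" ..
  then have "poly_eval x0 p \<noteq> 0" using F(1) by (simp add: p_def eval.hom_prod)
  then have "p \<noteq> 0" by auto
  moreover have "\<phi> x \<longleftrightarrow> \<beta> (F \<inter> {0})" if "poly_eval x p \<noteq> 0" for x
  proof -
    have "\<forall>p\<in>F - {0}. poly_eval x p \<noteq> 0" using that F(1) by (simp add: p_def eval.hom_prod)
    then have "{p\<in>F. poly_eval x p = 0} = F \<inter> {0}" by auto
    then show ?thesis using F(2) by simp
  qed
  ultimately show ?thesis using that by blast
qed

section \<open>The number of points of a generic fibre\<close>

definition fibre :: "('p + 's) mpoly set \<Rightarrow> ('p \<Rightarrow> complex) \<Rightarrow> ('s \<Rightarrow> complex) set" where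
  "fibre H y = {s. \<forall>h\<in>H. poly_eval (case_sum y s) h = 0}"

text \<open>Since \<open>card\<close> is \<open>0\<close> on infinite sets, lower bounds on sizes
  are stated by injections. In this form they are also existential statements about \<open>m\<close>
  points, open to quantifier elimination.\<close>

definition at_least :: "nat \<Rightarrow> 'a set \<Rightarrow> bool" where
  "at_least m S \<longleftrightarrow> (\<exists>g. inj_on g {..<m} \<and> g ` {..<m} \<subseteq> S)"

lemma at_least_iff_card: "at_least m S \<longleftrightarrow> infinite S \<or> m \<le> card S"
proof
  assume "at_least m S"
  then obtain g where g: "inj_on g {..<m}" "g ` {..<m} \<subseteq> S" by (auto simp: at_least_def)
  then show "infinite S \<or> m \<le> card S"
    using card_inj_on_le[OF g] by (cases "finite S") simp_all
next
  assume "infinite S \<or> m \<le> card S"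
  then have "\<exists>T. finite T \<and> card T = m \<and> T \<subseteq> S"
  proof
    assume "infinite S"
    then show ?thesis by (rule infinite_arbitrarily_large)
  next
    assume le: "m \<le> card S"
    show ?thesis
    proof (cases "finite S")
      case True
      show ?thesis by (rule obtain_subset_with_card_n[OF le]) (use True finite_subset in auto)
    qed (rule infinite_arbitrarily_large)
  qed
  then obtain T where T: "T \<subseteq> S" "finite T" "card T = m" by blast
  obtain g where "bij_betw g {..<m} T"
    using ex_bij_betw_nat_finite[OF T(2)] T(3) by (auto simp: atLeast0LessThan)
  then show "at_least m S"
    using T(1) unfolding at_least_def bij_betw_def by blast
qed

text \<open>Distinct points of a fibre become \<open>m\<close> blocks of additional variables,
  subject to equations and inequations; eliminating them leaves a condition on the parameter
  alone.\<close>

lemma at_least_fibre_dichotomy: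
  fixes H :: "('p + 's::finite) mpoly set"
  assumes "finite H"
  obtains p where "p \<noteq> 0"
    "(\<forall>y. poly_eval y p \<noteq> 0 \<longrightarrow> at_least m (fibre H y)) \<or>
     (\<forall>y. poly_eval y p \<noteq> 0 \<longrightarrow> \<not> at_least m (fibre H y))"
proof -
  define pt where "pt x j s = x (Inr (j, s))" for x :: "'p + nat \<times> 's \<Rightarrow> complex" and j :: nat and s :: 's
  define \<phi> where "\<phi> x \<longleftrightarrow>
      (\<forall>j\<in>{..<m}. \<forall>h\<in>H. poly_eval (case_sum (\<lambda>a. x (Inl a)) (pt x j)) h = 0) \<and>
      (\<forall>i\<in>{..<m}. \<forall>j\<in>{..<m} - {i}. \<exists>s\<in>UNIV. pt x i s \<noteq> pt x j s)"
    for x :: "'p + nat \<times> 's \<Rightarrow> complex"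
  have 1: "constructible (\<lambda>x. poly_eval (case_sum (\<lambda>a. x (Inl a)) (pt x j)) h = 0)" for j h
  proof -
    have "poly_eval (case_sum (\<lambda>a. x (Inl a)) (pt x j)) h =
        poly_eval x (subst Const (\<lambda>v. Var (case v of Inl a \<Rightarrow> Inl a | Inr s \<Rightarrow> Inr (j, s))) h)" for x
      by simp (intro poly_eval_cong, auto simp: pt_def split: sum.splits)
    then show ?thesis by (simp only: constructible_zero)
  qed
  have 2: "constructible (\<lambda>x. pt x i s \<noteq> pt x j s)" for i j s
  proof -
    have "pt x i s \<noteq> pt x j s \<longleftrightarrow> \<not> poly_eval x (Var (Inr (i, s)) - Var (Inr (j, s))) = 0" for x
      by (simp add: pt_def eval.hom_minus)
    then show ?thesis by (simp only: constructible_not[OF constructible_zero])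
  qed
  have "constructible \<phi>"
    unfolding \<phi>_def using assms
    by (intro constructible_conj constructible_ball constructible_bex 1 2) auto
  define I where "I = (Inr ` ({..<m} \<times> UNIV) :: ('p + nat \<times> 's) set)"
  have "finite I" by (simp add: I_def)
  from constructible_ex_finite[OF this \<open>constructible \<phi>\<close>]
  have con: "constructible (\<lambda>x. \<exists>y. \<phi> (\<lambda>v. if v \<in> I then y v else x v))" .
  have iff: "(\<exists>y. \<phi> (\<lambda>v. if v \<in> I then y v else x v)) \<longleftrightarrow> at_least m (fibre H (\<lambda>a. x (Inl a)))"
    (is "?L \<longleftrightarrow> ?R") for x
  proof
    assume ?L
    then obtain y where y: "\<phi> (\<lambda>v. if v \<in> I then y v else x v)" ..
    let ?x = "\<lambda>v. if v \<in> I then y v else x v"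
    have x: "?x (Inl a) = x (Inl a)" for a by (auto simp: I_def)
    show ?R unfolding at_least_def
    proof (intro exI[of _ "pt ?x"] conjI inj_onI)
      show "i = j" if "i \<in> {..<m}" "j \<in> {..<m}" "pt ?x i = pt ?x j" for i j
      proof (rule ccontr)
        assume "i \<noteq> j"
        then have "j \<in> {..<m} - {i}" using that(2) by blast
        moreover have "\<forall>i\<in>{..<m}. \<forall>j\<in>{..<m} - {i}. \<exists>s\<in>UNIV. pt ?x i s \<noteq> pt ?x j s"
          using y unfolding \<phi>_def by (rule conjunct2)
        ultimately have "\<exists>s\<in>UNIV. pt ?x i s \<noteq> pt ?x j s" using that(1) by (simp only: Ball_def)
        then obtain s where "pt ?x i s \<noteq> pt ?x j s" by (elim bexE)
        then show False by (simp only: that(3))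
      qed
      show "pt ?x ` {..<m} \<subseteq> fibre H (\<lambda>a. x (Inl a))"
      proof
        fix s assume "s \<in> pt ?x ` {..<m}"
        then obtain j where j: "j \<in> {..<m}" "s = pt ?x j" ..
        have "\<forall>h\<in>H. poly_eval (case_sum (\<lambda>a. ?x (Inl a)) (pt ?x j)) h = 0"
          using y j(1) unfolding \<phi>_def by simp
        then show "s \<in> fibre H (\<lambda>a. x (Inl a))"
          unfolding fibre_def j(2) x mem_Collect_eq .
      qed
    qed
  next
    assume ?R
    then obtain g where g: "inj_on g {..<m}" "g ` {..<m} \<subseteq> fibre H (\<lambda>a. x (Inl a))"
      by (auto simp: at_least_def)
    define y where "y v = (case v of Inl a \<Rightarrow> x (Inl a) | Inr (j, s) \<Rightarrow> g j s)" for v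
    let ?x = "\<lambda>v. if v \<in> I then y v else x v"
    have x: "?x (Inl a) = x (Inl a)" for a by (auto simp: I_def)
    have gj: "pt ?x j = g j" if "j \<in> {..<m}" for j
      using that by (auto simp: pt_def y_def I_def fun_eq_iff)
    have "\<phi> ?x"
      unfolding \<phi>_def x
    proof (intro conjI ballI)
      show "poly_eval (case_sum (\<lambda>a. x (Inl a)) (pt ?x j)) h = 0" if "j \<in> {..<m}" "h \<in> H" for j h
      proof -
        have "g j \<in> fibre H (\<lambda>a. x (Inl a))" using g(2) that(1) by blast
        then show ?thesis using that(2) unfolding gj[OF that(1)] fibre_def by simp
      qed
      show "\<exists>s\<in>UNIV. pt ?x i s \<noteq> pt ?x j s" if "i \<in> {..<m}" "j \<in> {..<m} - {i}" for i j
      proof -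
        have j: "j \<in> {..<m}" "j \<noteq> i" using that(2) by auto
        have "g i \<noteq> g j" using inj_onD[OF g(1)] that(1) j by blast
        then show ?thesis unfolding gj[OF that(1)] gj[OF j(1)] by (auto simp: fun_eq_iff)
      qed
    qed
    then show ?L by (rule exI[of _ y])
  qed
  from con have "constructible (\<lambda>x :: 'p + nat \<times> 's \<Rightarrow> complex. at_least m (fibre H (\<lambda>a. x (Inl a))))"
    by (simp only: iff)
  then show ?thesis
  proof (rule constructible_dichotomy)
    fix p :: "('p + nat \<times> 's) mpoly"
    assume p: "p \<noteq> 0" and dich:
      "(\<forall>x. poly_eval x p \<noteq> 0 \<longrightarrow> at_least m (fibre H (\<lambda>a. x (Inl a)))) \<or>
       (\<forall>x. poly_eval x p \<noteq> 0 \<longrightarrow> \<not> at_least m (fibre H (\<lambda>a. x (Inl a))))"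
    obtain x0 where x0: "poly_eval x0 p \<noteq> 0" using p mpoly_eq_0_iff[of p] by blast
    \<comment> \<open>The polynomial obtained may still contain the eliminated variables. Freezing
      them at a point where it does not vanish leaves a nonzero polynomial in the
      parameters.\<close>
    define p' where "p' = subst Const (case_sum Var (\<lambda>b. Const (x0 (Inr b)))) p"
    have p': "poly_eval y p' = poly_eval (case_sum y (\<lambda>b. x0 (Inr b))) p" for y
      unfolding p'_def by simp (intro poly_eval_cong, auto split: sum.splits)
    have "case_sum (\<lambda>a. x0 (Inl a)) (\<lambda>b. x0 (Inr b)) = x0"
      by (auto simp: fun_eq_iff split: sum.splits)
    then have "poly_eval (\<lambda>a. x0 (Inl a)) p' \<noteq> 0" using x0 by (simp add: p')
    then have "p' \<noteq> 0" by auto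
    moreover have "(\<forall>y. poly_eval y p' \<noteq> 0 \<longrightarrow> at_least m (fibre H y)) \<or>
        (\<forall>y. poly_eval y p' \<noteq> 0 \<longrightarrow> \<not> at_least m (fibre H y))"
      using dich
    proof (elim disjE)
      assume *: "\<forall>x. poly_eval x p \<noteq> 0 \<longrightarrow> at_least m (fibre H (\<lambda>a. x (Inl a)))"
      have "at_least m (fibre H y)" if "poly_eval y p' \<noteq> 0" for y
        using *[rule_format, of "case_sum y (\<lambda>b. x0 (Inr b))"] that by (simp add: p')
      then show ?thesis by blast
    next
      assume *: "\<forall>x. poly_eval x p \<noteq> 0 \<longrightarrow> \<not> at_least m (fibre H (\<lambda>a. x (Inl a)))"
      have "\<not> at_least m (fibre H y)" if "poly_eval y p' \<noteq> 0" for y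
        using *[rule_format, of "case_sum y (\<lambda>b. x0 (Inr b))"] that by (simp add: p')
      then show ?thesis by blast
    qed
    ultimately show ?thesis by (rule that)
  qed
qed

text \<open>\<open>m\<close> is the largest number of points reached by almost all fibres. By the
  dichotomy almost all fibres then fail to reach \<open>m + 1\<close>, which also makes them
  finite.\<close>

theorem generic_fibre_card:
  fixes H :: "('p + 's::finite) mpoly set"
  assumes "finite H" "c \<noteq> 0"
    "\<And>y. poly_eval y c \<noteq> 0 \<Longrightarrow> \<not> at_least (Suc B) (fibre H y)"
  obtains m c' where "m \<le> B" "c' \<noteq> 0"
    "\<And>y. poly_eval y c' \<noteq> 0 \<Longrightarrow> finite (fibre H y) \<and> card (fibre H y) = m"
proof -
  define good where "good m \<longleftrightarrow>
    (\<exists>p. p \<noteq> 0 \<and> (\<forall>y. poly_eval y p \<noteq> 0 \<longrightarrow> at_least m (fibre H y)))" for m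
  have "good 0" unfolding good_def by (intro exI[of _ 1]) (auto simp: at_least_def)
  have "\<not> good (Suc B)"
  proof
    assume "good (Suc B)"
    then obtain p where p: "p \<noteq> 0" "\<And>y. poly_eval y p \<noteq> 0 \<Longrightarrow> at_least (Suc B) (fibre H y)"
      unfolding good_def by auto
    have "p * c \<noteq> 0" using p(1) assms(2) by (simp add: mpoly_mult_eq_0_iff)
    then obtain y where "poly_eval y (p * c) \<noteq> 0" using mpoly_eq_0_iff[of "p * c"] by blast
    then show False using p(2)[of y] assms(3)[of y] by (auto simp: eval.hom_mult)
  qed
  have "\<exists>m\<le>B. good m \<and> \<not> good (Suc m)"
  proof (rule ccontr)
    assume *: "\<not> (\<exists>m\<le>B. good m \<and> \<not> good (Suc m))"
    have "m \<le> Suc B \<Longrightarrow> good m" for m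
      by (induction m) (use \<open>good 0\<close> * in auto)
    then show False using \<open>\<not> good (Suc B)\<close> by blast
  qed
  then obtain m where m: "m \<le> B" "good m" "\<not> good (Suc m)" by blast
  from m(2) obtain p where p: "p \<noteq> 0" "\<And>y. poly_eval y p \<noteq> 0 \<Longrightarrow> at_least m (fibre H y)"
    unfolding good_def by auto
  show ?thesis
  proof (rule at_least_fibre_dichotomy[OF assms(1), of "Suc m"])
    fix p'
    assume nz: "p' \<noteq> 0" and dich:
      "(\<forall>y. poly_eval y p' \<noteq> 0 \<longrightarrow> at_least (Suc m) (fibre H y)) \<or>
       (\<forall>y. poly_eval y p' \<noteq> 0 \<longrightarrow> \<not> at_least (Suc m) (fibre H y))"
    have "\<not> (\<forall>y. poly_eval y p' \<noteq> 0 \<longrightarrow> at_least (Suc m) (fibre H y))"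
      using m(3) nz unfolding good_def by blast
    with dich nz have p': "p' \<noteq> 0" "\<And>y. poly_eval y p' \<noteq> 0 \<Longrightarrow> \<not> at_least (Suc m) (fibre H y)"
      by simp_all
    show ?thesis
    proof (rule that[of m "p * p'"])
      show "finite (fibre H y) \<and> card (fibre H y) = m" if "poly_eval y (p * p') \<noteq> 0" for y
      proof -
        have "poly_eval y p \<noteq> 0" "poly_eval y p' \<noteq> 0" using that by (simp_all add: eval.hom_mult)
        then have "at_least m (fibre H y)" "\<not> at_least (Suc m) (fibre H y)"
          using p(2) p'(2) by blast+
        then show ?thesis unfolding at_least_iff_card by linarith
      qed
    qed (use m p p' in \<open>simp_all add: mpoly_mult_eq_0_iff\<close>)
  qed
qed

section \<open>Binomial estimates\<close>

lemma sum_choose_reverse: "(\<Sum>s\<le>Q. (Q - s + j) choose j) = (Q + j + 1) choose (j + 1)"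
proof -
  have "(\<Sum>s\<le>Q. (Q - s + j) choose j) = (\<Sum>i\<le>Q. (j + i) choose j)"
    by (rule sum.reindex_bij_witness[of _ "\<lambda>i. Q - i" "\<lambda>i. Q - i"]) (auto simp: add.commute)
  then show ?thesis by (simp only: choose_rising_sum(1)) (simp add: add.commute)
qed

text \<open>Both sides are the coefficient of \<open>x^Q\<close> in the power series of
  \<open>1 / (1 - x)^(j + k + 2)\<close>. This is a discrete beta integral.\<close>

lemma sum_choose_convolution:
  "(\<Sum>s\<le>Q. ((Q - s + j) choose j) * ((s + k) choose k)) = (Q + j + k + 1) choose (j + k + 1)"
proof (induction k arbitrary: j)
  case 0
  then show ?case using sum_choose_reverse[of Q j] by simp
next
  case (Suc k)
  have inner: "(\<Sum>s=r..Q. (Q - s + j) choose j) = (Q - r + Suc j) choose Suc j" if "r \<le> Q" for r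
  proof -
    have "(\<Sum>s=r..Q. (Q - s + j) choose j) = (\<Sum>s\<le>Q - r. (Q - r - s + j) choose j)"
      using that by (intro sum.reindex_bij_witness[of _ "\<lambda>i. i + r" "\<lambda>i. i - r"]) auto
    then show ?thesis using sum_choose_reverse[of "Q - r" j] by simp
  qed
  have pascal: "(s + Suc k) choose Suc k = (\<Sum>r\<le>s. (r + k) choose k)" for s
    using choose_rising_sum(1)[of k s] by (simp add: add.commute)
  have "(\<Sum>s\<le>Q. ((Q - s + j) choose j) * ((s + Suc k) choose Suc k))
      = (\<Sum>s\<le>Q. \<Sum>r\<le>s. ((Q - s + j) choose j) * ((r + k) choose k))"
    by (simp only: pascal sum_distrib_left)
  also have "\<dots> = (\<Sum>(s, r)\<in>(SIGMA s:{..Q}. {..s}). ((Q - s + j) choose j) * ((r + k) choose k))"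
    by (rule sum.Sigma) auto
  also have "\<dots> = (\<Sum>(r, s)\<in>(SIGMA r:{..Q}. {r..Q}). ((Q - s + j) choose j) * ((r + k) choose k))"
    by (rule sum.reindex_bij_witness[of _ prod.swap prod.swap]) auto
  also have "\<dots> = (\<Sum>r\<le>Q. \<Sum>s=r..Q. ((Q - s + j) choose j) * ((r + k) choose k))"
    by (rule sum.Sigma[symmetric]) auto
  also have "\<dots> = (\<Sum>r\<le>Q. ((Q - r + Suc j) choose Suc j) * ((r + k) choose k))"
    by (intro sum.cong refl) (simp only: sum_distrib_right[symmetric] inner atMost_iff)
  also have "\<dots> = (Q + Suc j + k + 1) choose (Suc j + k + 1)" by (rule Suc.IH)
  finally show ?case by simp
qed

lemma power_le_fact_binomial': "a ^ j \<le> fact j * ((a + j) choose j)"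
  using power_mono[of a "a + 1" j] power_le_fact_binomial[of a j] by linarith

text \<open>Discrete form of integrating \<open>(q - s + \<theta> s)^N / N!\<close> over
  \<open>s\<close> from \<open>0\<close> to \<open>q\<close>: by the binomial theorem and beta
  integrals each power of \<theta> contributes \<open>q^(N + 1) / (N + 1)!\<close>. The geometric
  sum of the final bound arises here.\<close>

lemma sum_choose_le:
  "(\<Sum>s\<le>q. (q - s + c + \<theta> * s) choose N) \<le> (\<Sum>k\<le>N. \<theta> ^ k) * ((q + c + N + 1) choose (N + 1))"
proof -
  define C where "C = ((q + c + N + 1) choose (N + 1))"
  have beta: "(\<Sum>s\<le>q. (q - s + c) ^ j * s ^ k) \<le> fact j * fact k * C" if "j + k = N" for j k
  proof -
    have "(\<Sum>s\<le>q. (q - s + c) ^ j * s ^ k)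
        \<le> (\<Sum>s\<le>q. (fact j * ((q - s + c + j) choose j)) * (fact k * ((s + k) choose k)))"
      by (intro sum_mono mult_le_mono power_le_fact_binomial')
    also have "\<dots> = fact j * fact k * (\<Sum>s\<le>q. ((q - s + c + j) choose j) * ((s + k) choose k))"
      by (simp add: sum_distrib_left algebra_simps)
    also have "(\<Sum>s\<le>q. ((q - s + c + j) choose j) * ((s + k) choose k))
        = (\<Sum>s\<le>q. ((q + c - s + j) choose j) * ((s + k) choose k))"
      by (intro sum.cong) auto
    \<comment> \<open>Lengthening the range only adds terms and makes the convolution exact.\<close>
    also have "\<dots> \<le> (\<Sum>s\<le>q + c. ((q + c - s + j) choose j) * ((s + k) choose k))"
      by (intro sum_mono2) auto
    also have "\<dots> = C"
    proof -
      have "q + c + j + k + 1 = q + c + N + 1" "j + k + 1 = N + 1" using that by auto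
      then show ?thesis by (simp only: sum_choose_convolution C_def)
    qed
    finally show ?thesis by simp
  qed
  have "fact N * (\<Sum>s\<le>q. (q - s + c + \<theta> * s) choose N) \<le> (\<Sum>s\<le>q. (q - s + c + \<theta> * s) ^ N)"
    unfolding sum_distrib_left
    by (intro sum_mono, subst mult.commute, rule binomial_fact_pow)
  also have "\<dots> = (\<Sum>s\<le>q. \<Sum>k\<le>N. (N choose k) * (\<theta> * s) ^ k * (q - s + c) ^ (N - k))"
    by (intro sum.cong refl, subst add.commute, subst binomial) simp
  also have "\<dots> = (\<Sum>k\<le>N. (N choose k) * \<theta> ^ k * (\<Sum>s\<le>q. (q - s + c) ^ (N - k) * s ^ k))"
    by (subst sum.swap) (simp add: sum_distrib_left power_mult_distrib algebra_simps)
  also have "\<dots> \<le> (\<Sum>k\<le>N. (N choose k) * \<theta> ^ k * (fact (N - k) * fact k * C))"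
    by (intro sum_mono mult_le_mono2 beta) auto
  also have "\<dots> = (\<Sum>k\<le>N. fact N * (\<theta> ^ k * C))"
  proof (intro sum.cong refl)
    fix k assume "k \<in> {..N}"
    then have "fact k * fact (N - k) * (N choose k) = (fact N :: nat)"
      by (intro binomial_fact_lemma) simp
    then have "fact N * (\<theta> ^ k * C) = fact k * fact (N - k) * (N choose k) * (\<theta> ^ k * C)" by simp
    then show "(N choose k) * \<theta> ^ k * (fact (N - k) * fact k * C) = fact N * (\<theta> ^ k * C)"
      by (simp only: ac_simps)
  qed
  also have "\<dots> = fact N * ((\<Sum>k\<le>N. \<theta> ^ k) * C)"
    by (simp add: sum_distrib_left sum_distrib_right)
  finally show ?thesis by (simp add: C_def)
qed

text \<open>A shift by \<open>c\<close> changes the binomial only in lower order, so for large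
  \<open>q\<close> it cannot outweigh the step from \<open>K\<close> to
  \<open>Suc K\<close>.\<close>

lemma binomial_shift_less:
  assumes "n \<ge> 1"
  obtains q where "K * ((q + c + n) choose n) < Suc K * ((q + n) choose n)"
proof -
  \<comment> \<open>Chosen so that \<open>Suc K\<close> times the error term
    \<open>c * n * C\<close> is exactly \<open>q * C\<close>.\<close>
  define q where "q = Suc K * c * n"
  define C where "C = ((q + c + n) choose n)"
  define C0 where "C0 = ((q + n) choose n)"
  have "C \<le> C0 + c * ((q + c + n) choose (n - 1))"
    unfolding C_def C0_def
  proof (induction c)
    case (Suc c)
    obtain n' where n: "n = Suc n'" using assms by (cases n) auto
    have "(q + Suc c + n) choose n = ((q + c + n) choose n) + ((q + c + n) choose (n - 1))"
      unfolding n by simp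
    also have "\<dots> \<le> ((q + n) choose n) + c * ((q + c + n) choose (n - 1)) + ((q + c + n) choose (n - 1))"
      using Suc by simp
    also have "\<dots> = ((q + n) choose n) + Suc c * ((q + c + n) choose (n - 1))" by simp
    also have "\<dots> \<le> ((q + n) choose n) + Suc c * ((q + Suc c + n) choose (n - 1))"
      by (intro add_mono mult_le_mono binomial_right_mono) auto
    finally show ?case by simp
  qed simp
  moreover have "(q + c + 1) * ((q + c + n) choose (n - 1)) = n * C"
  proof -
    obtain n' where n: "n = Suc n'" using assms by (cases n) auto
    have "Suc n' * ((q + c + n) choose Suc n') = (q + c + n - n') * ((q + c + n) choose n')"
      using binomial_absorb_comp[of "q + c + n" n'] binomial_absorption[of n' "q + c + n"]
      by simp
    then show ?thesis by (simp add: C_def n)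
  qed
  ultimately have le: "(q + c + 1) * C \<le> (q + c + 1) * C0 + c * n * C"
  proof -
    assume a: "C \<le> C0 + c * ((q + c + n) choose (n - 1))"
      and b: "(q + c + 1) * ((q + c + n) choose (n - 1)) = n * C"
    have "(q + c + 1) * C \<le> (q + c + 1) * C0 + c * ((q + c + 1) * ((q + c + n) choose (n - 1)))"
      using mult_le_mono2[OF a, of "q + c + 1"] by (simp add: algebra_simps)
    then show ?thesis by (simp only: b mult.assoc)
  qed
  have "C > 0" by (simp add: C_def)
  have "(q + c + 1) * (K * C) + (q + c + 1) * C \<le> (q + c + 1) * (Suc K * C0) + q * C"
    using mult_le_mono2[OF le, of "Suc K"] by (simp add: q_def algebra_simps)
  moreover have "q * C < (q + c + 1) * C" using \<open>C > 0\<close> by (simp add: add_mult_distrib)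
  ultimately have "(q + c + 1) * (K * C) < (q + c + 1) * (Suc K * C0)" by linarith
  then have "K * C < Suc K * C0" by (simp only: mult_less_cancel1)
  then show ?thesis using that[of q] by (simp only: C_def C0_def)
qed

section \<open>Bounding the fibres of a slice\<close>

lemma keys_partial_deriv:
  assumes "keys p \<subseteq> monoms UNIV n"
  shows "keys (partial_deriv v p) \<subseteq> monoms UNIV (n - 1)"
  unfolding partial_deriv_def
proof (rule keys_sum_subset)
  fix m assume "m \<in> keys p"
  then have m: "monom_degree m \<le> n" using assms by (auto simp: monoms_def)
  show "keys (single (m - single v 1) (of_nat (lookup m v) * lookup p m)) \<subseteq> monoms UNIV (n - 1)"
  proof (cases "lookup m v = 0")
    case False
    then have "m = single v 1 + (m - single v 1)"
      by (intro poly_mapping_eqI) (auto simp: lookup_add lookup_minus lookup_single when_def)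
    from arg_cong[OF this, of monom_degree]
    have "monom_degree (m - single v 1) \<le> n - 1" using m by simp
    then show ?thesis by (simp add: monoms_def)
  qed simp
qed

section \<open>Functions spanned by finitely many monomials on a set of points\<close>

definition reducible_on ::
    "('v \<Rightarrow> complex) set \<Rightarrow> ('v \<Rightarrow>\<^sub>0 nat) set \<Rightarrow> (('v \<Rightarrow> complex) \<Rightarrow> complex) \<Rightarrow> bool" where
  "reducible_on E G \<phi> \<longleftrightarrow> (\<exists>a. \<forall>x\<in>E. \<phi> x = (\<Sum>m\<in>G. a m * mval x m))"

lemma reducible_on_mval: "finite G \<Longrightarrow> m \<in> G \<Longrightarrow> reducible_on E G (\<lambda>x. mval x m)"
proof -
  assume G: "finite G" "m \<in> G"
  have "mval x m = (\<Sum>k\<in>G. (if k = m then 1 else 0) * mval x k)" for x :: "'a \<Rightarrow> complex"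
  proof -
    have "(\<Sum>k\<in>G. (if k = m then 1 else 0) * mval x k) = (\<Sum>k\<in>G. if k = m then mval x k else 0)"
      by (intro sum.cong) auto
    then show ?thesis using G by (simp add: sum.delta)
  qed
  then show ?thesis unfolding reducible_on_def by (intro exI[of _ "\<lambda>k. if k = m then 1 else 0"]) blast
qed

lemma reducible_on_sum:
  assumes "\<And>i. i \<in> I \<Longrightarrow> reducible_on E G (\<psi> i)"
    "\<And>x. x \<in> E \<Longrightarrow> \<phi> x = (\<Sum>i\<in>I. c i * \<psi> i x)"
  shows "reducible_on E G \<phi>"
proof -
  have "\<forall>i\<in>I. \<exists>a. \<forall>x\<in>E. \<psi> i x = (\<Sum>m\<in>G. a m * mval x m)"
    using assms(1) by (simp add: reducible_on_def)
  from bchoice[OF this] obtain a where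
    a: "\<And>i x. i \<in> I \<Longrightarrow> x \<in> E \<Longrightarrow> \<psi> i x = (\<Sum>m\<in>G. a i m * mval x m)" by blast
  have "\<phi> x = (\<Sum>m\<in>G. (\<Sum>i\<in>I. c i * a i m) * mval x m)" if "x \<in> E" for x
  proof -
    have "\<phi> x = (\<Sum>i\<in>I. c i * (\<Sum>m\<in>G. a i m * mval x m))"
      using assms(2)[OF that] a that by (simp cong: sum.cong)
    also have "\<dots> = (\<Sum>m\<in>G. \<Sum>i\<in>I. c i * (a i m * mval x m))"
      unfolding sum_distrib_left by (rule sum.swap)
    finally show ?thesis by (simp add: sum_distrib_right mult.assoc)
  qed
  then show ?thesis unfolding reducible_on_def by (intro exI[of _ "\<lambda>m. \<Sum>i\<in>I. c i * a i m"]) blast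
qed

text \<open>The pivot \<open>k\<close> may be any monomial of \<open>p\<close>, not only a leading
  one: of the two reductions on the slice, one uses a pure power and the other a constant
  term.\<close>

lemma reducible_on_by_equation:
  assumes "\<And>x. x \<in> E \<Longrightarrow> poly_eval x p = 0" "lookup p k \<noteq> 0"
    and "\<And>\<gamma>. \<gamma> \<in> keys p \<Longrightarrow> \<gamma> \<noteq> k \<Longrightarrow> reducible_on E G (\<lambda>x. mval x (\<gamma> + m))"
  shows "reducible_on E G (\<lambda>x. mval x (k + m))"
proof (rule reducible_on_sum[of "keys p - {k}" E G "\<lambda>\<gamma> x. mval x (\<gamma> + m)" _ "\<lambda>\<gamma>. - lookup p \<gamma> / lookup p k"])
  show "reducible_on E G (\<lambda>x. mval x (\<gamma> + m))" if "\<gamma> \<in> keys p - {k}" for \<gamma>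
    using that assms(3) by simp
  show "mval x (k + m) = (\<Sum>\<gamma>\<in>keys p - {k}. - lookup p \<gamma> / lookup p k * mval x (\<gamma> + m))"
    if "x \<in> E" for x
  proof -
    have "k \<in> keys p" using assms(2) by (simp add: in_keys_iff)
    then have "lookup p k * mval x k + (\<Sum>\<gamma>\<in>keys p - {k}. lookup p \<gamma> * mval x \<gamma>) = 0"
      using assms(1)[OF that] sum.remove[of "keys p" k "\<lambda>\<gamma>. lookup p \<gamma> * mval x \<gamma>"]
      by (simp add: poly_eval_alt)
    then have "mval x k = (\<Sum>\<gamma>\<in>keys p - {k}. - lookup p \<gamma> / lookup p k * mval x \<gamma>)"
      using assms(2) by (simp add: sum_negf sum_divide_distrib[symmetric] field_simps
        add_eq_0_iff)
    then show ?thesis by (simp add: mval_add sum_distrib_right mult.assoc)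
  qed
qed

lemma poly_eval_0: "poly_eval (\<lambda>_. 0) p = lookup p 0"
proof -
  have *: "mval (\<lambda>_. 0) m = (if m = 0 then 1 else 0 :: complex)" for m :: "'a \<Rightarrow>\<^sub>0 nat"
  proof (cases "m = 0")
    case False
    have "keys m \<noteq> {}"
    proof
      assume "keys m = {}"
      then have "lookup m v = 0" for v using in_keys_iff[of v m] by simp
      then have "m = 0" by (intro poly_mapping_eqI) simp
      then show False using False by simp
    qed
    then obtain v where "v \<in> keys m" by blast
    then have "mval (\<lambda>_. 0 :: complex) m = 0"
      unfolding mval_def by (intro prod_zero) (auto simp: in_keys_iff)
    then show ?thesis using False by simp
  qed simp
  have "poly_eval (\<lambda>_. 0) p = (\<Sum>m\<in>insert 0 (keys p). lookup p m * mval (\<lambda>_. 0) m)"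
    by (intro poly_eval_superset) auto
  also have "\<dots> = (\<Sum>m\<in>insert 0 (keys p). if m = 0 then lookup p m else 0)"
    by (intro sum.cong) (auto simp: *)
  also have "\<dots> = lookup p 0" by simp
  finally show ?thesis .
qed

text \<open>\<open>lead\<close> provides the equation of \<open>w\<close> with a pivot of constant
  coefficient, and \<open>fu\<close> does so for the equation of \<open>z\<close>.\<close>

locale hypersurface_slice =
  fixes f g :: "'n::finite mpoly" and u :: "'n \<Rightarrow> complex" and x1 :: 'n and d :: nat
  assumes d: "d \<ge> 1" and f: "keys f \<subseteq> monoms UNIV d" and g: "keys g \<subseteq> monoms UNIV d"
    and lead: "lookup g (single x1 d) \<noteq> 0" and fu: "poly_eval u f \<noteq> 0"
begin

text \<open>The slice is a variety in the coordinates \<open>w\<^sub>k\<close> (\<open>Inl k\<close>), \<open>\<mu>\<close> (\<open>Inr False\<close>) and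
  \<open>\<lambda>\<close> (\<open>Inr True\<close>), with \<open>z = u - \<mu> \<nabla>g(w)\<close> and \<open>v = w + \<lambda> \<nabla>f(z)\<close>.\<close>

definition "\<delta> = d - 1"

definition lift :: "'n mpoly \<Rightarrow> ('n + bool) mpoly" where
  "lift = subst Const (\<lambda>k. Var (Inl k))"

definition zpol :: "'n \<Rightarrow> ('n + bool) mpoly" where
  "zpol k = Const (u k) - Var (Inr False) * lift (partial_deriv k g)"

definition fz :: "('n + bool) mpoly" where
  "fz = subst Const zpol f"

definition vpol :: "'n \<Rightarrow> ('n + bool) mpoly" where
  "vpol k = Var (Inl k) + Var (Inr True) * subst Const zpol (partial_deriv k f)"

definition slice :: "('n + bool \<Rightarrow> complex) set" where
  "slice = {x. poly_eval x (lift g) = 0 \<and> poly_eval x fz = 0}"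

definition dl :: "('n + bool \<Rightarrow>\<^sub>0 nat) \<Rightarrow> nat" where "dl m = lookup m (Inr True)"
definition dm :: "('n + bool \<Rightarrow>\<^sub>0 nat) \<Rightarrow> nat" where "dm m = lookup m (Inr False)"
definition dw :: "('n + bool \<Rightarrow>\<^sub>0 nat) \<Rightarrow> nat" where "dw m = (\<Sum>k\<in>UNIV. lookup m (Inl k))"

lemma deg_add [simp]: "dl (m + m') = dl m + dl m'" "dm (m + m') = dm m + dm m'" "dw (m + m') = dw m + dw m'"
  by (simp_all add: dl_def dm_def dw_def lookup_add sum.distrib)

lemma deg_0 [simp]: "dl 0 = 0" "dm 0 = 0" "dw 0 = 0"
  by (simp_all add: dl_def dm_def dw_def)

lemma deg_single [simp]:
  "dl (single (Inl k) j) = 0" "dm (single (Inl k) j) = 0" "dw (single (Inl k) j) = j"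
  "dl (single (Inr b) j) = (if b then j else 0)" "dm (single (Inr b) j) = (if b then 0 else j)"
  "dw (single (Inr b) j) = 0"
  by (auto simp: dl_def dm_def dw_def lookup_single when_def sum.delta)

definition WG :: "nat \<Rightarrow> ('n + bool \<Rightarrow>\<^sub>0 nat) set" where
  "WG n = {m. dl m = 0 \<and> dm m = 0 \<and> dw m \<le> n}"

text \<open>The monomials of degree \<open>e\<close> in the coordinates of \<open>z\<close>: every
  factor \<mu> brings along at most \<delta> factors \<open>w\<close>.\<close>

definition ZG :: "nat \<Rightarrow> ('n + bool \<Rightarrow>\<^sub>0 nat) set" where
  "ZG e = {m. dl m = 0 \<and> dm m \<le> e \<and> dw m \<le> \<delta> * dm m}"

text \<open>\<open>TG\<close> is chosen so that the functions \<open>v\<^sub>k\<close> lie in degree \<open>(1, 0)\<close> and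
  \<open>w\<^sub>k\<close>, \<open>\<mu>\<close> in degree \<open>(0, 1)\<close>.\<close>

definition TG :: "nat \<Rightarrow> nat \<Rightarrow> ('n + bool \<Rightarrow>\<^sub>0 nat) set" where
  "TG q e = {m. dl m \<le> q \<and> dm m \<le> \<delta> * dl m + e \<and> dw m + dl m \<le> q + e + \<delta> * dm m}"

lemma WG_grading: "monom_grading WG" by unfold_locales (auto simp: WG_def)
lemma ZG_grading: "monom_grading ZG" by unfold_locales (auto simp: ZG_def algebra_simps)

lemma TG_add: "a \<in> TG q e \<Longrightarrow> b \<in> TG q' e' \<Longrightarrow> a + b \<in> TG (q + q') (e + e')"
  by (auto simp: TG_def algebra_simps)

lemma TG_mono: "q \<le> q' \<Longrightarrow> e \<le> e' \<Longrightarrow> TG q e \<subseteq> TG q' e'"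
  by (auto simp: TG_def)

lemma keys_lift: "keys p \<subseteq> monoms UNIV n \<Longrightarrow> keys (lift p) \<subseteq> WG n"
  unfolding lift_def
  by (rule monom_grading.keys_subst[OF WG_grading]) (auto simp: keys_Var WG_def)

lemma keys_zpol: "keys (zpol k) \<subseteq> ZG 1"
  unfolding zpol_def
proof (intro keys_diff_subset)
  show "keys (Const (u k)) \<subseteq> ZG 1" using keys_Const[of "u k"] by (auto simp: ZG_def)
  show "keys (Var (Inr False) * lift (partial_deriv k g)) \<subseteq> ZG 1"
    using keys_lift[OF keys_partial_deriv[OF g]]
    by (rule keys_mult_graded[rotated 2, where A = "{single (Inr False) 1}"])
      (auto simp: keys_Var WG_def ZG_def \<delta>_def)
qed

lemma keys_fz: "keys fz \<subseteq> ZG d"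
  unfolding fz_def by (rule monom_grading.keys_subst[OF ZG_grading f keys_zpol])

lemma keys_vpol: "keys (vpol k) \<subseteq> TG 1 0"
  unfolding vpol_def
proof (intro keys_add_subset)
  show "keys (Var (Inl k)) \<subseteq> TG 1 0" by (auto simp: keys_Var TG_def)
  have "keys (subst Const zpol (partial_deriv k f)) \<subseteq> ZG \<delta>"
    unfolding \<delta>_def by (rule monom_grading.keys_subst[OF ZG_grading keys_partial_deriv[OF f] keys_zpol])
  then show "keys (Var (Inr True) * subst Const zpol (partial_deriv k f)) \<subseteq> TG 1 0"
    by (rule keys_mult_graded[rotated 2, where A = "{single (Inr True) 1}"])
      (auto simp: keys_Var ZG_def TG_def)
qed

lemma keys_mval_vpol: "keys (mval vpol \<alpha>) \<subseteq> TG (monom_degree \<alpha>) 0"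
proof -
  interpret monom_grading "\<lambda>q. TG q 0"
  proof unfold_locales
    show "0 \<in> TG 0 0" by (simp add: TG_def)
  qed (use TG_add[of _ _ 0 _ _ 0] TG_add[of _ 0 _ _ 0] TG_mono in simp_all)
  show ?thesis by (rule keys_mval[OF keys_vpol])
qed

lemma keys_power_TG: "keys p \<subseteq> TG 0 1 \<Longrightarrow> keys (p ^ a) \<subseteq> TG 0 a"
proof -
  interpret monom_grading "\<lambda>e. TG 0 e"
  proof unfold_locales
    show "0 \<in> TG 0 0" by (simp add: TG_def)
  qed (use TG_add[of _ _ 0 _ _ 0] TG_add[of _ 0 _ _ 0] TG_mono in simp_all)
  show "keys p \<subseteq> TG 0 1 \<Longrightarrow> keys (p ^ a) \<subseteq> TG 0 a" by (rule keys_power)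
qed

lemma poly_eval_zpol: "poly_eval x (zpol k) =
    u k - x (Inr False) * poly_eval (\<lambda>k. x (Inl k)) (partial_deriv k g)"
  by (simp add: zpol_def lift_def eval.hom_minus eval.hom_mult)

text \<open>At the origin, where \<open>w\<close> and \<mu> are zero, the point \<open>z\<close> is
  \<open>u\<close>.\<close>

lemma lookup_fz_0: "lookup fz 0 = poly_eval u f"
proof -
  have "lookup fz 0 = poly_eval (\<lambda>_. 0) fz" by (simp add: poly_eval_0)
  also have "\<dots> = poly_eval u f" by (simp add: fz_def poly_eval_zpol)
  finally show ?thesis .
qed

definition emb :: "('n \<Rightarrow>\<^sub>0 nat) \<Rightarrow> ('n + bool \<Rightarrow>\<^sub>0 nat)" where
  "emb \<gamma> = (\<Sum>k\<in>UNIV. single (Inl k) (lookup \<gamma> k))"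

lemma lookup_emb [simp]: "lookup (emb \<gamma>) (Inl k) = lookup \<gamma> k" "lookup (emb \<gamma>) (Inr b) = 0"
  by (simp_all add: emb_def lookup_sum lookup_single when_def sum.delta)

lemma emb_inj: "emb \<gamma> = emb \<gamma>' \<longleftrightarrow> \<gamma> = \<gamma>'"
proof
  assume *: "emb \<gamma> = emb \<gamma>'"
  show "\<gamma> = \<gamma>'"
  proof (rule poly_mapping_eqI)
    show "lookup \<gamma> k = lookup \<gamma>' k" for k using arg_cong[OF *, of "\<lambda>m. lookup m (Inl k)"] by simp
  qed
qed simp

lemma emb_single: "emb (single k j) = single (Inl k) j"
proof (rule poly_mapping_eqI)
  show "lookup (emb (single k j)) i = lookup (single (Inl k) j) i" for i
    by (cases i) (auto simp: lookup_single when_def)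
qed

lemma lift_eq_sum: "lift p = (\<Sum>\<gamma>\<in>keys p. single (emb \<gamma>) (lookup p \<gamma>))"
proof (rule mpoly_eqI)
  fix x :: "'n + bool \<Rightarrow> complex"
  have "mval x (emb \<gamma>) = mval (\<lambda>k. x (Inl k)) \<gamma>" for \<gamma>
    by (simp add: emb_def mval_sum mval_superset[of UNIV \<gamma>])
  then show "poly_eval x (lift p) = poly_eval x (\<Sum>\<gamma>\<in>keys p. single (emb \<gamma>) (lookup p \<gamma>))"
    by (simp add: lift_def eval.hom_sum poly_eval_alt[of _ p])
qed

lemma lookup_lift_emb: "lookup (lift p) (emb \<gamma>) = lookup p \<gamma>"
  by (simp add: lift_eq_sum lookup_sum lookup_single emb_inj when_def sum.delta in_keys_iff)

lemma keys_lift_emb: "keys (lift p) \<subseteq> emb ` keys p"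
  unfolding lift_eq_sum by (rule keys_sum_subset) auto

text \<open>Normal forms: the exponent of \<mu> lies in the window of length \<open>d\<close> below
  its maximum in \<open>TG\<close>, and that of one coordinate of \<open>w\<close> is below
  \<open>d\<close>. These two windows are the factor \<open>d\<^sup>2\<close> of the bound.\<close>

definition red :: "nat \<Rightarrow> nat \<Rightarrow> ('n + bool \<Rightarrow>\<^sub>0 nat) set" where
  "red q e = {m\<in>TG q e. \<delta> * dl m + e < dm m + d \<and> lookup m (Inl x1) < d}"

text \<open>Reducing by \<open>g\<close> keeps the exponents of \<lambda> and \<mu> and does not
  raise the degree in \<open>w\<close>. It therefore stays inside \<open>TG\<close> and does not
  leave the window of \<mu>, which is why it comes after the reduction in \<mu>.\<close>

lemma reduce_w:
  assumes "finite (red q e)" "m \<in> TG q e" "\<delta> * dl m + e < dm m + d"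
  shows "reducible_on slice (red q e) (\<lambda>x. mval x m)"
  using assms(2,3)
proof (induction "lookup m (Inl x1)" arbitrary: m rule: less_induct)
  case less
  show ?case
  proof (cases "lookup m (Inl x1) < d")
    case True
    with less.prems show ?thesis
      by (intro reducible_on_mval[OF assms(1)]) (simp add: red_def)
  next
    case False
    define m' where "m' = m - single (Inl x1) d"
    have m: "m = single (Inl x1) d + m'" unfolding m'_def using False by (intro monom_split_le) simp
    have "reducible_on slice (red q e) (\<lambda>x. mval x (single (Inl x1) d + m'))"
    proof (rule reducible_on_by_equation[where p = "lift g"])
      show "poly_eval x (lift g) = 0" if "x \<in> slice" for x using that by (simp add: slice_def)
      show "lookup (lift g) (single (Inl x1) d) \<noteq> 0"
        using lead lookup_lift_emb[of g "single x1 d"] by (simp add: emb_single)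
      show "reducible_on slice (red q e) (\<lambda>x. mval x (\<gamma> + m'))"
        if \<gamma>: "\<gamma> \<in> keys (lift g)" "\<gamma> \<noteq> single (Inl x1) d" for \<gamma>
      proof (rule less.hyps)
        have W: "\<gamma> \<in> WG d" using keys_lift[OF g] \<gamma>(1) by blast
        then have W': "dl \<gamma> = 0" "dm \<gamma> = 0" "dw \<gamma> \<le> d" by (auto simp: WG_def)
        show "\<gamma> + m' \<in> TG q e" using W' less.prems(1) by (auto simp: TG_def m)
        show "\<delta> * dl (\<gamma> + m') + e < dm (\<gamma> + m') + d" using W' less.prems(2) by (simp add: m)
        \<comment> \<open>Among the monomials of degree at most \<open>d\<close> only the pure power
          has exponent \<open>d\<close> in \<open>x1\<close>, so the induction measure
          drops.\<close>
        have "lookup \<gamma> (Inl x1) < d"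
        proof (rule ccontr)
          assume "\<not> lookup \<gamma> (Inl x1) < d"
          then have ge: "d \<le> lookup \<gamma> (Inl x1)" by simp
          obtain \<beta> where \<beta>: "\<gamma> = emb \<beta>" using keys_lift_emb \<gamma>(1) by blast
          have "dw \<gamma> = lookup \<gamma> (Inl x1) + (\<Sum>k\<in>UNIV - {x1}. lookup \<gamma> (Inl k))"
            unfolding dw_def by (rule sum.remove) auto
          with ge W'(3) have "lookup \<gamma> (Inl x1) = d" "(\<Sum>k\<in>UNIV - {x1}. lookup \<gamma> (Inl k)) = 0"
            by linarith+
          then have "lookup \<beta> x1 = d" "\<And>k. k \<noteq> x1 \<Longrightarrow> lookup \<beta> k = 0" by (auto simp: \<beta>)
          then have "\<beta> = single x1 d" by (intro poly_mapping_eqI) (auto simp: lookup_single when_def)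
          then show False using \<gamma>(2) \<beta> by (simp add: emb_single)
        qed
        then show "lookup (\<gamma> + m') (Inl x1) < lookup m (Inl x1)" by (simp add: m lookup_add)
      qed
    qed
    then show ?thesis by (simp only: m[symmetric])
  qed
qed

text \<open>Powers of \<open>\<mu>\<close> are reduced upwards: the equation \<open>f(u - \<mu> \<nabla>g(w)) = 0\<close> has the
  nonzero constant term \<open>f(u)\<close>, whereas its leading coefficient in \<open>\<mu>\<close> is not constant.\<close>

lemma reduce_mu:
  assumes "finite (red q e)" "m \<in> TG q e"
  shows "reducible_on slice (red q e) (\<lambda>x. mval x m)"
  using assms(2)
proof (induction "\<delta> * dl m + e - dm m" arbitrary: m rule: less_induct)
  case less
  show ?case
  proof (cases "\<delta> * dl m + e < dm m + d")
    case True
    then show ?thesis by (rule reduce_w[OF assms(1) less.prems])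
  next
    case False
    have "reducible_on slice (red q e) (\<lambda>x. mval x (0 + m))"
    proof (rule reducible_on_by_equation[where p = fz])
      show "poly_eval x fz = 0" if "x \<in> slice" for x using that by (simp add: slice_def)
      show "lookup fz 0 \<noteq> 0" using fu by (simp add: lookup_fz_0)
      show "reducible_on slice (red q e) (\<lambda>x. mval x (\<gamma> + m))" if \<gamma>: "\<gamma> \<in> keys fz" "\<gamma> \<noteq> 0" for \<gamma>
      proof (rule less.hyps)
        have "\<gamma> \<in> ZG d" using keys_fz \<gamma>(1) by blast
        then have Zd: "dl \<gamma> = 0" "dm \<gamma> \<le> d" "dw \<gamma> \<le> \<delta> * dm \<gamma>" by (auto simp: ZG_def)
        \<comment> \<open>Below the window there is room for up to \<open>d\<close> further factors
          \<mu>, and \<open>TG\<close> grants \<delta> factors \<open>w\<close> for each of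
          them.\<close>
        show "\<gamma> + m \<in> TG q e" using Zd less.prems False by (auto simp: TG_def algebra_simps)
        have "dm \<gamma> \<noteq> 0"
        proof
          assume 0: "dm \<gamma> = 0"
          then have "dw \<gamma> = 0" using Zd by simp
          then have "lookup \<gamma> i = 0" for i
            using 0 Zd(1) by (cases i rule: sum.exhaust; cases "projr i") (auto simp: dw_def dl_def dm_def)
          then have "\<gamma> = 0" by (intro poly_mapping_eqI) simp
          then show False using \<gamma>(2) by simp
        qed
        then show "\<delta> * dl (\<gamma> + m) + e - dm (\<gamma> + m) < \<delta> * dl m + e - dm m"
          using Zd(1) False d by simp
      qed
    qed
    then show ?thesis by simp
  qed
qed

text \<open>A normal form is coded by its exponent \<open>s\<close> of \<lambda>, the gap of \<mu>
  below its maximum, the exponent of the distinguished coordinate of \<open>w\<close>, and the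
  remaining exponents, whose degree is at most \<open>M s\<close>. The sum over \<open>s\<close> is
  the one estimated by \<open>sum_choose_le\<close> with
  \<open>\<theta> = \<delta>\<^sup>2\<close>.\<close>

lemma card_red:
  "finite (red q e) \<and> card (red q e) \<le> d\<^sup>2 * (\<Sum>k<CARD('n). (\<delta>\<^sup>2) ^ k) *
     ((q + (e + \<delta> * e + (CARD('n) - 1)) + CARD('n)) choose CARD('n))"
proof -
  define N where "N = CARD('n) - 1"
  have n: "CARD('n) = Suc N" by (simp add: N_def)
  \<comment> \<open>In \<open>TG\<close> the degree in \<open>w\<close> is at most
    \<open>(q - s) + e + \<delta> * dm m\<close>, where \<open>dm m\<close> is at most
    \<open>\<delta> * s + e\<close>.\<close>
  define M where "M s = (q - s) + (e + \<delta> * e) + \<delta>\<^sup>2 * s" for s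
  define R where "R m = (\<Sum>k\<in>UNIV - {x1}. single k (lookup m (Inl k)))" for m :: "'n + bool \<Rightarrow>\<^sub>0 nat"
  have R: "lookup (R m) k = (if k = x1 then 0 else lookup m (Inl k))" for m k
    by (simp add: R_def lookup_sum lookup_single when_def sum.delta)
  define h where "h m = (dl m, \<delta> * dl m + e - dm m, lookup m (Inl x1), R m)" for m
  let ?B = "SIGMA s:{..q}. {..<d} \<times> {..<d} \<times> monoms (UNIV - {x1}) (M s)"
  have inj: "inj_on h (red q e)"
  proof (rule inj_onI)
    fix m m' assume m: "m \<in> red q e" "m' \<in> red q e" and eq: "h m = h m'"
    have "dl m = dl m'" "lookup m (Inl x1) = lookup m' (Inl x1)" "R m = R m'"
      "\<delta> * dl m + e - dm m = \<delta> * dl m' + e - dm m'" using eq by (auto simp: h_def)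
    moreover from this have "dm m = dm m'" using m by (auto simp: red_def TG_def)
    moreover have "lookup m (Inl k) = lookup m' (Inl k)" for k
      using R[of m k] R[of m' k] calculation by (cases "k = x1") auto
    ultimately show "m = m'"
    proof (intro poly_mapping_eqI)
      fix i
      assume *: "dl m = dl m'" "dm m = dm m'" "\<And>k. lookup m (Inl k) = lookup m' (Inl k)"
      show "lookup m i = lookup m' i"
      proof (cases i)
        case (Inr b)
        then show ?thesis using *(1,2) by (cases b) (auto simp: dl_def dm_def)
      qed (simp add: *)
    qed
  qed
  have sub: "h ` red q e \<subseteq> ?B"
  proof
    fix t assume "t \<in> h ` red q e"
    then obtain m where m: "m \<in> red q e" "t = h m" by blast
    then have T: "dl m \<le> q" "dm m \<le> \<delta> * dl m + e" "dw m + dl m \<le> q + e + \<delta> * dm m"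
      "\<delta> * dl m + e < dm m + d" "lookup m (Inl x1) < d" by (auto simp: red_def TG_def)
    have "keys (R m) \<subseteq> UNIV - {x1}" by (auto simp: in_keys_iff R)
    moreover have "monom_degree (R m) \<le> M (dl m)"
    proof -
      have "monom_degree (R m) = (\<Sum>k\<in>UNIV - {x1}. lookup m (Inl k))"
        by (subst monom_degree_superset[of "UNIV - {x1}"]) (auto simp: R in_keys_iff)
      also have "\<dots> \<le> dw m" unfolding dw_def by (intro sum_mono2) auto
      also have "\<dots> \<le> (q - dl m) + e + \<delta> * dm m" using T(1,3) by simp
      also have "\<dots> \<le> (q - dl m) + e + \<delta> * (\<delta> * dl m + e)" using T(2) by simp
      also have "\<dots> = M (dl m)" by (simp add: M_def algebra_simps power2_eq_square)
      finally show ?thesis .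
    qed
    ultimately show "t \<in> ?B" using T by (auto simp: m(2) h_def monoms_def)
  qed
  have finM: "finite ({..<d} \<times> {..<d} \<times> monoms (UNIV - {x1}) (M s))" for s
    by (intro finite_cartesian_product finite_monoms) auto
  have finB: "finite ?B" by (intro finite_SigmaI finM) auto
  have fin: "finite (red q e)" by (rule inj_on_finite[OF inj sub finB])
  have "card (red q e) \<le> card ?B" by (rule card_inj_on_le[OF inj sub finB])
  also have "\<dots> = (\<Sum>s\<le>q. d * (d * ((M s + N) choose N)))"
    using finM by (subst card_SigmaI) (auto simp: card_cartesian_product card_monoms n)
  also have "\<dots> = d\<^sup>2 * (\<Sum>s\<le>q. (q - s + (e + \<delta> * e + N) + \<delta>\<^sup>2 * s) choose N)"
    by (simp add: sum_distrib_left power2_eq_square M_def ac_simps)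
  also have "\<dots> \<le> d\<^sup>2 * ((\<Sum>k\<le>N. (\<delta>\<^sup>2) ^ k) * ((q + (e + \<delta> * e + N) + N + 1) choose (N + 1)))"
    by (intro mult_le_mono2 sum_choose_le)
  also have "\<dots> = d\<^sup>2 * (\<Sum>k<CARD('n). (\<delta>\<^sup>2) ^ k) *
     ((q + (e + \<delta> * e + (CARD('n) - 1)) + CARD('n)) choose CARD('n))"
    by (simp add: n lessThan_Suc_atMost mult.assoc)
  finally show ?thesis using fin by blast
qed

end

text \<open>Two distinct points are confused only if \<open>t\<close> is a root of a nonzero
  polynomial, so few \<open>t\<close> fail in all. The range of \<open>t\<close> depends on
  \<open>N\<close> and the dimension but not on \<open>S\<close>: the forms must be fixed before the
  points of a fibre are known.\<close>

lemma separating_combination: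
  fixes S :: "('x::finite \<Rightarrow> complex) set" and idx :: "'x \<Rightarrow> nat"
  assumes "finite S" "card S \<le> N" "inj idx" "\<And>v. idx v < CARD('x)"
  obtains t where "t \<le> N * N * CARD('x)" "inj_on (\<lambda>y. \<Sum>v\<in>UNIV. of_nat t ^ idx v * y v) S"
proof -
  define P where "P = (\<lambda>(y :: 'x \<Rightarrow> complex, y'). \<Sum>v\<in>UNIV. monom (y v - y' v) (idx v))"
  define T where "T = {p\<in>S \<times> S. fst p \<noteq> snd p}"
  have finT: "finite T" using assms(1) by (simp add: T_def)
  have "card T \<le> card (S \<times> S)" unfolding T_def using assms(1) by (intro card_mono) auto
  also have "\<dots> \<le> N * N" using assms(2) by (simp add: card_cartesian_product mult_le_mono)
  finally have cT: "card T \<le> N * N" .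
  have coeffP: "coeff (P (y, y')) (idx v) = y v - y' v" for y y' v
  proof -
    have "coeff (P (y, y')) (idx v) = (\<Sum>w\<in>UNIV. if w = v then y w - y' w else 0)"
      unfolding P_def prod.case coeff_sum coeff_monom
      by (intro sum.cong refl) (simp add: inj_eq[OF assms(3)])
    then show ?thesis by simp
  qed
  have "P p \<noteq> 0" if "p \<in> T" for p
  proof
    assume 0: "P p = 0"
    have "fst p v = snd p v" for v using coeffP[of "fst p" "snd p" v] 0 by simp
    then show False using that by (auto simp: T_def)
  qed
  then have nz: "(\<Prod>p\<in>T. P p) \<noteq> 0" using finT by simp
  have degP: "degree (P p) \<le> CARD('x)" for p
    unfolding P_def case_prod_unfold
    by (intro degree_sum_le) (auto intro: order.trans[OF degree_monom_le] less_imp_le assms(4))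
  have "degree (\<Prod>p\<in>T. P p) \<le> (\<Sum>p\<in>T. degree (P p))" using degree_prod_sum_le[OF finT, of P] by (simp add: comp_def)
  also have "\<dots> \<le> card T * CARD('x)" using sum_bounded_above[of T "\<lambda>p. degree (P p)"] degP by simp
  also have "\<dots> \<le> N * N * CARD('x)" using cT by simp
  finally have deg: "degree (\<Prod>p\<in>T. P p) \<le> N * N * CARD('x)" .
  have "\<exists>t\<in>{..N * N * CARD('x)}. poly (\<Prod>p\<in>T. P p) (of_nat t) \<noteq> 0"
  proof (rule ccontr)
    assume "\<not> ?thesis"
    then have sub: "(of_nat ` {..N * N * CARD('x)} :: complex set) \<subseteq> {x. poly (\<Prod>p\<in>T. P p) x = 0}"
      by blast
    have "card (of_nat ` {..N * N * CARD('x)} :: complex set) = Suc (N * N * CARD('x))"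
      by (subst card_image) (auto intro: inj_onI)
    moreover have "card (of_nat ` {..N * N * CARD('x)} :: complex set) \<le> card {x. poly (\<Prod>p\<in>T. P p) x = 0}"
      by (intro card_mono sub poly_roots_finite nz)
    ultimately show False using card_poly_roots_bound[OF nz] deg by simp
  qed
  then obtain t where t: "t \<le> N * N * CARD('x)" "poly (\<Prod>p\<in>T. P p) (of_nat t) \<noteq> 0" by blast
  have "inj_on (\<lambda>y. \<Sum>v\<in>UNIV. of_nat t ^ idx v * y v) S"
  proof (rule inj_onI, rule ccontr)
    fix y y' assume y: "y \<in> S" "y' \<in> S" "y \<noteq> y'"
      "(\<Sum>v\<in>UNIV. of_nat t ^ idx v * y v) = (\<Sum>v\<in>UNIV. of_nat t ^ idx v * y' v)"
    have "poly (P (y, y')) (of_nat t) = (\<Sum>v\<in>UNIV. of_nat t ^ idx v * y v - of_nat t ^ idx v * y' v)"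
      unfolding P_def prod.case poly_sum poly_monom by (intro sum.cong refl) (simp add: algebra_simps)
    also have "\<dots> = 0" using y(4) by (simp add: sum_subtractf)
    finally have "poly (P (y, y')) (of_nat t) = 0" .
    moreover have "(y, y') \<in> T" using y by (simp add: T_def)
    ultimately have "poly (\<Prod>p\<in>T. P p) (of_nat t) = 0"
      unfolding poly_prod using finT by (intro prod_zero) blast+
    then show False using t(2) by simp
  qed
  with t(1) show ?thesis by (rule that)
qed

context hypersurface_slice
begin

definition wm_var :: "'n option \<Rightarrow> 'n + bool" where
  "wm_var i = (case i of None \<Rightarrow> Inr False | Some k \<Rightarrow> Inl k)"

text \<open>The coordinate \<lambda> is projected away: \<open>w\<close> and \<mu> already determine
  the critical point, and they are the coordinates of degree \<open>(0, 1)\<close> in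
  \<open>TG\<close>.\<close>

definition slice_fibre :: "('n \<Rightarrow> complex) \<Rightarrow> ('n option \<Rightarrow> complex) set" where
  "slice_fibre v = (\<lambda>x i. x (wm_var i)) ` {x\<in>slice. \<forall>k. poly_eval x (vpol k) = v k}"

definition "bound = d\<^sup>2 * (\<Sum>k<CARD('n). (\<delta>\<^sup>2) ^ k)"

text \<open>There are more products \<open>l\<^sup>a v\<^sup>\<alpha>\<close> with \<open>a \<le> bound\<close> than monomials spanning
  the functions on the slice in that degree, so \<open>l\<close> is a root of a polynomial of degree at most
  \<open>bound\<close> over \<open>\<complex>[v]\<close>.\<close>

lemma slice_relation:
  assumes l: "keys l \<subseteq> TG 0 1"
  obtains P where "\<exists>a\<le>bound. P a \<noteq> 0"
    "\<And>x. x \<in> slice \<Longrightarrow>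
       (\<Sum>a\<le>bound. poly_eval x l ^ a * poly_eval (\<lambda>k. poly_eval x (vpol k)) (P a)) = 0"
proof -
  \<comment> \<open>The index \<open>e\<close> of \<open>TG\<close> is \<open>bound\<close> itself,
    because powers up to \<open>l ^ bound\<close> occur. The shift that this causes in
    \<open>card_red\<close> does not depend on \<open>q\<close>, so a large \<open>q\<close> absorbs
    it.\<close>
  obtain q where q: "bound * ((q + (bound + \<delta> * bound + (CARD('n) - 1)) + CARD('n)) choose CARD('n))
      < Suc bound * ((q + CARD('n)) choose CARD('n))"
    by (rule binomial_shift_less[of "CARD('n)" bound "bound + \<delta> * bound + (CARD('n) - 1)"])
      (simp_all add: Suc_le_eq)
  let ?G = "red q bound" and ?M = "monoms (UNIV :: 'n set) q"
  let ?J = "{..bound} \<times> ?M"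
  have finM: "finite ?M" by (intro finite_monoms) simp
  have fin: "finite ?G" and cG: "card ?G < card ?J"
    using card_red[of q bound] q finM
    by (simp_all add: card_cartesian_product card_monoms bound_def)
  have red: "\<exists>b. \<forall>x\<in>slice. poly_eval x (l ^ fst j * mval vpol (snd j)) = (\<Sum>m\<in>?G. b m * mval x m)"
    if "j \<in> ?J" for j
  proof -
    obtain a \<alpha> where j: "j = (a, \<alpha>)" "a \<le> bound" "monom_degree \<alpha> \<le> q"
      using \<open>j \<in> ?J\<close> by (auto simp: monoms_def)
    have "keys (l ^ a * mval vpol \<alpha>) \<subseteq> TG (0 + monom_degree \<alpha>) (a + 0)"
      by (rule keys_mult_graded[OF TG_add keys_power_TG[OF l] keys_mval_vpol])
    also have "\<dots> \<subseteq> TG q bound" using j by (intro TG_mono) auto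
    finally have k: "keys (l ^ a * mval vpol \<alpha>) \<subseteq> TG q bound" .
    have "reducible_on slice ?G (\<lambda>x. poly_eval x (l ^ a * mval vpol \<alpha>))"
      by (rule reducible_on_sum[OF reduce_mu[OF fin]]) (use k in \<open>auto simp: poly_eval_alt\<close>)
    then show ?thesis by (simp add: reducible_on_def j)
  qed
  have finJ: "finite ?J" using finM by simp
  show ?thesis
  proof (rule functions_linear_dependent[OF fin finJ cG red])
    fix c assume c: "\<exists>j\<in>?J. c j \<noteq> 0" "\<And>x. x \<in> slice \<Longrightarrow>
      (\<Sum>j\<in>?J. c j * poly_eval x (l ^ fst j * mval vpol (snd j))) = 0"
    define P where "P a = (\<Sum>\<alpha>\<in>?M. single \<alpha> (c (a, \<alpha>)))" for a
    have lookP: "lookup (P a) \<alpha> = (if \<alpha> \<in> ?M then c (a, \<alpha>) else 0)" for a \<alpha>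
      unfolding P_def lookup_sum lookup_single when_def using finM by (simp add: sum.delta)
    show ?thesis
    proof (rule that[of P])
      from c(1) obtain a \<alpha> where "a \<le> bound" "\<alpha> \<in> ?M" "c (a, \<alpha>) \<noteq> 0" by auto
      then have "lookup (P a) \<alpha> \<noteq> 0" by (simp add: lookP)
      then have "P a \<noteq> 0" by auto
      with \<open>a \<le> bound\<close> show "\<exists>a\<le>bound. P a \<noteq> 0" by blast
      show "(\<Sum>a\<le>bound. poly_eval x l ^ a * poly_eval (\<lambda>k. poly_eval x (vpol k)) (P a)) = 0"
        if "x \<in> slice" for x
      proof -
        have "(\<Sum>a\<le>bound. poly_eval x l ^ a * poly_eval (\<lambda>k. poly_eval x (vpol k)) (P a))
            = (\<Sum>a\<le>bound. \<Sum>\<alpha>\<in>?M. c (a, \<alpha>) * poly_eval x (l ^ a * mval vpol \<alpha>))"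
          unfolding P_def eval.hom_sum sum_distrib_left
          by (intro sum.cong refl) (simp add: eval.hom_mult eval.hom_power)
        also have "\<dots> = (\<Sum>j\<in>?J. c j * poly_eval x (l ^ fst j * mval vpol (snd j)))"
          by (simp add: sum.cartesian_product case_prod_unfold)
        finally show ?thesis using c(2)[OF that] by simp
      qed
    qed
  qed
qed

text \<open>The relation of a linear form must not become trivial at \<open>v\<close>, so one of its
  nonzero coefficients is kept nonzero. This is done at once for all forms \<open>l t\<close> with
  \<open>t \<le> K\<close>. Then any \<open>bound + 1\<close> points of the fibre are separated by
  one of these forms, which gives too many roots for degree \<open>bound\<close>.\<close>

theorem slice_fibre_bound:
  assumes "c \<noteq> 0"
  obtains v where "poly_eval v c \<noteq> 0" "\<not> at_least (Suc bound) (slice_fibre v)"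
proof -
  obtain idx :: "'n option \<Rightarrow> nat" where "bij_betw idx UNIV {0..<CARD('n option)}"
    using ex_bij_betw_finite_nat[of "UNIV :: 'n option set"] by auto
  then have idx: "inj idx" "\<And>i. idx i < CARD('n option)" by (auto simp: bij_betw_def)
  define K where "K = Suc bound * Suc bound * CARD('n option)"
  define l where "l t = (\<Sum>i\<in>UNIV. Const (of_nat t ^ idx i) * Var (wm_var i))" for t :: nat
  have evl: "poly_eval x (l t) = (\<Sum>i\<in>UNIV. of_nat t ^ idx i * x (wm_var i))" for x t
    by (simp add: l_def eval.hom_sum eval.hom_mult)
  have kl: "keys (l t) \<subseteq> TG 0 1" for t
    unfolding l_def
  proof (rule keys_sum_subset)
    fix i :: "'n option"
    have "single (wm_var i) 1 \<in> TG 0 1"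
      by (cases i) (auto simp: wm_var_def TG_def)
    then show "keys (Const (of_nat t ^ idx i) * Var (wm_var i)) \<subseteq> TG 0 1"
      by (intro keys_mult_graded[of "{0}" "{single (wm_var i) 1}"] keys_Const) (auto simp: keys_Var)
  qed
  have "\<forall>t. \<exists>P. (\<exists>a\<le>bound. P a \<noteq> 0) \<and> (\<forall>x\<in>slice.
      (\<Sum>a\<le>bound. poly_eval x (l t) ^ a * poly_eval (\<lambda>k. poly_eval x (vpol k)) (P a)) = 0)"
  proof
    fix t
    show "\<exists>P. (\<exists>a\<le>bound. P a \<noteq> 0) \<and> (\<forall>x\<in>slice.
      (\<Sum>a\<le>bound. poly_eval x (l t) ^ a * poly_eval (\<lambda>k. poly_eval x (vpol k)) (P a)) = 0)"
    proof (rule slice_relation[OF kl[of t]])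
      fix P :: "nat \<Rightarrow> 'n mpoly"
      assume "\<exists>a\<le>bound. P a \<noteq> 0" "\<And>x. x \<in> slice \<Longrightarrow>
        (\<Sum>a\<le>bound. poly_eval x (l t) ^ a * poly_eval (\<lambda>k. poly_eval x (vpol k)) (P a)) = 0"
      then show ?thesis by (intro exI[of _ P]) simp
    qed
  qed
  from choice[OF this] obtain P where P: "\<And>t. \<exists>a\<le>bound. P t a \<noteq> 0" "\<And>t x. x \<in> slice \<Longrightarrow>
      (\<Sum>a\<le>bound. poly_eval x (l t) ^ a * poly_eval (\<lambda>k. poly_eval x (vpol k)) (P t a)) = 0"
    by auto
  have "\<forall>t. \<exists>a. a \<le> bound \<and> P t a \<noteq> 0" using P(1) by blast
  from choice[OF this] obtain a0 where a0: "\<And>t. a0 t \<le> bound" "\<And>t. P t (a0 t) \<noteq> 0" by auto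
  \<comment> \<open>\<open>None\<close> stands for the prescribed condition \<open>c\<close>, and
    \<open>Some t\<close> for the coefficient kept in the relation of \<open>l t\<close>.\<close>
  define G where "G o' = (case o' of None \<Rightarrow> c | Some t \<Rightarrow> P t (a0 t))" for o'
  have "\<exists>v. \<forall>o'\<in>insert None (Some ` {..K}). poly_eval v (G o') \<noteq> 0"
  proof (rule common_nonzero_finite)
    fix o' assume "o' \<in> insert None (Some ` {..K})"
    have "G o' \<noteq> 0" using a0(2) assms by (simp add: G_def split: option.splits)
    then show "\<exists>v. poly_eval v (G o') \<noteq> 0" using mpoly_eq_0_iff[of "G o'"] by blast
  qed simp
  then obtain v where v: "\<forall>o'\<in>insert None (Some ` {..K}). poly_eval v (G o') \<noteq> 0" ..
  have vc: "poly_eval v c \<noteq> 0" using v by (auto simp: G_def)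
  have vP: "poly_eval v (P t (a0 t)) \<noteq> 0" if "t \<le> K" for t using v that by (auto simp: G_def)
  show ?thesis
  proof (rule that[OF vc])
    show "\<not> at_least (Suc bound) (slice_fibre v)"
    proof
      assume "at_least (Suc bound) (slice_fibre v)"
      then obtain h where h: "inj_on h {..<Suc bound}" "h ` {..<Suc bound} \<subseteq> slice_fibre v"
        by (auto simp: at_least_def)
      define S where "S = h ` {..<Suc bound}"
      have S: "finite S" "card S = Suc bound" "S \<subseteq> slice_fibre v"
        using h by (auto simp: S_def card_image)
      obtain t where t: "t \<le> K" "inj_on (\<lambda>y. \<Sum>i\<in>UNIV. of_nat t ^ idx i * y i) S"
        using separating_combination[OF S(1) eq_refl[OF S(2)] idx] unfolding K_def .
      define R where "R = (\<Sum>a\<le>bound. monom (poly_eval v (P t a)) a)"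
      have coeffR: "coeff R a = (if a \<le> bound then poly_eval v (P t a) else 0)" for a
        unfolding R_def coeff_sum coeff_monom by (simp add: sum.delta')
      have "coeff R (a0 t) \<noteq> 0" using a0(1) vP[OF t(1)] by (simp add: coeffR)
      then have "R \<noteq> 0" by auto
      have "degree R \<le> bound" by (rule degree_le) (auto simp: coeffR)
      have root: "poly R (\<Sum>i\<in>UNIV. of_nat t ^ idx i * y i) = 0" if "y \<in> S" for y
      proof -
        from that S(3) obtain x where x: "x \<in> slice" "\<forall>k. poly_eval x (vpol k) = v k" "y = (\<lambda>i. x (wm_var i))"
          unfolding slice_fibre_def by blast
        have "(\<lambda>k. poly_eval x (vpol k)) = v" using x(2) by (simp add: fun_eq_iff)
        then have "(\<Sum>a\<le>bound. poly_eval x (l t) ^ a * poly_eval v (P t a)) = 0"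
          using P(2)[OF x(1), of t] by simp
        then show ?thesis
          unfolding R_def poly_sum poly_monom x(3) evl[symmetric] by (simp add: mult.commute)
      qed
      have "card S = card ((\<lambda>y. \<Sum>i\<in>UNIV. of_nat t ^ idx i * y i) ` S)"
        using card_image[OF t(2)] by simp
      also have "\<dots> \<le> card {s. poly R s = 0}"
        using root by (intro card_mono poly_roots_finite \<open>R \<noteq> 0\<close>) auto
      also have "\<dots> \<le> bound" using card_poly_roots_bound[OF \<open>R \<noteq> 0\<close>] \<open>degree R \<le> bound\<close> by simp
      finally show False using S(2) by simp
    qed
  qed
qed

end

section \<open>Singular polynomials lie in a hypersurface\<close>

text \<open>With a constant filtration the grading lemmas track which variables occur.\<close>

lemma vars_in_grading: "monom_grading (\<lambda>_. {m. keys m \<subseteq> A})"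
  by unfold_locales (auto simp: keys_add_nat)

lemma vars_in_mult:
  fixes p p' :: "'v mpoly"
  shows "keys p \<subseteq> {m. keys m \<subseteq> A} \<Longrightarrow> keys p' \<subseteq> {m. keys m \<subseteq> A} \<Longrightarrow> keys (p * p') \<subseteq> {m. keys m \<subseteq> A}"
  by (rule keys_mult_graded) (auto simp: keys_add_nat)

lemma vars_in_Var: "v \<in> A \<Longrightarrow> keys (Var v) \<subseteq> {m. keys m \<subseteq> A}"
  by (auto simp: keys_Var)

lemma vars_in_Const: "keys (Const c) \<subseteq> {m. keys m \<subseteq> A}"
  using keys_Const[of c] by auto

lemma vars_in_uminus: "keys (p :: 'v mpoly) \<subseteq> B \<Longrightarrow> keys (- p) \<subseteq> B"
  by (auto simp: in_keys_iff)

lemma vars_in_mval: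
  assumes "\<And>v. v \<in> keys m \<Longrightarrow> y v \<in> A"
  shows "keys (mval (\<lambda>v. Var (y v)) m) \<subseteq> {m. keys m \<subseteq> A}"
  by (rule monom_grading.keys_mval[OF vars_in_grading]) (intro vars_in_Var assms)

lemma monoms_le_1:
  assumes "m \<in> monoms A d" "monom_degree m < 2"
  shows "m = 0 \<or> (\<exists>v\<in>A. m = single v 1)"
proof (cases "m = 0")
  case False
  have "keys m \<noteq> {}"
  proof
    assume "keys m = {}"
    then have "lookup m v = 0" for v using in_keys_iff[of v m] by simp
    then have "m = 0" by (intro poly_mapping_eqI) simp
    then show False using False by simp
  qed
  then obtain v where v: "v \<in> keys m" by blast
  then have "m = single v 1 + (m - single v 1)"
    by (intro monom_split_le) (simp add: in_keys_iff)
  then have md: "monom_degree m = 1 + monom_degree (m - single v 1)"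
    using monom_degree_add[of "single v 1" "m - single v 1"] by simp
  have "lookup (m - single v 1) w = 0" for w
    using lookup_le_monom_degree[of "m - single v 1" w] md assms(2) by simp
  then have "m - single v 1 = 0" by (intro poly_mapping_eqI) simp
  then have "m = single v 1" using \<open>m = single v 1 + (m - single v 1)\<close> by simp
  moreover have "v \<in> A" using v assms(1) by (auto simp: monoms_def)
  ultimately show ?thesis by blast
qed simp

lemma sum_monoms_split:
  fixes \<phi> :: "('v \<Rightarrow>\<^sub>0 nat) \<Rightarrow> 'b::comm_monoid_add"
  assumes "finite A" "d \<ge> 1"
  shows "(\<Sum>m\<in>monoms A d. \<phi> m)
    = (\<Sum>m\<in>{m\<in>monoms A d. 2 \<le> monom_degree m}. \<phi> m) + (\<phi> 0 + (\<Sum>v\<in>A. \<phi> (single v 1)))"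
proof -
  let ?B = "{m\<in>monoms A d. 2 \<le> monom_degree m}"
  let ?S = "(\<lambda>v. single v (1::nat)) ` A"
  have eq: "monoms A d = ?B \<union> insert 0 ?S"
  proof
    show "monoms A d \<subseteq> ?B \<union> insert 0 ?S"
    proof
      fix m assume "m \<in> monoms A d"
      then show "m \<in> ?B \<union> insert 0 ?S"
        using monoms_le_1[of m A d] by (cases "2 \<le> monom_degree m") auto
    qed
    show "?B \<union> insert 0 ?S \<subseteq> monoms A d" using assms(2) by (auto simp: monoms_def)
  qed
  have finB: "finite ?B" using finite_monoms[OF assms(1)] by simp
  have inj: "inj_on (\<lambda>v. single v (1::nat)) A"
    by (rule inj_onI) (metis lookup_single_eq lookup_single_not_eq one_neq_zero)
  have "0 \<notin> ?S"
  proof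
    assume "0 \<in> ?S"
    then show False
    proof (rule imageE)
      fix v assume "0 = single v (1::nat)"
      from arg_cong[OF this, of "\<lambda>m. lookup m v"] show False by simp
    qed
  qed
  have "(\<Sum>m\<in>monoms A d. \<phi> m) = (\<Sum>m\<in>?B. \<phi> m) + (\<Sum>m\<in>insert 0 ?S. \<phi> m)"
    by (subst eq, rule sum.union_disjoint[OF finB]) (use assms(1) in auto)
  also have "(\<Sum>m\<in>insert 0 ?S. \<phi> m) = \<phi> 0 + (\<Sum>v\<in>A. \<phi> (single v 1))"
    using \<open>0 \<notin> ?S\<close> assms(1) sum.reindex[OF inj, of \<phi>] by (simp add: comp_def)
  finally show ?thesis .
qed

text \<open>Plays the part of a discriminant: the variables of \<Delta> are monomials, its points
  are coefficient vectors. With all variables in \<open>A\<close> it yields smoothness, with a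
  single one distinct roots on a coordinate axis.\<close>

definition detects_singular :: "'v set \<Rightarrow> nat \<Rightarrow> ('v \<Rightarrow>\<^sub>0 nat) mpoly \<Rightarrow> bool" where
  "detects_singular A d \<Delta> \<longleftrightarrow> \<Delta> \<noteq> 0 \<and> (\<forall>m\<in>keys \<Delta>. keys m \<subseteq> monoms A d) \<and>
    (\<forall>c x. (\<Sum>m\<in>monoms A d. c m * mval x m) = 0 \<longrightarrow>
      (\<forall>v\<in>A. (\<Sum>m\<in>monoms A d. of_nat (lookup m v) * c m * mval x (m - single v 1)) = 0) \<longrightarrow>
      poly_eval c \<Delta> = 0)"

text \<open>At a singular point the coefficients of degree at most one are determined by the point
  and the other coefficients, so singular polynomials form the image of a space of smaller dimension.\<close>

lemma singular_hypersurface: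
  fixes A :: "'v set"
  assumes A: "finite A" and d: "d \<ge> 1"
  shows "\<exists>\<Delta>. detects_singular A d \<Delta>"
proof -
  let ?M = "monoms A d"
  define B where "B = {m\<in>?M. 2 \<le> monom_degree m}"
  \<comment> \<open>The parameters are the point and the coefficients of degree at least two. They
    are one fewer than the coefficients, since the linear terms and the constant term outnumber the
    coordinates of the point by one.\<close>
  define X where "X = (Inl ` A \<union> Inr ` B :: ('v + ('v \<Rightarrow>\<^sub>0 nat)) set)"
  define z where "z = (\<lambda>v. Var (Inl v :: 'v + ('v \<Rightarrow>\<^sub>0 nat)))"
  define g1 where "g1 v = - (\<Sum>m\<in>B. Const (of_nat (lookup m v)) * Var (Inr m) * mval z (m - single v 1))" for v
  define g0 where "g0 = - (\<Sum>m\<in>B. Var (Inr m) * mval z m) - (\<Sum>v\<in>A. g1 v * z v)"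
  define g where "g m = (if m \<in> B then Var (Inr m) else if m = 0 then g0 else g1 (SOME v. v \<in> A \<and> m = single v 1))" for m
  have finM: "finite ?M" by (rule finite_monoms[OF A])
  have finB: "finite B" using finM by (simp add: B_def)
  have g_single: "g (single v 1) = g1 v" if "v \<in> A" for v
  proof -
    have "single v (1::nat) \<noteq> 0"
    proof
      assume "single v (1::nat) = 0"
      from arg_cong[OF this, of "\<lambda>m. lookup m v"] show False by simp
    qed
    moreover have "(SOME w. w \<in> A \<and> single v (1::nat) = single w 1) = v"
    proof (rule some_equality)
      fix w assume "w \<in> A \<and> single v (1::nat) = single w 1"
      then have "lookup (single v (1::nat)) v = lookup (single w 1) v" by simp
      then show "w = v" by (cases "w = v") (auto simp: lookup_single)
    qed (use that in simp)
    ultimately show ?thesis by (simp add: g_def B_def)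
  qed
  have cM: "card ?M = card B + (1 + card A)"
    using sum_monoms_split[OF A d, of "\<lambda>_. 1 :: nat"] by (simp add: B_def)
  have cX: "card X < card ?M"
  proof -
    have "card X \<le> card (Inl ` A :: ('v + ('v \<Rightarrow>\<^sub>0 nat)) set) + card (Inr ` B :: ('v + ('v \<Rightarrow>\<^sub>0 nat)) set)"
      unfolding X_def by (rule card_Un_le)
    also have "\<dots> = card A + card B" by (simp add: card_image)
    finally show ?thesis using cM by simp
  qed
  have vX: "Inl v \<in> X" if "v \<in> A" for v using that by (simp add: X_def)
  have mX: "Inr m \<in> X" if "m \<in> B" for m using that by (simp add: X_def)
  have kB: "keys m \<subseteq> A" if "m \<in> B" for m using that by (auto simp: B_def monoms_def)
  have kB': "keys (m - single v 1) \<subseteq> A" if "m \<in> B" for m v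
  proof -
    have "keys (m - single v 1) \<subseteq> keys m" by (auto simp: in_keys_iff lookup_minus)
    then show ?thesis using kB[OF that] by blast
  qed
  have kg1: "keys (g1 v) \<subseteq> {m. keys m \<subseteq> X}" for v
    unfolding g1_def z_def
    by (intro vars_in_uminus keys_sum_subset vars_in_mult vars_in_Const vars_in_Var vars_in_mval mX vX)
      (use kB' in auto)
  have kg0: "keys g0 \<subseteq> {m. keys m \<subseteq> X}"
    unfolding g0_def z_def
    by (intro keys_diff_subset vars_in_uminus keys_sum_subset vars_in_mult vars_in_Var vars_in_mval mX vX kg1)
      (use kB in auto)
  have kg: "keys k \<subseteq> X" if "k \<in> keys (g m)" for m k
  proof -
    have "keys (g m) \<subseteq> {k. keys k \<subseteq> X}"
      using kg0 kg1 vars_in_Var[OF mX, of m] by (auto simp: g_def)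
    then show ?thesis using that by blast
  qed
  have finX: "finite X" using A finB by (simp add: X_def)
  show ?thesis
  proof (rule algebraic_dependence[OF finM finX cX kg])
    fix \<Delta> :: "('v \<Rightarrow>\<^sub>0 nat) mpoly"
    assume \<Delta>: "\<Delta> \<noteq> 0" "\<And>m. m \<in> keys \<Delta> \<Longrightarrow> keys m \<subseteq> ?M"
      "\<And>x. poly_eval (\<lambda>m. poly_eval x (g m)) \<Delta> = 0"
    have "poly_eval c \<Delta> = 0"
      if s0: "(\<Sum>m\<in>?M. c m * mval x m) = 0"
        and s1: "\<And>v. v \<in> A \<Longrightarrow> (\<Sum>m\<in>?M. of_nat (lookup m v) * c m * mval x (m - single v 1)) = 0"
      for c and x :: "'v \<Rightarrow> complex"
    proof -
      let ?y = "case_sum x c"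
      have z: "poly_eval ?y (z v) = x v" for v by (simp add: z_def)
      have lin: "b = - a - e" if "a + (b + e) = 0" for a b e :: complex
      proof -
        from that have "b + (a + e) = 0" by (simp add: ac_simps)
        then have "b = - (a + e)" by (simp only: eq_neg_iff_add_eq_0)
        then show ?thesis by simp
      qed
      have e1: "poly_eval ?y (g1 v) = c (single v 1)" if v: "v \<in> A" for v
      proof -
        have "(\<Sum>w\<in>A. of_nat (lookup (single w 1) v) * c (single w 1) * mval x (single w 1 - single v 1))
            = (\<Sum>w\<in>A. if w = v then c (single v 1) else 0)"
          by (intro sum.cong) (auto simp: lookup_single)
        also have "\<dots> = c (single v 1)" using A v by simp
        finally have "(\<Sum>m\<in>B. of_nat (lookup m v) * c m * mval x (m - single v 1)) + c (single v 1) = 0"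
          using s1[OF v] sum_monoms_split[OF A d, of "\<lambda>m. of_nat (lookup m v) * c m * mval x (m - single v 1)"]
          by (simp add: B_def)
        then show ?thesis
          by (simp add: g1_def eval.hom_uminus eval.hom_sum eval.hom_mult z eq_neg_iff_add_eq_0 neg_eq_iff_add_eq_0)
      qed
      have e0: "poly_eval ?y g0 = c 0"
      proof -
        have "(\<Sum>m\<in>B. c m * mval x m) + (c 0 + (\<Sum>v\<in>A. c (single v 1) * x v)) = 0"
          using s0 sum_monoms_split[OF A d, of "\<lambda>m. c m * mval x m"] by (simp add: B_def)
        moreover have "poly_eval ?y g0 = - (\<Sum>m\<in>B. c m * mval x m) - (\<Sum>v\<in>A. c (single v 1) * x v)"
          by (simp add: g0_def eval.hom_minus eval.hom_uminus eval.hom_sum eval.hom_mult z e1)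
        ultimately show ?thesis using lin by simp
      qed
      have "poly_eval ?y (g m) = c m" if m: "m \<in> ?M" for m
      proof (cases "m \<in> B")
        case False
        then have "monom_degree m < 2" using m by (simp add: B_def)
        from monoms_le_1[OF m this] show ?thesis
        proof
          assume "m = 0"
          then show ?thesis using e0 by (simp add: g_def B_def)
        next
          assume "\<exists>v\<in>A. m = single v 1"
          then obtain v where "v \<in> A" "m = single v 1" by blast
          then show ?thesis using e1 g_single by simp
        qed
      qed (simp add: g_def)
      then have "poly_eval (\<lambda>m. poly_eval ?y (g m)) \<Delta> = poly_eval c \<Delta>"
        using \<Delta>(2) by (intro poly_eval_cong) blast
      then show ?thesis using \<Delta>(3)[of ?y] by simp
    qed
    then have "detects_singular A d \<Delta>" using \<Delta>(1,2) unfolding detects_singular_def by blast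
    then show ?thesis by (rule exI)
  qed
qed

lemma poly_eval_partial_deriv:
  assumes "finite M" "keys f \<subseteq> M"
  shows "poly_eval x (partial_deriv v f) = (\<Sum>m\<in>M. of_nat (lookup m v) * lookup f m * mval x (m - single v 1))"
proof -
  have "poly_eval x (partial_deriv v f)
      = (\<Sum>m\<in>keys f. of_nat (lookup m v) * lookup f m * mval x (m - single v 1))"
    by (simp add: partial_deriv_def eval.hom_sum)
  also have "\<dots> = (\<Sum>m\<in>M. of_nat (lookup m v) * lookup f m * mval x (m - single v 1))"
    using assms by (intro sum.mono_neutral_left) (auto simp: in_keys_iff)
  finally show ?thesis .
qed

section \<open>Products of bivariate polynomials lie in a hypersurface\<close>

definition tri :: "nat \<Rightarrow> (nat \<times> nat) set" where
  "tri n = {(i, j). i + j \<le> n}"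

lemma tri_Sigma: "tri n = (SIGMA i:{..n}. {..n - i})"
  by (auto simp: tri_def)

lemma finite_tri [simp]: "finite (tri n)"
  by (simp add: tri_Sigma)

lemma card_tri: "2 * card (tri n) = (n + 1) * (n + 2)"
proof -
  have "card (tri n) = (\<Sum>i\<le>n. Suc (n - i))" by (simp add: tri_Sigma card_SigmaI)
  also have "\<dots> = (\<Sum>i\<le>n. Suc i)"
    by (rule sum.reindex_bij_witness[of _ "\<lambda>i. n - i" "\<lambda>i. n - i"]) auto
  also have "2 * (\<Sum>i\<le>n. Suc i) = (n + 1) * (n + 2)" by (induction n) auto
  finally show ?thesis .
qed

definition coeff2 :: "complex poly poly \<Rightarrow> nat \<times> nat \<Rightarrow> complex" where
  "coeff2 F = (\<lambda>(i, j). coeff (coeff F i) j)"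

lemma coeff2_mult:
  "coeff2 (F * G) (i, j) = (\<Sum>p\<le>i. \<Sum>q\<le>j. coeff2 F (p, q) * coeff2 G (i - p, j - q))"
  by (simp add: coeff2_def coeff_mult coeff_sum)

definition detects_product :: "nat \<Rightarrow> nat \<Rightarrow> (nat \<times> nat) mpoly \<Rightarrow> bool" where
  "detects_product a b Q \<longleftrightarrow> Q \<noteq> 0 \<and> (\<forall>m\<in>keys Q. keys m \<subseteq> tri (a + b)) \<and>
    (\<forall>F G. (\<forall>k. k \<notin> tri a \<longrightarrow> coeff2 F k = 0) \<longrightarrow> (\<forall>k. k \<notin> tri b \<longrightarrow> coeff2 G k = 0) \<longrightarrow>
       coeff2 F (0, 0) \<noteq> 0 \<longrightarrow> poly_eval (coeff2 (F * G)) Q = 0)"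

text \<open>Normalizing the constant coefficient of one factor to \<open>1\<close> saves one parameter, which the
  count needs when \<open>a = b = 1\<close>.\<close>

lemma product_hypersurface:
  assumes "a \<ge> 1" "b \<ge> 1"
  shows "\<exists>Q. detects_product a b Q"
proof -
  define X where "X = (Inl ` (tri a - {(0, 0)}) \<union> Inr ` tri b :: (nat \<times> nat + nat \<times> nat) set)"
  define \<alpha> where "\<alpha> k = (if k = (0, 0) then 1 else if k \<in> tri a then Var (Inl k :: nat \<times> nat + nat \<times> nat) else 0)" for k
  define \<beta> where "\<beta> k = (if k \<in> tri b then Var (Inr k :: nat \<times> nat + nat \<times> nat) else 0)" for k
  define g where "g = (\<lambda>(i, j). \<Sum>p\<le>i. \<Sum>q\<le>j. \<alpha> (p, q) * \<beta> (i - p, j - q))"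
  have 00: "(0, 0) \<in> tri n" for n by (simp add: tri_def)
  have "card X \<le> card (tri a - {(0, 0)}) + card (tri b)"
    unfolding X_def by (rule order.trans[OF card_Un_le]) (simp add: card_image)
  also have "\<dots> < card (tri a) + card (tri b)"
    using card_Diff1_less[OF finite_tri 00, of a] by simp
  also have "\<dots> \<le> card (tri (a + b))"
  proof -
    have "1 * 1 \<le> a * b" using assms by (intro mult_le_mono)
    moreover have "(a + b + 1) * (a + b + 2) + 2 = (a + 1) * (a + 2) + (b + 1) * (b + 2) + 2 * (a * b)"
      by (simp add: algebra_simps)
    ultimately have "2 * card (tri a) + 2 * card (tri b) \<le> 2 * card (tri (a + b))"
      unfolding card_tri by linarith
    then show ?thesis by simp
  qed
  finally have cX: "card X < card (tri (a + b))" .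
  have finX: "finite X" by (simp add: X_def)
  have k\<alpha>: "keys (\<alpha> k) \<subseteq> {m. keys m \<subseteq> X}" for k
    using vars_in_Var[of "Inl k" X] by (auto simp: \<alpha>_def X_def)
  have k\<beta>: "keys (\<beta> k) \<subseteq> {m. keys m \<subseteq> X}" for k
    using vars_in_Var[of "Inr k" X] by (auto simp: \<beta>_def X_def)
  have "keys (g k) \<subseteq> {m. keys m \<subseteq> X}" for k
    unfolding g_def case_prod_unfold by (intro keys_sum_subset vars_in_mult k\<alpha> k\<beta>)
  then have kg: "\<And>k m. m \<in> keys (g k) \<Longrightarrow> keys m \<subseteq> X" by blast
  show ?thesis
  proof (rule algebraic_dependence[OF finite_tri finX cX kg])
    fix Q :: "(nat \<times> nat) mpoly"
    assume Q: "Q \<noteq> 0" "\<And>m. m \<in> keys Q \<Longrightarrow> keys m \<subseteq> tri (a + b)"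
      "\<And>x. poly_eval (\<lambda>j. poly_eval x (g j)) Q = 0"
    have "poly_eval (coeff2 (F * G)) Q = 0"
      if F: "\<And>k. k \<notin> tri a \<Longrightarrow> coeff2 F k = 0" and G: "\<And>k. k \<notin> tri b \<Longrightarrow> coeff2 G k = 0"
        and F0: "coeff2 F (0, 0) \<noteq> 0" for F G
    proof -
      define c where "c = coeff2 F (0, 0)"
      \<comment> \<open>Moving the constant coefficient of \<open>F\<close> over to \<open>G\<close>
        normalizes the first factor and keeps the product.\<close>
      let ?x = "case_sum (\<lambda>k. coeff2 F k / c) (\<lambda>k. c * coeff2 G k)"
      have "poly_eval ?x (\<alpha> k) = coeff2 F k / c" for k
        using F[of k] F0 by (auto simp: \<alpha>_def c_def)
      moreover have "poly_eval ?x (\<beta> k) = c * coeff2 G k" for k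
        using G[of k] by (auto simp: \<beta>_def)
      ultimately have "poly_eval ?x (g (i, j)) = coeff2 (F * G) (i, j)" for i j
        using F0 by (simp add: g_def eval.hom_sum eval.hom_mult coeff2_mult c_def)
      then have "(\<lambda>k. poly_eval ?x (g k)) = coeff2 (F * G)" by (auto simp: fun_eq_iff)
      then show ?thesis using Q(3)[of ?x] by simp
    qed
    then have "detects_product a b Q" using Q(1,2) unfolding detects_product_def by blast
    then show ?thesis by (rule exI)
  qed
qed

section \<open>Irreducible bivariate polynomials\<close>

lemma coeff2_supp_iff:
  "(\<forall>k. k \<notin> tri n \<longrightarrow> coeff2 F k = 0) \<longleftrightarrow> (\<forall>i. coeff F i \<noteq> 0 \<longrightarrow> i + degree (coeff F i) \<le> n)"
proof (intro iffI allI impI)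
  fix i assume *: "\<forall>k. k \<notin> tri n \<longrightarrow> coeff2 F k = 0" "coeff F i \<noteq> 0"
  then have "coeff2 F (i, degree (coeff F i)) \<noteq> 0" by (simp add: coeff2_def)
  with *(1) show "i + degree (coeff F i) \<le> n" by (auto simp: tri_def)
next
  fix k assume *: "\<forall>i. coeff F i \<noteq> 0 \<longrightarrow> i + degree (coeff F i) \<le> n" "k \<notin> tri n"
  obtain i j where k: "k = (i, j)" by fastforce
  show "coeff2 F k = 0"
  proof (cases "coeff F i = 0")
    case False
    then have "degree (coeff F i) < j" using * by (fastforce simp: k tri_def)
    then show ?thesis by (simp add: k coeff2_def coeff_eq_0)
  qed (simp add: k coeff2_def)
qed

text \<open>A leading term for the total degree, ties being broken by the larger exponent of the
  outer variable.\<close>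

lemma max_weight_coeff:
  fixes G :: "complex poly poly"
  assumes "G \<noteq> 0"
  obtains w i where "coeff G i \<noteq> 0" "i + degree (coeff G i) = w"
    "\<And>j. coeff G j \<noteq> 0 \<Longrightarrow> j + degree (coeff G j) \<le> w"
    "\<And>j. coeff G j \<noteq> 0 \<Longrightarrow> i < j \<Longrightarrow> j + degree (coeff G j) < w"
proof -
  let ?S = "{i. coeff G i \<noteq> 0}"
  let ?w = "\<lambda>i. i + degree (coeff G i)"
  have fin: "finite ?S" by (rule finite_subset[of _ "{..degree G}"]) (auto intro: le_degree)
  have ne: "?S \<noteq> {}" using assms by (auto intro!: exI[of _ "degree G"])
  define w where "w = Max (?w ` ?S)"
  define i where "i = Max {i\<in>?S. ?w i = w}"
  have "w \<in> ?w ` ?S" unfolding w_def using fin ne by (intro Max_in) auto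
  then have "{i\<in>?S. ?w i = w} \<noteq> {}" by auto
  then have i: "i \<in> {i\<in>?S. ?w i = w}" unfolding i_def using fin by (intro Max_in) auto
  have le: "?w j \<le> w" if "coeff G j \<noteq> 0" for j
    unfolding w_def using fin that by (intro Max_ge) auto
  have "?w j < w" if "coeff G j \<noteq> 0" "i < j" for j
  proof (rule ccontr)
    assume "\<not> ?w j < w"
    then have "j \<in> {i\<in>?S. ?w i = w}" using le[OF that(1)] that(1) by simp
    then have "j \<le> i" unfolding i_def using fin by (intro Max_ge) auto
    then show False using that(2) by simp
  qed
  with i le show ?thesis using that by blast
qed

text \<open>Total degrees of factors add, because the product of the two leading terms meets no
  other product of the same bidegree and so cannot cancel.\<close>

lemma weight_mult:
  fixes G H :: "complex poly poly"
  assumes "G \<noteq> 0" "H \<noteq> 0" "\<And>i. coeff (G * H) i \<noteq> 0 \<Longrightarrow> i + degree (coeff (G * H) i) \<le> n"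
  obtains a b where "a + b \<le> n"
    "\<And>j. coeff G j \<noteq> 0 \<Longrightarrow> j + degree (coeff G j) \<le> a"
    "\<And>j. coeff H j \<noteq> 0 \<Longrightarrow> j + degree (coeff H j) \<le> b"
proof (rule max_weight_coeff[OF assms(1)], rule max_weight_coeff[OF assms(2)])
  fix a i b k
  assume G: "coeff G i \<noteq> 0" "i + degree (coeff G i) = a"
    "\<And>j. coeff G j \<noteq> 0 \<Longrightarrow> j + degree (coeff G j) \<le> a"
    "\<And>j. coeff G j \<noteq> 0 \<Longrightarrow> i < j \<Longrightarrow> j + degree (coeff G j) < a"
  assume H: "coeff H k \<noteq> 0" "k + degree (coeff H k) = b"
    "\<And>j. coeff H j \<noteq> 0 \<Longrightarrow> j + degree (coeff H j) \<le> b"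
    "\<And>j. coeff H j \<noteq> 0 \<Longrightarrow> k < j \<Longrightarrow> j + degree (coeff H j) < b"
  let ?J = "degree (coeff G i) + degree (coeff H k)"
  have zero: "coeff (coeff G p * coeff H (i + k - p)) ?J = 0" if p: "p \<le> i + k" "p \<noteq> i" for p
  proof (cases "coeff G p = 0 \<or> coeff H (i + k - p) = 0")
    case False
    then have nz: "coeff G p \<noteq> 0" "coeff H (i + k - p) \<noteq> 0" by auto
    have "p + degree (coeff G p) + (i + k - p + degree (coeff H (i + k - p))) < a + b"
    proof (cases "p < i")
      case True
      then have "k < i + k - p" by simp
      then show ?thesis using G(3)[OF nz(1)] H(4)[OF nz(2)] by linarith
    next
      case False
      then have "i < p" using p(2) by simp
      then show ?thesis using G(4)[OF nz(1)] H(3)[OF nz(2)] by linarith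
    qed
    then have "degree (coeff G p) + degree (coeff H (i + k - p)) < ?J"
      using G(2) H(2) p(1) by linarith
    then have "degree (coeff G p * coeff H (i + k - p)) < ?J"
      using degree_mult_le[of "coeff G p" "coeff H (i + k - p)"] by linarith
    then show ?thesis by (rule coeff_eq_0)
  qed auto
  have "coeff (coeff (G * H) (i + k)) ?J = (\<Sum>p\<le>i + k. coeff (coeff G p * coeff H (i + k - p)) ?J)"
    by (simp add: coeff_mult[of G H] coeff_sum)
  also have "\<dots> = coeff (coeff G i * coeff H (i + k - i)) ?J"
    using sum.remove[of "{..i + k}" i "\<lambda>p. coeff (coeff G p * coeff H (i + k - p)) ?J"] zero
    by simp
  also have "\<dots> \<noteq> 0" using G(1) H(1) by (simp add: coeff_mult_degree_sum)
  finally have J: "coeff (coeff (G * H) (i + k)) ?J \<noteq> 0" .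
  then have "coeff (G * H) (i + k) \<noteq> 0" by auto
  from assms(3)[OF this] have "i + k + ?J \<le> n" using le_degree[OF J] by linarith
  then have "a + b \<le> n" using G(2) H(2) by linarith
  then show ?thesis using G(3) H(3) by (rule that)
qed

text \<open>The constant coefficient of the \<open>d\<close>-th power makes the degree in the outer
  variable equal to the total degree, for \<open>F\<close> and hence for both factors. A factor of
  outer degree zero is then a constant; otherwise the total degrees are positive with sum
  \<open>d\<close>, the case excluded by \<open>prod\<close>.\<close>

lemma irreducible_bivariate:
  fixes F :: "complex poly poly"
  assumes "\<And>k. k \<notin> tri d \<Longrightarrow> coeff2 F k = 0" "coeff F d = [:l:]" "l \<noteq> 0" "d \<ge> 1"
    and F0: "coeff2 F (0, 0) \<noteq> 0"
    and prod: "\<And>a b G H. a \<ge> 1 \<Longrightarrow> b \<ge> 1 \<Longrightarrow> a + b = d \<Longrightarrow> F = G * H \<Longrightarrow>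
        (\<And>k. k \<notin> tri a \<Longrightarrow> coeff2 G k = 0) \<Longrightarrow> (\<And>k. k \<notin> tri b \<Longrightarrow> coeff2 H k = 0) \<Longrightarrow>
        coeff2 G (0, 0) \<noteq> 0 \<Longrightarrow> False"
  shows "degree F = d" "irreducible F"
proof -
  have w: "\<And>i. coeff F i \<noteq> 0 \<Longrightarrow> i + degree (coeff F i) \<le> d"
    using assms(1) coeff2_supp_iff[of d F] by blast
  have "degree F \<le> d"
  proof (rule degree_le, intro allI impI)
    fix i assume "d < i"
    then show "coeff F i = 0" using w[of i] by (cases "coeff F i = 0") simp_all
  qed
  moreover have "coeff F d \<noteq> 0" using assms(2,3) by simp
  ultimately show degF: "degree F = d" using le_degree[of F d] by simp
  have "F \<noteq> 0" using \<open>coeff F d \<noteq> 0\<close> by auto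
  show "irreducible F"
  proof (rule irreducibleI)
    show "\<not> F dvd 1" using degF assms(4) dvd_imp_degree_le[of F 1] by auto
    fix G H assume FGH: "F = G * H"
    have nz: "G \<noteq> 0" "H \<noteq> 0" using FGH \<open>F \<noteq> 0\<close> by auto
    have deg: "degree G + degree H = d" using FGH degF nz by (simp add: degree_mult_eq)
    have "lead_coeff G * lead_coeff H = [:l:]"
      using assms(2) degF FGH lead_coeff_mult[of G H] by simp
    then have "degree (lead_coeff G * lead_coeff H) = 0" by simp
    then have lc: "degree (lead_coeff G) = 0" "degree (lead_coeff H) = 0"
      using nz by (simp_all add: degree_mult_eq)
    show "G dvd 1 \<or> H dvd 1"
    proof (cases "degree G = 0 \<or> degree H = 0")
      case True
      have unit: "P dvd 1" if deg0: "degree P = 0" and lc0: "degree (lead_coeff P) = 0" and nz: "P \<noteq> 0"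
        for P :: "complex poly poly"
      proof -
        obtain p where P: "P = [:p:]" using degree_eq_zeroE[OF deg0] by blast
        then have "degree p = 0" using that(2) by simp
        then obtain c where c: "p = [:c:]" using degree_eq_zeroE by blast
        have "c \<noteq> 0" using nz P c by auto
        then have "1 = P * [:[:inverse c:]:]" by (simp add: P c one_pCons)
        then show ?thesis by (rule dvdI)
      qed
      from True show ?thesis using unit lc nz by blast
    next
      case False
      show ?thesis
      proof (rule weight_mult[OF nz, of d])
        show "i + degree (coeff (G * H) i) \<le> d" if "coeff (G * H) i \<noteq> 0" for i
          using w that by (simp add: FGH)
        fix a b assume ab: "a + b \<le> d"
          and Ga: "\<And>j. coeff G j \<noteq> 0 \<Longrightarrow> j + degree (coeff G j) \<le> a"
          and Hb: "\<And>j. coeff H j \<noteq> 0 \<Longrightarrow> j + degree (coeff H j) \<le> b"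
        have "degree G \<le> a" "degree H \<le> b"
          using Ga[of "degree G"] Hb[of "degree H"] nz by simp_all
        then have eq: "a = degree G" "b = degree H" using ab deg by simp_all
        have G: "\<forall>k. k \<notin> tri a \<longrightarrow> coeff2 G k = 0" unfolding coeff2_supp_iff using Ga by blast
        have H: "\<forall>k. k \<notin> tri b \<longrightarrow> coeff2 H k = 0" unfolding coeff2_supp_iff using Hb by blast
        have "coeff2 F (0, 0) = coeff2 G (0, 0) * coeff2 H (0, 0)"
          by (simp add: FGH coeff2_mult)
        then have G0: "coeff2 G (0, 0) \<noteq> 0" using F0 by auto
        have "False"
          by (rule prod[of a b G H]) (use False eq deg FGH G H G0 in auto)
        then show ?thesis ..
      qed
    qed
  qed (rule \<open>F \<noteq> 0\<close>)
qed

section \<open>Restriction to planes through a coordinate axis\<close>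

locale axis = fixes x1 :: "'n::finite"
begin

text \<open>The restriction to the plane \<open>{(x, t y)}\<close>, as a polynomial in \<open>x\<close> over \<open>\<complex>[t]\<close>.\<close>

definition rs :: "('n \<Rightarrow> complex) \<Rightarrow> 'n mpoly \<Rightarrow> complex poly poly" where
  "rs y = subst (\<lambda>a. [:[:a:]:]) (\<lambda>k. if k = x1 then [:0, 1:] else [:[:0, y k:]:])"

lemma rs_coeff_hom: "coeff_hom (\<lambda>a::complex. [:[:a:]:])"
  by (intro coeff_homI comm_ring_hom_comp[OF comm_ring_hom_pCons comm_ring_hom_pCons])

lemma rs_hom: "comm_ring_hom (rs y)"
  unfolding rs_def by (rule coeff_hom.comm_ring_hom_subst[OF rs_coeff_hom])

sublocale rs: comm_ring_hom "rs y" for y by (rule rs_hom)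

lemma poly_rs: "poly (poly (rs y p) [:x:]) t = poly_eval (\<lambda>k. if k = x1 then x else t * y k) p"
proof -
  have hom: "comm_ring_hom (\<lambda>F::complex poly poly. poly (poly F [:x:]) t)" by unfold_locales auto
  have "poly (poly (rs y p) [:x:]) t = subst (\<lambda>a. a)
      (\<lambda>k. poly (poly (if k = x1 then [:0, 1:] else [:[:0, y k:]:]) [:x:]) t) p"
    unfolding rs_def hom_subst[OF hom] by simp
  also have "(\<lambda>k. poly (poly (if k = x1 then [:0, 1:] else [:[:0, y k:]:]) [:x:]) t)
      = (\<lambda>k. if k = x1 then x else t * y k)" by (auto simp: fun_eq_iff)
  finally show ?thesis by (simp add: poly_eval_def)
qed

definition xdeg :: "('n \<Rightarrow>\<^sub>0 nat) \<Rightarrow> nat" where "xdeg m = lookup m x1"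
definition rest :: "('n \<Rightarrow>\<^sub>0 nat) \<Rightarrow> ('n \<Rightarrow>\<^sub>0 nat)" where "rest m = m - single x1 (xdeg m)"

lemma split_rest: "m = single x1 (xdeg m) + rest m"
  unfolding rest_def xdeg_def by (rule monom_split)

lemma degree_rest: "monom_degree m = xdeg m + monom_degree (rest m)"
  using arg_cong[OF split_rest, of monom_degree m] by simp

lemma rest_no_x1: "x1 \<notin> keys (rest m)"
  by (simp add: rest_def xdeg_def in_keys_iff lookup_minus)

text \<open>As \<open>t\<close> scales all coordinates but \<open>x1\<close>, its exponent records
  the degree in them, so the total degree can be read off the restriction.\<close>

lemma coeff_rs: "coeff (coeff (rs y p) i) j
    = (\<Sum>m\<in>keys p. if xdeg m = i \<and> monom_degree (rest m) = j then lookup p m * mval y (rest m) else 0)"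
proof -
  let ?Y = "\<lambda>k. if k = x1 then [:0, 1:] else [:[:0, y k:]:]"
  have pow: "[:0, c:] ^ k = monom (c ^ k) k" for c :: complex and k
    using monom_power[of c 1 k] by (simp add: monom_altdef)
  have pow2: "([:q:] :: complex poly poly) ^ k = [:q ^ k:]" for q k
    by (induction k) (auto simp: one_pCons)
  have prod_monom: "(\<Prod>k\<in>K. [:monom (a k) (e k):]) = [:monom (\<Prod>k\<in>K. a k) (\<Sum>k\<in>K. e k):]"
    if "finite K" for K :: "'n set" and a :: "'n \<Rightarrow> complex" and e
    using that by (induction K rule: finite_induct) (auto simp: mult_monom one_pCons ac_simps)
  have r: "mval ?Y (rest m) = [:monom (mval y (rest m)) (monom_degree (rest m)):]" for m
  proof -
    have "mval ?Y (rest m) = (\<Prod>k\<in>keys (rest m). [:monom (y k ^ lookup (rest m) k) (lookup (rest m) k):])"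
      unfolding mval_def by (intro prod.cong refl) (use rest_no_x1 in \<open>auto simp: pow pow2\<close>)
    then show ?thesis by (simp add: prod_monom mval_def monom_degree_def)
  qed
  have x1: "([:0, 1:] :: complex poly poly) ^ k = monom 1 k" for k
    using monom_power[of "1 :: complex poly" 1 k] by (simp add: monom_altdef)
  have m: "[:[:a:]:] * mval ?Y m = monom (monom (a * mval y (rest m)) (monom_degree (rest m))) (xdeg m)" for a m
  proof -
    have "mval ?Y m = mval ?Y (single x1 (xdeg m) + rest m)" by (simp only: split_rest[symmetric])
    also have "\<dots> = monom 1 (xdeg m) * [:monom (mval y (rest m)) (monom_degree (rest m)):]"
      by (simp only: mval_add r) (simp add: x1)
    finally show ?thesis by (simp add: smult_monom mult.commute[of "monom 1 _"])
  qed
  have "coeff (coeff (rs y p) i) j = (\<Sum>m\<in>keys p. coeff (coeff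
      (monom (monom (lookup p m * mval y (rest m)) (monom_degree (rest m))) (xdeg m)) i) j)"
    unfolding rs_def subst_def mval_def[symmetric] m by (simp only: coeff_sum)
  also have "\<dots> = (\<Sum>m\<in>keys p. if xdeg m = i \<and> monom_degree (rest m) = j then lookup p m * mval y (rest m) else 0)"
    by (intro sum.cong refl) (auto simp: coeff_monom)
  finally show ?thesis .
qed

lemma coeff_rs_eq_0:
  assumes "\<And>m. m \<in> keys p \<Longrightarrow> xdeg m < d" "d \<le> i"
  shows "coeff (rs y p) i = 0"
proof (rule poly_eqI)
  fix j
  have "coeff (coeff (rs y p) i) j = (\<Sum>m\<in>keys p. 0)"
    unfolding coeff_rs using assms by (intro sum.cong refl) force
  then show "coeff (coeff (rs y p) i) j = coeff 0 j" by simp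
qed

end

lemma sum_axis_monoms:
  fixes \<phi> :: "('n \<Rightarrow>\<^sub>0 nat) \<Rightarrow> 'b::comm_monoid_add"
  shows "(\<Sum>m\<in>monoms {i} d. \<phi> m) = (\<Sum>k\<le>d. \<phi> (single i k))"
proof (rule sum.reindex_bij_witness[of _ "\<lambda>k. single i k" "\<lambda>m. lookup m i"])
  fix m assume m: "m \<in> monoms {i} d"
  show eq: "single i (lookup m i) = m"
    by (rule poly_mapping_eqI) (use m in \<open>auto simp: lookup_single when_def monoms_def in_keys_iff subset_iff\<close>)
  show "lookup m i \<in> {..d}" using m lookup_le_monom_degree[of m i] by (auto simp: monoms_def)
  show "\<phi> (single i (lookup m i)) = \<phi> m" by (simp only: eq)
qed (auto simp: monoms_def)

lemma rsquarefree_card_roots: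
  fixes p :: "complex poly"
  assumes "rsquarefree p"
  shows "card {z. poly p z = 0} = degree p"
proof -
  have p: "p \<noteq> 0" using assms by (simp add: rsquarefree_def)
  have "smult (lead_coeff p) (\<Prod>z|poly p z = 0. [:-z, 1:]) = p"
    using complex_poly_decompose_rsquarefree[OF assms] .
  then have "degree p = degree (\<Prod>z|poly p z = 0. [:-z, 1:])"
    using p by (metis degree_smult_eq leading_coeff_0_iff)
  also have "\<dots> = (\<Sum>z|poly p z = 0. degree [:-z, 1:])"
    by (rule degree_prod_eq_sum_degree) auto
  also have "\<dots> = card {z. poly p z = 0}" by simp
  finally show ?thesis ..
qed

section \<open>Generic hypersurfaces are irreducible\<close>

text \<open>Distinct roots and irreducibility are demanded only on one axis and one coordinate
  plane. Being conditions of nonvanishing they spread: \<open>\<Delta>_f\<close> to almost all lines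
  parallel to the axis, \<open>Q_f\<close> to almost all planes through it. \<open>f0\<close>
  permits the normalization of a factor.\<close>

locale generic_hypersurface = axis x1 for x1 :: "'n::finite" +
  fixes f :: "'n mpoly" and x2 :: 'n and d :: nat
    and \<Delta> :: "('n \<Rightarrow>\<^sub>0 nat) mpoly" and Q :: "nat \<Rightarrow> (nat \<times> nat) mpoly"
  assumes x12: "x1 \<noteq> x2" and d: "d \<ge> 1" and f: "keys f \<subseteq> monoms UNIV d"
    and lead: "lookup f (single x1 d) \<noteq> 0" and f0: "lookup f 0 \<noteq> 0"
    and smooth: "\<And>z. poly_eval z f = 0 \<Longrightarrow> \<exists>k. poly_eval z (partial_deriv k f) \<noteq> 0"
    and \<Delta>: "detects_singular {x1} d \<Delta>"
    and \<Delta>_f: "poly_eval (lookup f) \<Delta> \<noteq> 0"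
    and Q: "\<And>a. 1 \<le> a \<Longrightarrow> a < d \<Longrightarrow> detects_product a (d - a) (Q a)"
    and Q_f: "\<And>a. 1 \<le> a \<Longrightarrow> a < d \<Longrightarrow>
       poly_eval (\<lambda>(i, j). lookup f (single x1 i + single x2 j)) (Q a) \<noteq> 0"
begin

lemma keys_f: "m \<in> keys f \<Longrightarrow> xdeg m + monom_degree (rest m) \<le> d"
  using f degree_rest[of m] by (auto simp: monoms_def)

lemma rest_eq_0: "monom_degree (rest m) = 0 \<Longrightarrow> m = single x1 (xdeg m)"
proof -
  assume "monom_degree (rest m) = 0"
  then have "lookup (rest m) k = 0" for k using lookup_le_monom_degree[of "rest m" k] by simp
  then have "rest m = 0" by (intro poly_mapping_eqI) simp
  then show ?thesis using split_rest[of m] by simp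
qed

lemma xdeg_single [simp]: "xdeg (single x1 i) = i" "rest (single x1 i) = 0"
  by (simp_all add: xdeg_def rest_def)

lemma coeff2_rs: "coeff2 (rs y p) (i, j)
    = (\<Sum>m\<in>keys p. if xdeg m = i \<and> monom_degree (rest m) = j then lookup p m * mval y (rest m) else 0)"
  by (simp add: coeff2_def coeff_rs)

lemma coeff2_rs_axis: "coeff2 (rs y p) (i, 0) = lookup p (single x1 i)"
proof -
  have "coeff2 (rs y p) (i, 0) = (\<Sum>m\<in>keys p. if m = single x1 i then lookup p m else 0)"
    unfolding coeff2_rs
  proof (intro sum.cong refl)
    fix m
    show "(if xdeg m = i \<and> monom_degree (rest m) = 0 then lookup p m * mval y (rest m) else 0)
        = (if m = single x1 i then lookup p m else 0)"
      using rest_eq_0[of m] by (cases "m = single x1 i") auto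
  qed
  also have "\<dots> = lookup p (single x1 i)" by (simp add: sum.delta in_keys_iff)
  finally show ?thesis .
qed

lemma rs_support: "k \<notin> tri d \<Longrightarrow> coeff2 (rs y f) k = 0"
proof -
  assume k: "k \<notin> tri d"
  obtain i j where ij: "k = (i, j)" by fastforce
  have "coeff2 (rs y f) (i, j) = (\<Sum>m\<in>keys f. 0)"
    unfolding coeff2_rs
  proof (intro sum.cong refl)
    fix m assume "m \<in> keys f"
    from keys_f[OF this] k show "(if xdeg m = i \<and> monom_degree (rest m) = j
        then lookup f m * mval y (rest m) else 0) = 0"
      by (auto simp: ij tri_def)
  qed
  then show ?thesis by (simp add: ij)
qed

lemma rs_lead: "coeff (rs y f) d = [:lookup f (single x1 d):]"
proof (rule poly_eqI)
  fix j
  show "coeff (coeff (rs y f) d) j = coeff [:lookup f (single x1 d):] j"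
  proof (cases j)
    case 0
    then show ?thesis using coeff2_rs_axis[of y f d] by (simp add: coeff2_def)
  next
    case (Suc j')
    have "coeff2 (rs y f) (d, j) = 0" by (rule rs_support) (simp add: Suc tri_def)
    then show ?thesis by (simp add: coeff2_def Suc)
  qed
qed

definition pc :: "nat \<times> nat \<Rightarrow> 'n mpoly" where
  "pc = (\<lambda>(i, j). \<Sum>m\<in>keys f. if xdeg m = i \<and> monom_degree (rest m) = j then single (rest m) (lookup f m) else 0)"

lemma poly_eval_pc: "poly_eval y (pc k) = coeff2 (rs y f) k"
proof -
  obtain i j where k: "k = (i, j)" by fastforce
  show ?thesis
    unfolding k pc_def prod.case coeff2_rs eval.hom_sum by (intro sum.cong refl) simp
qed

text \<open>One factor for every splitting of \<open>d\<close> into two positive degrees. Where the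
  product does not vanish, the restriction to the plane has no such factorization.\<close>

definition plane_disc :: "'n mpoly" where
  "plane_disc = (\<Prod>a\<in>{1..<d}. subst Const pc (Q a))"

lemma poly_eval_plane_disc:
  "poly_eval y plane_disc = (\<Prod>a\<in>{1..<d}. poly_eval (coeff2 (rs y f)) (Q a))"
  by (simp add: plane_disc_def eval.hom_prod poly_eval_pc)

lemma coeff2_rs_x2:
  "coeff2 (rs (\<lambda>k. if k = x2 then 1 else 0) f) (i, j) = lookup f (single x1 i + single x2 j)"
proof -
  let ?y = "\<lambda>k. if k = x2 then 1 else 0 :: complex"
  let ?m = "single x1 i + single x2 j :: 'n \<Rightarrow>\<^sub>0 nat"
  have rm: "xdeg ?m = i" "rest ?m = single x2 j"
    using x12 by (simp_all add: xdeg_def rest_def lookup_add lookup_single when_def)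
  have mv: "mval ?y (single x2 j) = 1" by simp
  have "coeff2 (rs ?y f) (i, j) = (\<Sum>m\<in>keys f. if m = ?m then lookup f m else 0)"
    unfolding coeff2_rs
  proof (intro sum.cong refl)
    fix m
    show "(if xdeg m = i \<and> monom_degree (rest m) = j then lookup f m * mval ?y (rest m) else 0)
        = (if m = ?m then lookup f m else 0)"
    proof (cases "m = ?m")
      case True
      then show ?thesis using rm mv by simp
    next
      case False
      have "mval ?y (rest m) = 0" if "xdeg m = i" "monom_degree (rest m) = j"
      proof (rule ccontr)
        assume "mval ?y (rest m) \<noteq> 0"
        then have "\<forall>k\<in>keys (rest m). ?y k ^ lookup (rest m) k \<noteq> 0"
          unfolding mval_def by (simp add: prod_zero_iff)
        then have sub: "keys (rest m) \<subseteq> {x2}"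
          by (auto simp: in_keys_iff split: if_splits)
        then have 0: "lookup (rest m) k = 0" if "k \<noteq> x2" for k using that by (auto simp: in_keys_iff)
        have "lookup (rest m) x2 = j"
          using that(2) monom_degree_superset[OF _ sub] by simp
        then have "rest m = single x2 j"
          using 0 by (intro poly_mapping_eqI) (auto simp: lookup_single when_def)
        then have "m = ?m" using split_rest[of m] that(1) by simp
        then show False using False by simp
      qed
      then show ?thesis using False by simp
    qed
  qed
  also have "\<dots> = lookup f ?m" by (simp add: sum.delta in_keys_iff)
  finally show ?thesis .
qed

lemma plane_disc_nonzero: "poly_eval (\<lambda>k. if k = x2 then 1 else 0) plane_disc \<noteq> 0"
proof -
  have "coeff2 (rs (\<lambda>k. if k = x2 then 1 else 0) f) = (\<lambda>(i, j). lookup f (single x1 i + single x2 j))"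
    by (auto simp: fun_eq_iff coeff2_rs_x2)
  then show ?thesis using Q_f by (simp add: poly_eval_plane_disc)
qed

lemma irreducible_rs:
  assumes "poly_eval y plane_disc \<noteq> 0"
  shows "degree (rs y f) = d" "irreducible (rs y f)"
proof -
  have f00: "coeff2 (rs y f) (0, 0) \<noteq> 0" using f0 by (simp add: coeff2_rs_axis)
  have prod: "False" if "1 \<le> a" "1 \<le> b" "a + b = d" "rs y f = G * H"
    "\<And>k. k \<notin> tri a \<Longrightarrow> coeff2 G k = 0" "\<And>k. k \<notin> tri b \<Longrightarrow> coeff2 H k = 0"
    "coeff2 G (0, 0) \<noteq> 0" for a b G H
  proof -
    have a: "a < d" "b = d - a" using that by auto
    have "poly_eval (coeff2 (G * H)) (Q a) = 0"
      using Q[OF that(1) a(1)] that(5-7) unfolding detects_product_def a(2) by blast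
    moreover have "a \<in> {1..<d}" using that a by simp
    ultimately show False using assms by (auto simp: poly_eval_plane_disc that(4)[symmetric])
  qed
  show "degree (rs y f) = d"
    by (rule irreducible_bivariate(1)[OF rs_support rs_lead lead d f00 prod])
  show "irreducible (rs y f)"
    by (rule irreducible_bivariate(2)[OF rs_support rs_lead lead d f00 prod])
qed

text \<open>No other monomial of degree at most \<open>d\<close> contains \<open>x1\<close> to the
  power \<open>d\<close>, so as a polynomial in \<open>x1\<close> the leading coefficient of
  \<open>f\<close> is a constant and division by \<open>f\<close> requires no denominators.\<close>

lemma division: "\<exists>k r. p = f * k + r \<and> (\<forall>m\<in>keys r. xdeg m < d)"
proof -
  define ok where "ok p \<longleftrightarrow> (\<exists>k r. p = f * k + r \<and> keys r \<subseteq> {m. xdeg m < d})" for p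
  have ok_mult: "ok (f * k)" for k unfolding ok_def by (intro exI[of _ k] exI[of _ 0]) simp
  have ok_add: "ok (p + q)" if "ok p" "ok q" for p q
  proof -
    from that obtain k r k' r' where "p = f * k + r" "keys r \<subseteq> {m. xdeg m < d}"
      "q = f * k' + r'" "keys r' \<subseteq> {m. xdeg m < d}" unfolding ok_def by blast
    then show ?thesis unfolding ok_def
      by (intro exI[of _ "k + k'"] exI[of _ "r + r'"] conjI keys_add_subset) (simp_all add: algebra_simps)
  qed
  have ok_sum: "(\<And>i. i \<in> I \<Longrightarrow> ok (g i)) \<Longrightarrow> ok (sum g I)" for I and g :: "('n \<Rightarrow>\<^sub>0 nat) \<Rightarrow> 'n mpoly"
    by (induction I rule: infinite_finite_induct) (use ok_mult[of 0] ok_add in auto)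
  have mono: "ok (single m a)" for m a
  proof (induction "xdeg m" arbitrary: m a rule: less_induct)
    case less
    show ?case
    proof (cases "xdeg m < d")
      case True
      then show ?thesis unfolding ok_def by (intro exI[of _ 0] exI[of _ "single m a"]) simp
    next
      case False
      define m' where "m' = m - single x1 d"
      have m: "m = single x1 d + m'"
        unfolding m'_def using False by (intro monom_split_le) (simp add: xdeg_def)
      let ?l = "lookup f (single x1 d)"
      have "f = single (single x1 d) ?l + (\<Sum>\<gamma>\<in>keys f - {single x1 d}. single \<gamma> (lookup f \<gamma>))"
      proof -
        have "single x1 d \<in> keys f" using lead by (simp add: in_keys_iff)
        then have "(\<Sum>\<gamma>\<in>keys f. single \<gamma> (lookup f \<gamma>))
            = single (single x1 d) ?l + (\<Sum>\<gamma>\<in>keys f - {single x1 d}. single \<gamma> (lookup f \<gamma>))"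
          by (intro sum.remove) auto
        then show ?thesis by (simp only: mpoly_sum_single)
      qed
      from arg_cong[OF this, of "\<lambda>p. p * single m' (a / ?l)"]
      have "f * single m' (a / ?l) = single m a
          + (\<Sum>\<gamma>\<in>keys f - {single x1 d}. single (\<gamma> + m') (lookup f \<gamma> * (a / ?l)))"
        using lead by (simp add: ring_distribs sum_distrib_right mult_single m)
      then have "single m a = f * single m' (a / ?l)
          + (\<Sum>\<gamma>\<in>keys f - {single x1 d}. single (\<gamma> + m') (- (lookup f \<gamma> * (a / ?l))))"
        by (simp add: single_uminus sum_negf)
      moreover have "ok (\<Sum>\<gamma>\<in>keys f - {single x1 d}. single (\<gamma> + m') (- (lookup f \<gamma> * (a / ?l))))"
      proof (intro ok_sum less.hyps)
        fix \<gamma> assume \<gamma>: "\<gamma> \<in> keys f - {single x1 d}"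
        have "xdeg \<gamma> < d"
        proof (rule ccontr)
          assume "\<not> xdeg \<gamma> < d"
          then have "xdeg \<gamma> = d" "monom_degree (rest \<gamma>) = 0" using keys_f[of \<gamma>] \<gamma> by auto
          then show False using rest_eq_0[of \<gamma>] \<gamma> by simp
        qed
        then show "xdeg (\<gamma> + m') < xdeg m" by (simp add: m xdeg_def lookup_add)
      qed
      ultimately show ?thesis using ok_add[OF ok_mult] by simp
    qed
  qed
  have "ok (\<Sum>m\<in>keys p. single m (lookup p m))" by (intro ok_sum mono)
  then show ?thesis unfolding mpoly_sum_single ok_def by blast
qed

lemma poly_eval_of_rs: "poly_eval (z(x1 := x)) p = poly (poly (rs z p) [:x:]) 1"
  unfolding poly_rs by (intro poly_eval_cong) auto

text \<open>In a plane where \<open>f\<close> is irreducible one of the two remainders modulo \<open>f\<close> vanishes;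
  since these planes are dense, one of the remainders vanishes identically.\<close>

lemma prime_f:
  assumes "f dvd p * q"
  shows "f dvd p \<or> f dvd q"
proof -
  obtain kp rp where p: "p = f * kp + rp" "\<forall>m\<in>keys rp. xdeg m < d" using division by blast
  obtain kq rq where q: "q = f * kq + rq" "\<forall>m\<in>keys rq. xdeg m < d" using division by blast
  have "rp = 0 \<or> rq = 0"
  proof (rule ccontr)
    assume "\<not> (rp = 0 \<or> rq = 0)"
    then obtain a b where a: "poly_eval a rp \<noteq> 0" and b: "poly_eval b rq \<noteq> 0"
      using mpoly_eq_0_iff[of rp] mpoly_eq_0_iff[of rq] by blast
    \<comment> \<open>Freezing the coordinate \<open>x1\<close> turns the nonvanishing of a
      remainder into a condition on the direction \<open>y\<close> of the plane, which can be
      combined with \<open>plane_disc\<close>.\<close>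
    define fx where "fx c r = subst Const (\<lambda>k. if k = x1 then Const c else Var k) r" for c and r :: "'n mpoly"
    have fx: "poly_eval y (fx c r) = poly_eval (y(x1 := c)) r" for y c r
      unfolding fx_def by simp (intro poly_eval_cong, auto)
    have "\<exists>y. poly_eval y plane_disc \<noteq> 0" by (rule exI[of _ "\<lambda>k. if k = x2 then 1 else 0"], rule plane_disc_nonzero)
    moreover have "poly_eval a (fx (a x1) rp) \<noteq> 0" using a by (simp add: fx)
    moreover have "poly_eval b (fx (b x1) rq) \<noteq> 0" using b by (simp add: fx)
    ultimately have nz: "plane_disc \<noteq> 0" "fx (a x1) rp \<noteq> 0" "fx (b x1) rq \<noteq> 0" by auto
    then have "plane_disc * (fx (a x1) rp * fx (b x1) rq) \<noteq> 0" by (simp add: mpoly_mult_eq_0_iff)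
    then obtain y where "poly_eval y (plane_disc * (fx (a x1) rp * fx (b x1) rq)) \<noteq> 0"
      using mpoly_eq_0_iff[of "plane_disc * (fx (a x1) rp * fx (b x1) rq)"] by blast
    then have y: "poly_eval y plane_disc \<noteq> 0" "poly_eval (y(x1 := a x1)) rp \<noteq> 0" "poly_eval (y(x1 := b x1)) rq \<noteq> 0"
      by (auto simp: eval.hom_mult fx)
    have "prime_elem (rs y f)"
      by (rule irreducible_imp_prime_elem[OF irreducible_rs(2)[OF y(1)]])
    moreover have "rs y f dvd rs y p * rs y q"
    proof -
      from assms obtain k where "p * q = f * k" by (elim dvdE)
      then have "rs y p * rs y q = rs y f * rs y k" by (simp only: rs.hom_mult[symmetric])
      then show ?thesis by (rule dvdI)
    qed
    ultimately have "rs y f dvd rs y p \<or> rs y f dvd rs y q"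
      by (simp add: prime_elem_dvd_mult_iff)
    then have "rs y f dvd rs y rp \<or> rs y f dvd rs y rq"
      by (simp add: p(1) q(1) rs.hom_add rs.hom_mult dvd_add_right_iff)
    moreover have "rs y r = 0" if "rs y f dvd rs y r" "\<forall>m\<in>keys r. xdeg m < d" for r
    proof (rule ccontr)
      assume nz: "rs y r \<noteq> 0"
      have "d \<le> degree (rs y r)" using dvd_imp_degree_le[OF that(1) nz] irreducible_rs(1)[OF y(1)] by simp
      then have "coeff (rs y r) (degree (rs y r)) = 0" using that(2) by (intro coeff_rs_eq_0) auto
      then show False using nz by simp
    qed
    ultimately have "rs y rp = 0 \<or> rs y rq = 0" using p(2) q(2) by blast
    then show False using y(2,3) by (auto simp: poly_eval_of_rs)
  qed
  then show ?thesis using p(1) q(1) by auto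
qed

text \<open>On all but finitely many lines parallel to the axis \<open>f\<close> has \<open>d\<close> distinct roots, more than
  the degree of the remainder allows.\<close>

lemma vanishing_imp_dvd:
  assumes "\<And>z. poly_eval z f = 0 \<Longrightarrow> poly_eval z p = 0"
  shows "f dvd p"
proof -
  obtain k r where p: "p = f * k + r" "\<forall>m\<in>keys r. xdeg m < d" using division by blast
  have r: "poly_eval z r = 0" if "poly_eval z f = 0" for z
    using assms[OF that] that by (simp add: p(1) eval.hom_add eval.hom_mult)
  have "r = 0"
  proof (rule ccontr)
    assume "r \<noteq> 0"
    then obtain a where a: "poly_eval a r \<noteq> 0" using mpoly_eq_0_iff[of r] by blast
    \<comment> \<open>\<Delta> at the coefficients of \<open>f\<close> on the parallel to the axis
      through \<open>t a\<close>; at \<open>t = 0\<close> this is the axis itself.\<close>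
    define E where "E = subst (\<lambda>c. [:c:]) (\<lambda>m. coeff (rs a f) (xdeg m)) \<Delta>"
    have E: "poly E t = poly_eval (\<lambda>m. poly (coeff (rs a f) (xdeg m)) t) \<Delta>" for t
    proof -
      have "comm_ring_hom (\<lambda>q. poly q t :: complex)" by unfold_locales auto
      from hom_subst[OF this, of "\<lambda>c. [:c:]" "\<lambda>m. coeff (rs a f) (xdeg m)" \<Delta>] show ?thesis
        unfolding E_def poly_eval_def by simp
    qed
    have "poly E 0 = poly_eval (lookup f) \<Delta>"
      unfolding E
    proof (rule poly_eval_cong)
      fix M m assume "M \<in> keys \<Delta>" "m \<in> keys M"
      then have m: "m \<in> monoms {x1} d" using \<Delta> unfolding detects_singular_def by blast
      have "lookup (rest m) k = 0" for k
      proof (cases "k = x1")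
        case True
        then show ?thesis using rest_no_x1[of m] by (simp add: in_keys_iff)
      next
        case False
        then have "k \<notin> keys m" using m by (auto simp: monoms_def)
        then show ?thesis by (simp add: in_keys_iff rest_def lookup_minus)
      qed
      then have "rest m = 0" by (intro poly_mapping_eqI) simp
      then have "m = single x1 (xdeg m)" using split_rest[of m] by simp
      then show "poly (coeff (rs a f) (xdeg m)) 0 = lookup f m"
        using coeff2_rs_axis[of a f "xdeg m"] by (simp add: coeff2_def poly_0_coeff_0)
    qed
    then have "E \<noteq> 0" using \<Delta>_f by auto
    \<comment> \<open>Where this is nonzero the remainder does not vanish identically on the chosen
      line.\<close>
    define R where "R = poly (rs a r) [:a x1:]"
    have "poly R 1 = poly_eval a r" using poly_eval_of_rs[of a "a x1" r] by (simp add: R_def)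
    then have "R \<noteq> 0" using a by auto
    then have "E * R \<noteq> 0" using \<open>E \<noteq> 0\<close> by simp
    then obtain t where "poly (E * R) t \<noteq> 0" by (metis poly_all_0_iff_0)
    then have t: "poly E t \<noteq> 0" "poly R t \<noteq> 0" by auto
    define F where "F = map_poly (\<lambda>c. poly c t) (rs a f)"
    define Rt where "Rt = map_poly (\<lambda>c. poly c t) (rs a r)"
    have cF: "coeff F i = poly (coeff (rs a f) i) t" for i by (simp add: F_def coeff_map_poly)
    have cR: "coeff Rt i = poly (coeff (rs a r) i) t" for i by (simp add: Rt_def coeff_map_poly)
    have pm: "poly (map_poly (\<lambda>c. poly c t) G) x = poly (poly G [:x:]) t" for G x
      by (induction G) (simp_all add: map_poly_pCons)
    have degF_le: "degree F \<le> d"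
    proof (rule degree_le, intro allI impI)
      fix i assume "d < i"
      then have "coeff2 (rs a f) (i, j) = 0" for j by (intro rs_support) (simp add: tri_def)
      then have "coeff (rs a f) i = 0" by (intro poly_eqI) (simp add: coeff2_def)
      then show "coeff F i = 0" by (simp add: cF)
    qed
    have cFd: "coeff F d \<noteq> 0" using lead by (simp add: cF rs_lead)
    have degF: "degree F = d" using degF_le le_degree[OF cFd] by simp
    have "rsquarefree F"
      unfolding rsquarefree_roots
    proof (intro allI notI, elim conjE)
      fix x assume x: "poly F x = 0" "poly (pderiv F) x = 0"
      let ?c = "\<lambda>m. poly (coeff (rs a f) (xdeg m)) t"
      have "poly_eval ?c \<Delta> = 0"
      proof -
        have "(\<Sum>m\<in>monoms {x1} d. ?c m * mval (\<lambda>_. x) m) = (\<Sum>k\<le>d. coeff F k * x ^ k)"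
          by (simp add: sum_axis_monoms cF)
        then have s0: "(\<Sum>m\<in>monoms {x1} d. ?c m * mval (\<lambda>_. x) m) = 0"
          using x(1) by (simp add: poly_altdef degF)
        obtain d' where d': "d = Suc d'" using d by (cases d) auto
        have "single x1 k - single x1 1 = single x1 (k - 1 :: nat)" for k
          by (rule poly_mapping_eqI) (simp add: lookup_minus lookup_single when_def)
        then have "(\<Sum>m\<in>monoms {x1} d. of_nat (lookup m x1) * ?c m * mval (\<lambda>_. x) (m - single x1 1))
            = (\<Sum>k\<le>d. of_nat k * coeff F k * x ^ (k - 1))"
          by (simp add: sum_axis_monoms cF)
        also have "\<dots> = (\<Sum>k\<le>d'. of_nat (Suc k) * coeff F (Suc k) * x ^ k)"
          unfolding d' by (subst sum.atMost_Suc_shift) simp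
        also have "\<dots> = poly (pderiv F) x"
          unfolding poly_altdef by (simp add: degree_pderiv degF d' coeff_pderiv)
        finally have "(\<Sum>m\<in>monoms {x1} d. of_nat (lookup m x1) * ?c m * mval (\<lambda>_. x) (m - single x1 1)) = 0"
          using x(2) by simp
        then have s1: "\<forall>v\<in>{x1}. (\<Sum>m\<in>monoms {x1} d. of_nat (lookup m v) * ?c m * mval (\<lambda>_. x) (m - single v 1)) = 0"
          by simp
        show ?thesis
          using \<Delta>[unfolded detects_singular_def, THEN conjunct2, THEN conjunct2, rule_format, OF s0] s1
          by blast
      qed
      then show False using t(1) by (simp add: E)
    qed
    from rsquarefree_card_roots[OF this] have card: "card {z. poly F z = 0} = d" by (simp add: degF)
    have sub: "{z. poly F z = 0} \<subseteq> {z. poly Rt z = 0}"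
    proof
      fix z assume "z \<in> {z. poly F z = 0}"
      then have "poly_eval (\<lambda>k. if k = x1 then z else t * a k) f = 0"
        by (simp add: F_def pm poly_rs)
      from r[OF this] show "z \<in> {z. poly Rt z = 0}" by (simp add: Rt_def pm poly_rs)
    qed
    have "poly Rt (a x1) \<noteq> 0" using t(2) by (simp add: Rt_def pm R_def)
    then have "Rt \<noteq> 0" by auto
    have "d \<le> card {z. poly Rt z = 0}"
      using card_mono[OF poly_roots_finite[OF \<open>Rt \<noteq> 0\<close>] sub] card by simp
    then have "d \<le> degree Rt" using card_poly_roots_bound[OF \<open>Rt \<noteq> 0\<close>] by simp
    then have "coeff (rs a r) (degree Rt) = 0" using p(2) by (intro coeff_rs_eq_0) auto
    then have "coeff Rt (degree Rt) = 0" by (simp add: cR)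
    then show False using \<open>Rt \<noteq> 0\<close> by simp
  qed
  then show ?thesis using p(1) by simp
qed

end

section \<open>Ideals\<close>

lemma module_mult: "Modules.module ((*) :: 'a::comm_ring_1 \<Rightarrow> 'a \<Rightarrow> 'a)"
  by unfold_locales (simp_all add: algebra_simps)

lemma ideal_gen_base: "p \<in> S \<Longrightarrow> p \<in> ideal_gen S"
  unfolding ideal_gen_def by (rule module.span_base[OF module_mult])

lemma ideal_gen_0: "0 \<in> ideal_gen S"
  unfolding ideal_gen_def by (rule module.span_zero[OF module_mult])

lemma ideal_gen_mult: "p \<in> ideal_gen S \<Longrightarrow> q * p \<in> ideal_gen S"
  unfolding ideal_gen_def by (rule module.span_scale[OF module_mult])

lemma ideal_gen_singleton: "ideal_gen {f} = {p. f dvd p}"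
  unfolding ideal_gen_def module.span_singleton[OF module_mult]
  by (auto simp: dvd_def mult.commute)

lemma ideal_gen_explicit: "p \<in> ideal_gen S \<Longrightarrow> \<exists>T r. finite T \<and> T \<subseteq> S \<and> p = (\<Sum>a\<in>T. r a * a)"
  unfolding ideal_gen_def module.span_explicit[OF module_mult] by blast

lemma poly_eval_ideal_gen:
  assumes "\<And>p. p \<in> S \<Longrightarrow> poly_eval y p = 0" "p \<in> ideal_gen S"
  shows "poly_eval y p = 0"
proof -
  from ideal_gen_explicit[OF assms(2)] obtain T r where "T \<subseteq> S" "p = (\<Sum>a\<in>T. r a * a)" by blast
  then show ?thesis using assms(1) by (auto simp: eval.hom_sum eval.hom_mult intro!: sum.neutral)
qed

section \<open>Partial derivatives\<close>

lemma partial_deriv_superset: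
  assumes "finite A" "keys p \<subseteq> A"
  shows "partial_deriv v p =
    (\<Sum>m\<in>A. single (m - single v 1) (of_nat (lookup m v) * lookup p m))"
  unfolding partial_deriv_def using assms
  by (intro sum.mono_neutral_left) (auto simp: in_keys_iff)

lemma partial_deriv_single:
  "partial_deriv v (single m a) = single (m - single v 1) (of_nat (lookup m v) * a)"
  by (subst partial_deriv_superset[of "{m}"]) auto

lemma partial_deriv_add: "partial_deriv v (p + q) = partial_deriv v p + partial_deriv v q"
proof -
  let ?A = "keys p \<union> keys q"
  have "keys (p + q) \<subseteq> ?A" by (rule Poly_Mapping.keys_add)
  then show ?thesis
    by (subst (1 2 3) partial_deriv_superset[of ?A])
      (auto simp: lookup_add ring_distribs single_add sum.distrib)
qed

lemma partial_deriv_0: "partial_deriv v 0 = 0"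
  by (simp add: partial_deriv_def)

lemma partial_deriv_sum: "partial_deriv v (sum g A) = (\<Sum>a\<in>A. partial_deriv v (g a))"
  by (induction A rule: infinite_finite_induct) (auto simp: partial_deriv_add partial_deriv_0)

lemma partial_deriv_mult:
  "partial_deriv v (p * q) = partial_deriv v p * q + p * partial_deriv v q"
proof -
  have sh: "(m + m') - single v 1 = (m - single v 1) + m'" if "lookup m v \<noteq> 0" for m m' :: "'a \<Rightarrow>\<^sub>0 nat"
    by (rule poly_mapping_eqI) (use that in \<open>auto simp: lookup_add lookup_minus lookup_single when_def\<close>)
  have 1: "partial_deriv v (single m a * single m' b)
      = partial_deriv v (single m a) * single m' b + single m a * partial_deriv v (single m' b)"
    for m m' :: "'a \<Rightarrow>\<^sub>0 nat" and a b
  proof -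
    \<comment> \<open>Truncated subtraction gives the wrong exponent if \<open>v\<close> does not
      occur in \<open>m\<close>, but then the coefficient is zero.\<close>
    have A: "single ((m + m') - single v 1) (of_nat (lookup m v) * c) = single ((m - single v 1) + m') (of_nat (lookup m v) * c)"
      for c :: complex
    proof (cases "lookup m v = 0")
      case False
      show ?thesis by (simp only: sh[OF False])
    qed simp
    have B: "single ((m + m') - single v 1) (of_nat (lookup m' v) * c) = single (m + (m' - single v 1)) (of_nat (lookup m' v) * c)"
      for c :: complex
    proof (cases "lookup m' v = 0")
      case False
      show ?thesis by (simp only: sh[OF False, of m] add.commute[of m])
    qed simp
    have "partial_deriv v (single m a * single m' b)
        = single ((m + m') - single v 1) (of_nat (lookup m v) * (a * b))
        + single ((m + m') - single v 1) (of_nat (lookup m' v) * (a * b))"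
      by (simp add: mult_single partial_deriv_single lookup_add ring_distribs single_add)
    also have "\<dots> = partial_deriv v (single m a) * single m' b + single m a * partial_deriv v (single m' b)"
      unfolding A B by (simp add: mult_single partial_deriv_single ac_simps)
    finally show ?thesis .
  qed
  let ?s = "\<lambda>p m. single m (lookup p m)"
  have "partial_deriv v (p * q) = partial_deriv v ((\<Sum>m\<in>keys p. ?s p m) * (\<Sum>m\<in>keys q. ?s q m))"
    by (simp only: mpoly_sum_single)
  also have "\<dots> = (\<Sum>m\<in>keys p. \<Sum>m'\<in>keys q. partial_deriv v (?s p m) * ?s q m')
      + (\<Sum>m\<in>keys p. \<Sum>m'\<in>keys q. ?s p m * partial_deriv v (?s q m'))"
    by (simp only: sum_product partial_deriv_sum 1 sum.distrib)
  also have "\<dots> = partial_deriv v (\<Sum>m\<in>keys p. ?s p m) * (\<Sum>m\<in>keys q. ?s q m)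
      + (\<Sum>m\<in>keys p. ?s p m) * partial_deriv v (\<Sum>m\<in>keys q. ?s q m)"
    by (simp only: sum_product partial_deriv_sum)
  finally show ?thesis by (simp only: mpoly_sum_single)
qed

section \<open>Critical points of a smooth hypersurface\<close>

lemma det_mat_2: "det (mat 2 2 a) = a (0, 0) * a (1, 1) - a (0, 1) * a (1, 0)"
  for a :: "nat \<times> nat \<Rightarrow> 'a::comm_ring_1"
proof -
  have A: "mat 2 2 a \<in> carrier_mat 2 2" by simp
  have "det (mat 2 2 a) = (\<Sum>j<2. mat 2 2 a $$ (0, j) * cofactor (mat 2 2 a) 0 j)"
    by (rule laplace_expansion_row[OF A]) simp
  also have "\<dots> = mat 2 2 a $$ (0, 0) * cofactor (mat 2 2 a) 0 0 + mat 2 2 a $$ (0, 1) * cofactor (mat 2 2 a) 0 1"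
    by (simp add: numeral_2_eq_2)
  also have "cofactor (mat 2 2 a) 0 0 = a (1, 1)"
    unfolding cofactor_def by (subst det_single) (auto simp: mat_delete_def)
  also have "cofactor (mat 2 2 a) 0 1 = - a (1, 0)"
    unfolding cofactor_def by (subst det_single) (auto simp: mat_delete_def)
  finally show ?thesis by simp
qed

lemma minors_1:
  fixes A :: "('n \<Rightarrow> 'a::comm_ring_1) list"
  shows "minors 1 A = {(A ! i) k | i k. i < length A}"
proof -
  have d: "det (mat 1 1 (\<lambda>(i, j). (A ! r i) (s j))) = (A ! r 0) (s 0)" for r :: "nat \<Rightarrow> nat" and s :: "nat \<Rightarrow> 'n"
    by (subst det_single) auto
  show ?thesis
  proof (intro subset_antisym subsetI)
    fix q assume "q \<in> minors 1 A"
    then obtain r :: "nat \<Rightarrow> nat" and s :: "nat \<Rightarrow> 'n" where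
      "q = (A ! r 0) (s 0)" "r ` {..<1} \<subseteq> {..<length A}" unfolding minors_def d by blast
    then show "q \<in> {(A ! i) k | i k. i < length A}" by auto
  next
    fix q assume "q \<in> {(A ! i) k | i k. i < length A}"
    then obtain i k where "q = (A ! i) k" "i < length A" by blast
    then show "q \<in> minors 1 A" unfolding minors_def d
      by (intro CollectI exI[of _ "\<lambda>_. i"] exI[of _ "\<lambda>_. k"]) (auto simp: inj_on_def)
  qed
qed

lemma minors_2:
  fixes A :: "('n \<Rightarrow> 'a::comm_ring_1) list"
  shows "minors 2 A = {(A ! i) k * (A ! j) l - (A ! i) l * (A ! j) k | i j k l.
    i \<noteq> j \<and> i < length A \<and> j < length A \<and> k \<noteq> l}"
proof -
  have d: "det (mat 2 2 (\<lambda>(i, j). (A ! r i) (s j)))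
      = (A ! r 0) (s 0) * (A ! r 1) (s 1) - (A ! r 0) (s 1) * (A ! r 1) (s 0)"
    for r :: "nat \<Rightarrow> nat" and s :: "nat \<Rightarrow> 'n"
    by (simp add: det_mat_2)
  have less2: "{..<2::nat} = {0, 1}" by auto
  show ?thesis
  proof (intro subset_antisym subsetI)
    fix q assume "q \<in> minors 2 A"
    then obtain r :: "nat \<Rightarrow> nat" and s :: "nat \<Rightarrow> 'n" where
      q: "q = (A ! r 0) (s 0) * (A ! r 1) (s 1) - (A ! r 0) (s 1) * (A ! r 1) (s 0)" and
      rs: "inj_on r {..<2}" "r ` {..<2} \<subseteq> {..<length A}" "inj_on s {..<2}"
      unfolding minors_def d by blast
    have "r 0 \<noteq> r 1" "s 0 \<noteq> s 1" "r 0 < length A" "r 1 < length A"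
      using rs by (auto simp: less2)
    with q show "q \<in> {(A ! i) k * (A ! j) l - (A ! i) l * (A ! j) k | i j k l.
      i \<noteq> j \<and> i < length A \<and> j < length A \<and> k \<noteq> l}" by blast
  next
    fix q assume "q \<in> {(A ! i) k * (A ! j) l - (A ! i) l * (A ! j) k | i j k l.
      i \<noteq> j \<and> i < length A \<and> j < length A \<and> k \<noteq> l}"
    then obtain i j k l where q: "q = (A ! i) k * (A ! j) l - (A ! i) l * (A ! j) k"
      and ij: "i \<noteq> j" "i < length A" "j < length A" "k \<noteq> l" by blast
    show "q \<in> minors 2 A" unfolding minors_def d
      by (intro CollectI exI[of _ "\<lambda>n. if n = 0 then i else j"] exI[of _ "\<lambda>n. if n = 0 then k else l"])
        (use q ij in \<open>auto simp: inj_on_def less2\<close>)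
  qed
qed

section \<open>Evaluation in the ring of \<open>z\<close>, \<open>w\<close>, \<open>u\<close>,
  \<open>v\<close> and its involution\<close>

lemma poly_eval_embed_z: "poly_eval y (embed_z p) = poly_eval (\<lambda>k. y (Z k)) p"
  by (simp add: embed_z_def)

text \<open>The antiholomorphic involution on points that corresponds to \<open>star\<close> on
  polynomials.\<close>

definition star_pt :: "('n zwuv \<Rightarrow> complex) \<Rightarrow> 'n zwuv \<Rightarrow> complex" where
  "star_pt y s = cnj (y (swap_var s))"

lemma swap_var_swap_var [simp]: "swap_var (swap_var s) = s"
  by (cases s) auto

lemma star_pt_star_pt [simp]: "star_pt (star_pt y) = y"
  by (simp add: star_pt_def fun_eq_iff)

lemma poly_eval_star: "poly_eval y (star p) = cnj (poly_eval (star_pt y) p)"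
proof -
  have "poly_eval y (star p) = subst (\<lambda>a. cnj a) (\<lambda>s. y (swap_var s)) p"
    by (simp add: star_def poly_eval_subst)
  also have "\<dots> = cnj (subst (\<lambda>a. a) (star_pt y) p)"
    using hom_subst[OF comm_ring_hom_cnj, of "\<lambda>a. a" "star_pt y" p]
    by (simp add: star_pt_def)
  finally show ?thesis by (simp add: poly_eval_def)
qed

lemma star_star: "star (star p) = p"
  by (rule mpoly_eqI) (simp add: poly_eval_star)

lemma star_mult: "star (p * q) = star p * star q"
  by (rule mpoly_eqI) (simp add: poly_eval_star eval.hom_mult)

lemma star_0: "star 0 = 0"
  by (rule mpoly_eqI) (simp add: poly_eval_star)

lemma star_image_mult: "p \<in> star ` ideal_gen S \<Longrightarrow> q * p \<in> star ` ideal_gen S"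
proof -
  assume "p \<in> star ` ideal_gen S"
  then obtain p' where "p = star p'" "p' \<in> ideal_gen S" by blast
  then have "q * p = star (star q * p')" "star q * p' \<in> ideal_gen S"
    by (simp_all add: star_mult star_star ideal_gen_mult)
  then show ?thesis by blast
qed

definition zwuv_pt :: "('n \<Rightarrow> complex) \<Rightarrow> ('n \<Rightarrow> complex) \<Rightarrow> ('n + 'n \<Rightarrow> complex) \<Rightarrow> 'n zwuv \<Rightarrow> complex" where
  "zwuv_pt u v x s = (case s of Z k \<Rightarrow> x (Inl k) | W k \<Rightarrow> x (Inr k) | U k \<Rightarrow> u k | V k \<Rightarrow> v k)"

lemma poly_eval_specialize: "poly_eval x (specialize u v p) = poly_eval (zwuv_pt u v x) p"
  unfolding specialize_def by simp (intro poly_eval_cong, auto simp: zwuv_pt_def split: zwuv.splits)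

text \<open>Saturation by \<open>J\<close> can remove zeros only on the zero locus of
  \<open>J\<close>: at \<open>y\<close> the powers of \<open>q0\<close> can be cancelled.\<close>

lemma zero_in_saturation:
  assumes "\<And>p q. p \<in> I \<Longrightarrow> q * p \<in> I" "q0 \<in> J" "poly_eval y q0 \<noteq> 0"
  shows "(\<forall>p\<in>saturation I J. poly_eval y p = 0) \<longleftrightarrow> (\<forall>p\<in>I. poly_eval y p = 0)"
proof
  assume *: "\<forall>p\<in>saturation I J. poly_eval y p = 0"
  show "\<forall>p\<in>I. poly_eval y p = 0"
  proof
    fix p assume p: "p \<in> I"
    have "p * q \<in> I" for q using assms(1)[OF p, of q] by (simp add: mult.commute)
    then have "p \<in> saturation I J" unfolding saturation_def by (intro CollectI exI[of _ 0]) simp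
    then show "poly_eval y p = 0" using * by blast
  qed
next
  assume *: "\<forall>p\<in>I. poly_eval y p = 0"
  have pow: "q0 ^ k \<in> ideal_power J k" for k
  proof (induction k)
    case (Suc k)
    have "q0 * q0 ^ k \<in> {a * b |a b. a \<in> J \<and> b \<in> ideal_power J k}" using Suc assms(2) by blast
    then show ?case by (simp add: ideal_mult_def ideal_gen_base)
  qed simp
  show "\<forall>p\<in>saturation I J. poly_eval y p = 0"
  proof
    fix p assume "p \<in> saturation I J"
    then obtain k where "\<forall>q\<in>ideal_power J k. p * q \<in> I" unfolding saturation_def by blast
    then have "p * q0 ^ k \<in> I" using pow by blast
    then have "poly_eval y (p * q0 ^ k) = 0" using * by blast
    then show "poly_eval y p = 0" using assms(3) by (simp add: eval.hom_mult eval.hom_power)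
  qed
qed

locale smooth_hypersurface =
  fixes X :: "('n::finite \<Rightarrow> complex) set" and f :: "'n mpoly"
  assumes X: "X = zero_locus {f}" and vanishing: "vanishing_ideal X = {p. f dvd p}"
    and smooth: "\<And>z. poly_eval z f = 0 \<Longrightarrow> \<exists>k. poly_eval z (partial_deriv k f) \<noteq> 0"
    and codim: "codimension X = 1"
begin

lemma in_X: "z \<in> X \<longleftrightarrow> poly_eval z f = 0"
  by (simp add: X zero_locus_def)

lemma ideal_generators: "ideal_gen (set (generators X)) = vanishing_ideal X"
  unfolding generators_def
  by (rule someI_ex) (auto simp: vanishing ideal_gen_singleton intro!: exI[of _ "[f]"])

text \<open>The chosen generators may differ from \<open>[f]\<close>, but each is a multiple of
  \<open>f\<close>, so by the product rule its gradient on \<open>X\<close> is a multiple of that of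
  \<open>f\<close>.\<close>

lemma generator_gradient:
  assumes "h \<in> set (generators X)"
  shows "\<exists>a. \<forall>z k. poly_eval z f = 0 \<longrightarrow>
    poly_eval z (partial_deriv k h) = poly_eval z a * poly_eval z (partial_deriv k f)"
proof -
  have "h \<in> vanishing_ideal X" using ideal_generators assms ideal_gen_base by blast
  then obtain a where "h = f * a" by (auto simp: vanishing dvd_def)
  then show ?thesis
    by (intro exI[of _ a]) (simp add: partial_deriv_mult eval.hom_add eval.hom_mult)
qed

text \<open>Conversely \<open>f\<close> is a combination of the generators. As these vanish on
  \<open>X\<close>, the nonzero gradient of \<open>f\<close> is there a combination of their
  gradients.\<close>

lemma exists_generator:
  assumes "poly_eval z f = 0"
  obtains h k where "h \<in> set (generators X)" "poly_eval z (partial_deriv k h) \<noteq> 0"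
proof -
  obtain k where k: "poly_eval z (partial_deriv k f) \<noteq> 0" using smooth[OF assms] by blast
  have "f \<in> ideal_gen (set (generators X))" by (simp add: ideal_generators vanishing)
  from ideal_gen_explicit[OF this] obtain T r where
    T: "T \<subseteq> set (generators X)" "f = (\<Sum>h\<in>T. r h * h)" by blast
  have "\<exists>h\<in>T. poly_eval z (partial_deriv k h) \<noteq> 0"
  proof (rule ccontr)
    assume "\<not> ?thesis"
    then have 0: "poly_eval z (partial_deriv k h) = 0" if "h \<in> T" for h using that by blast
    have "poly_eval z h = 0" if "h \<in> T" for h
    proof -
      have "h \<in> vanishing_ideal X" using that T(1) ideal_generators ideal_gen_base by blast
      then show ?thesis using assms in_X by (simp add: vanishing_ideal_def)
    qed
    then have "poly_eval z (partial_deriv k (r h * h)) = 0" if "h \<in> T" for h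
      using 0 that by (simp add: partial_deriv_mult eval.hom_add eval.hom_mult)
    then have "poly_eval z (partial_deriv k f) = 0"
      by (subst T(2)) (simp add: partial_deriv_sum eval.hom_sum)
    then show False using k by simp
  qed
  then obtain h where "h \<in> T" "poly_eval z (partial_deriv k h) \<noteq> 0" by blast
  with T(1) show ?thesis by (intro that[of h k]) auto
qed

lemma sing_ideal_nonzero:
  assumes "poly_eval z f = 0"
  obtains q where "q \<in> sing_ideal X" "poly_eval z q \<noteq> 0"
proof (rule exists_generator[OF assms])
  fix h k assume h: "h \<in> set (generators X)" and nz: "poly_eval z (partial_deriv k h) \<noteq> 0"
  obtain i where i: "i < length (generators X)" "generators X ! i = h"
    using h by (auto simp: in_set_conv_nth)
  have "partial_deriv k h = (jacobian (generators X) ! i) k" "i < length (jacobian (generators X))"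
    using i by (simp_all add: jacobian_def)
  then have "partial_deriv k h \<in> minors 1 (jacobian (generators X))"
    unfolding minors_1 by blast
  then have "partial_deriv k h \<in> ideal_gen (minors 1 (jacobian (generators X)))" by (rule ideal_gen_base)
  moreover have "0 \<in> vanishing_ideal X" by (simp add: vanishing)
  ultimately have "0 + partial_deriv k h \<in> sing_ideal X"
    unfolding sing_ideal_def codim by (rule set_plus_intro[rotated])
  then show ?thesis using nz that by simp
qed

text \<open>At a point of \<open>X\<close> the rows of the Jacobian span exactly the line of the
  gradient of \<open>f\<close>, so the \<open>2\<close>-minors vanish iff the additional row lies on
  that line.\<close>

lemma crit_ideal_zero_iff:
  assumes z: "poly_eval (\<lambda>k. y (Z k)) f = 0"
  shows "(\<forall>p\<in>crit_ideal X. poly_eval y p = 0) \<longleftrightarrow>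
    (\<exists>\<mu>. \<forall>k. y (V k) - y (W k) = \<mu> * poly_eval (\<lambda>k. y (Z k)) (partial_deriv k f))"
proof -
  let ?z = "\<lambda>k. y (Z k)"
  let ?rows = "map (\<lambda>row k. embed_z (row k)) (jacobian (generators X))"
  let ?A = "(\<lambda>k. Var (V k) - Var (W k)) # ?rows"
  have row: "\<exists>c. \<forall>k. poly_eval y ((?rows ! i) k) = c * poly_eval ?z (partial_deriv k f)"
    if "i < length ?rows" for i
  proof -
    have i: "i < length (generators X)" using that by (simp add: jacobian_def)
    obtain a where a: "\<forall>z k. poly_eval z f = 0 \<longrightarrow>
        poly_eval z (partial_deriv k (generators X ! i)) = poly_eval z a * poly_eval z (partial_deriv k f)"
      using generator_gradient[OF nth_mem[OF i]] by (elim exE)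
    then show ?thesis
      using z i by (intro exI[of _ "poly_eval ?z a"]) (simp add: jacobian_def poly_eval_embed_z)
  qed
  have crit: "crit_ideal X = ideal_gen (minors 2 ?A)"
    unfolding crit_ideal_def codim one_add_one ..
  show ?thesis
  proof
    assume *: "\<forall>p\<in>crit_ideal X. poly_eval y p = 0"
    have minor0: "poly_eval y p = 0" if "p \<in> minors 2 ?A" for p
      using * ideal_gen_base[OF that] unfolding crit by blast
    show "\<exists>\<mu>. \<forall>k. y (V k) - y (W k) = \<mu> * poly_eval ?z (partial_deriv k f)"
    proof (rule exists_generator[OF z])
      fix h k0 assume h: "h \<in> set (generators X)" and nz: "poly_eval ?z (partial_deriv k0 h) \<noteq> 0"
      obtain i where i: "i < length (generators X)" "generators X ! i = h"
        using h by (auto simp: in_set_conv_nth)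
      have Ai: "?A ! Suc i = (\<lambda>k. embed_z (partial_deriv k h))" "Suc i < length ?A"
        using i by (simp_all add: jacobian_def)
      have eq: "(y (V k) - y (W k)) * poly_eval ?z (partial_deriv k0 h)
          = (y (V k0) - y (W k0)) * poly_eval ?z (partial_deriv k h)" for k
      proof (cases "k = k0")
        case False
        have "(?A ! 0) k * (?A ! Suc i) k0 - (?A ! 0) k0 * (?A ! Suc i) k \<in> minors 2 ?A"
          unfolding minors_2 using Ai(2) False by blast
        from minor0[OF this] show ?thesis
          unfolding Ai(1) by (simp add: eval.hom_minus eval.hom_mult poly_eval_embed_z)
      qed simp
      obtain a where "\<forall>z k. poly_eval z f = 0 \<longrightarrow>
          poly_eval z (partial_deriv k h) = poly_eval z a * poly_eval z (partial_deriv k f)"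
        using generator_gradient[OF h] by (elim exE)
      with z have a: "poly_eval ?z (partial_deriv k h) = poly_eval ?z a * poly_eval ?z (partial_deriv k f)" for k
        by simp
      \<comment> \<open>The additional row is a multiple of the gradient of \<open>h\<close>, which
        in turn is \<open>a\<close> times that of \<open>f\<close>.\<close>
      let ?\<mu> = "(y (V k0) - y (W k0)) / poly_eval ?z (partial_deriv k0 h) * poly_eval ?z a"
      have "y (V k) - y (W k) = ?\<mu> * poly_eval ?z (partial_deriv k f)" for k
        using eq[of k] nz a[of k] by (simp add: field_simps)
      then show ?thesis by blast
    qed
  next
    assume "\<exists>\<mu>. \<forall>k. y (V k) - y (W k) = \<mu> * poly_eval ?z (partial_deriv k f)"
    then obtain \<mu> where \<mu>: "\<And>k. y (V k) - y (W k) = \<mu> * poly_eval ?z (partial_deriv k f)" by blast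
    have rowA: "\<exists>c. \<forall>k. poly_eval y ((?A ! i) k) = c * poly_eval ?z (partial_deriv k f)"
      if "i < length ?A" for i
    proof (cases i)
      case 0
      then show ?thesis using \<mu> by (intro exI[of _ \<mu>]) (simp add: eval.hom_minus)
    next
      case (Suc i')
      then show ?thesis using row[of i'] that by simp
    qed
    have "poly_eval y p = 0" if p: "p \<in> minors 2 ?A" for p
    proof -
      from p obtain i j k l where q: "p = (?A ! i) k * (?A ! j) l - (?A ! i) l * (?A ! j) k"
        and ij: "i < length ?A" "j < length ?A" unfolding minors_2 by blast
      obtain c where c: "\<And>k. poly_eval y ((?A ! i) k) = c * poly_eval ?z (partial_deriv k f)"
        using rowA[OF ij(1)] by blast
      obtain c' where c': "\<And>k. poly_eval y ((?A ! j) k) = c' * poly_eval ?z (partial_deriv k f)"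
        using rowA[OF ij(2)] by blast
      show ?thesis unfolding q eval.hom_minus eval.hom_mult c c' by (simp add: algebra_simps)
    qed
    then have "poly_eval y p = 0" if "p \<in> ideal_gen (minors 2 ?A)" for p
      using that by (rule poly_eval_ideal_gen)
    then show "\<forall>p\<in>crit_ideal X. poly_eval y p = 0" unfolding crit by (rule ballI)
  qed
qed

lemma extend_z_zero_iff:
  "(\<forall>p\<in>extend_z (vanishing_ideal X). poly_eval y p = 0) \<longleftrightarrow> poly_eval (\<lambda>k. y (Z k)) f = 0"
proof
  assume *: "\<forall>p\<in>extend_z (vanishing_ideal X). poly_eval y p = 0"
  have "embed_z f \<in> extend_z (vanishing_ideal X)"
    unfolding extend_z_def by (intro ideal_gen_base imageI) (simp add: vanishing)
  with * have "poly_eval y (embed_z f) = 0" by blast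
  then show "poly_eval (\<lambda>k. y (Z k)) f = 0" by (simp only: poly_eval_embed_z)
next
  assume z: "poly_eval (\<lambda>k. y (Z k)) f = 0"
  have "poly_eval y q = 0" if "q \<in> embed_z ` vanishing_ideal X" for q
    using that z in_X by (auto simp: poly_eval_embed_z vanishing_ideal_def)
  then show "\<forall>p\<in>extend_z (vanishing_ideal X). poly_eval y p = 0"
    unfolding extend_z_def using poly_eval_ideal_gen by blast
qed

text \<open>Since \<open>X\<close> is smooth, the saturation does not change the zeros.\<close>

lemma hermitian_zero_iff:
  "(\<forall>p\<in>hermitian_critical_ideal X. poly_eval y p = 0) \<longleftrightarrow>
    poly_eval (\<lambda>k. y (Z k)) f = 0 \<and> poly_eval (\<lambda>k. cnj (y (W k))) f = 0 \<and>
    (\<exists>\<mu>. \<forall>k. y (V k) - y (W k) = \<mu> * poly_eval (\<lambda>k. y (Z k)) (partial_deriv k f)) \<and>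
    (\<exists>\<mu>. \<forall>k. cnj (y (U k)) - cnj (y (Z k)) = \<mu> * poly_eval (\<lambda>k. cnj (y (W k))) (partial_deriv k f))"
  (is "?L \<longleftrightarrow> ?zX \<and> ?wX \<and> ?C1 \<and> ?C2")
proof -
  let ?E = "extend_z (vanishing_ideal X)" and ?K = "crit_ideal X"
  let ?I = "?E + star ` ?E + ?K + star ` ?K"
  have E0: "0 \<in> ?E" and K0: "0 \<in> ?K" by (simp_all add: extend_z_def crit_ideal_def ideal_gen_0)
  then have sE0: "0 \<in> star ` ?E" and sK0: "0 \<in> star ` ?K" using star_0 by (metis image_eqI)+
  have star_zero: "(\<forall>p\<in>star ` J. poly_eval y p = 0) \<longleftrightarrow> (\<forall>p\<in>J. poly_eval (star_pt y) p = 0)" for J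
    by (simp add: poly_eval_star)
  have I_iff: "(\<forall>p\<in>?I. poly_eval y p = 0) \<longleftrightarrow> (\<forall>p\<in>?E. poly_eval y p = 0) \<and>
    (\<forall>p\<in>?E. poly_eval (star_pt y) p = 0) \<and> (\<forall>p\<in>?K. poly_eval y p = 0) \<and> (\<forall>p\<in>?K. poly_eval (star_pt y) p = 0)"
    unfolding star_zero[symmetric]
  proof (intro iffI conjI ballI)
    assume *: "\<forall>p\<in>?I. poly_eval y p = 0"
    show "poly_eval y p = 0" if "p \<in> ?E" for p
      using *[rule_format, OF set_plus_intro[OF set_plus_intro[OF set_plus_intro[OF that sE0] K0] sK0]] by simp
    show "poly_eval y p = 0" if "p \<in> star ` ?E" for p
      using *[rule_format, OF set_plus_intro[OF set_plus_intro[OF set_plus_intro[OF E0 that] K0] sK0]] by simp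
    show "poly_eval y p = 0" if "p \<in> ?K" for p
      using *[rule_format, OF set_plus_intro[OF set_plus_intro[OF set_plus_intro[OF E0 sE0] that] sK0]] by simp
    show "poly_eval y p = 0" if "p \<in> star ` ?K" for p
      using *[rule_format, OF set_plus_intro[OF set_plus_intro[OF set_plus_intro[OF E0 sE0] K0] that]] by simp
  next
    fix p assume *: "(\<forall>p\<in>?E. poly_eval y p = 0) \<and> (\<forall>p\<in>star ` ?E. poly_eval y p = 0) \<and>
      (\<forall>p\<in>?K. poly_eval y p = 0) \<and> (\<forall>p\<in>star ` ?K. poly_eval y p = 0)" and "p \<in> ?I"
    then obtain a b c e where "p = a + b + c + e" "a \<in> ?E" "b \<in> star ` ?E" "c \<in> ?K" "e \<in> star ` ?K"
      by (elim set_plus_elim) blast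
    moreover from this have "poly_eval y a = 0" "poly_eval y b = 0" "poly_eval y c = 0" "poly_eval y e = 0"
      using * by blast+
    ultimately show "poly_eval y p = 0" by (simp add: eval.hom_add)
  qed
  have pts: "(\<lambda>k. star_pt y (Z k)) = (\<lambda>k. cnj (y (W k)))" by (simp add: star_pt_def)
  have I_iff': "(\<forall>p\<in>?I. poly_eval y p = 0) \<longleftrightarrow> ?zX \<and> ?wX \<and> ?C1 \<and> ?C2"
  proof (cases "?zX \<and> ?wX")
    case True
    then show ?thesis
      using crit_ideal_zero_iff[of y] crit_ideal_zero_iff[of "star_pt y"]
      unfolding I_iff extend_z_zero_iff pts by (simp add: star_pt_def)
  next
    case False
    then show ?thesis unfolding I_iff extend_z_zero_iff pts by blast
  qed
  have I_ideal: "q * p \<in> ?I" if "p \<in> ?I" for p q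
  proof -
    from that obtain a b c e where p: "p = a + b + c + e" "a \<in> ?E" "b \<in> star ` ?E" "c \<in> ?K" "e \<in> star ` ?K"
      by (elim set_plus_elim) blast
    have "q * a + q * b + q * c + q * e \<in> ?I"
      using p(2-5) unfolding extend_z_def crit_ideal_def
      by (intro set_plus_intro ideal_gen_mult star_image_mult)
    then show ?thesis by (simp add: p(1) ring_distribs)
  qed
  let ?J = "ideal_mult (extend_z (sing_ideal X)) (star ` extend_z (sing_ideal X))"
  show ?thesis
  proof (cases "?zX \<and> ?wX")
    case True
    obtain q1 where q1: "q1 \<in> sing_ideal X" "poly_eval (\<lambda>k. y (Z k)) q1 \<noteq> 0"
      by (rule sing_ideal_nonzero[OF conjunct1[OF True]])
    obtain q2 where q2: "q2 \<in> sing_ideal X" "poly_eval (\<lambda>k. cnj (y (W k))) q2 \<noteq> 0"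
      by (rule sing_ideal_nonzero[OF conjunct2[OF True]])
    have "embed_z q \<in> extend_z (sing_ideal X)" if "q \<in> sing_ideal X" for q
      unfolding extend_z_def using that by (intro ideal_gen_base imageI)
    then have "embed_z q1 * star (embed_z q2) \<in> ?J"
      unfolding ideal_mult_def using q1(1) q2(1) by (intro ideal_gen_base) blast
    moreover have "poly_eval y (embed_z q1 * star (embed_z q2)) \<noteq> 0"
      using q1(2) q2(2) by (simp add: eval.hom_mult poly_eval_star poly_eval_embed_z pts)
    ultimately have "?L \<longleftrightarrow> (\<forall>p\<in>?I. poly_eval y p = 0)"
      unfolding hermitian_critical_ideal_def by (intro zero_in_saturation I_ideal)
    then show ?thesis unfolding I_iff' .
  next
    case False
    \<comment> \<open>The unsaturated ideal lies in the saturation and already contains both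
      equations of the variety, so here neither side can hold.\<close>
    have "?I \<subseteq> hermitian_critical_ideal X"
    proof
      fix p assume p: "p \<in> ?I"
      have "p * q \<in> ?I" for q using I_ideal[OF p, of q] by (simp add: mult.commute)
      then show "p \<in> hermitian_critical_ideal X"
        unfolding hermitian_critical_ideal_def saturation_def by (intro CollectI exI[of _ 0]) simp
    qed
    then have "?L \<Longrightarrow> \<forall>p\<in>?I. poly_eval y p = 0" by blast
    then show ?thesis using False I_iff' by blast
  qed
qed

lemma critical_points_iff:
  "x \<in> critical_points X u v \<longleftrightarrow>
    poly_eval (\<lambda>k. x (Inl k)) f = 0 \<and> poly_eval (\<lambda>k. cnj (x (Inr k))) f = 0 \<and>
    (\<exists>\<mu>. \<forall>k. v k - x (Inr k) = \<mu> * poly_eval (\<lambda>k. x (Inl k)) (partial_deriv k f)) \<and>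
    (\<exists>\<mu>. \<forall>k. cnj (u k) - cnj (x (Inl k)) = \<mu> * poly_eval (\<lambda>k. cnj (x (Inr k))) (partial_deriv k f))"
proof -
  have "x \<in> critical_points X u v \<longleftrightarrow> (\<forall>p\<in>hermitian_critical_ideal X. poly_eval (zwuv_pt u v x) p = 0)"
    by (simp add: critical_points_def zero_locus_def poly_eval_specialize)
  then show ?thesis by (simp only: hermitian_zero_iff) (simp add: zwuv_pt_def)
qed

end

section \<open>Irreducible hypersurfaces have codimension one\<close>

lemma irreducible_variety_UNIV: "irreducible_variety (UNIV :: ('v \<Rightarrow> complex) set)"
  unfolding irreducible_variety_def
proof (intro conjI allI impI)
  show "algebraic_set (UNIV :: ('v \<Rightarrow> complex) set)"
    unfolding algebraic_set_def by (intro exI[of _ "{}"]) (simp add: zero_locus_def)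
  fix Y Y' :: "('v \<Rightarrow> complex) set"
  assume *: "algebraic_set Y \<and> algebraic_set Y' \<and> UNIV = Y \<union> Y'"
  then obtain P P' where P: "Y = zero_locus P" "Y' = zero_locus P'" unfolding algebraic_set_def by blast
  show "Y = UNIV \<or> Y' = UNIV"
  proof (rule ccontr)
    assume "\<not> (Y = UNIV \<or> Y' = UNIV)"
    then obtain y y' where "y \<notin> Y" "y' \<notin> Y'" by blast
    then obtain p p' where p: "p \<in> P" "poly_eval y p \<noteq> 0" "p' \<in> P'" "poly_eval y' p' \<noteq> 0"
      unfolding P zero_locus_def by blast
    then have "p \<noteq> 0" "p' \<noteq> 0" by auto
    then have "p * p' \<noteq> 0" by (simp add: mpoly_mult_eq_0_iff)
    then obtain x where "poly_eval x (p * p') \<noteq> 0" using mpoly_eq_0_iff[of "p * p'"] by blast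
    then have "x \<notin> Y \<union> Y'" using p unfolding P zero_locus_def by (auto simp: eval.hom_mult)
    then show False using * by blast
  qed
qed simp

lemma irreducible_variety_prime:
  assumes "irreducible_variety Y" "\<And>y. y \<in> Y \<Longrightarrow> poly_eval y (p * q) = 0"
  shows "(\<forall>y\<in>Y. poly_eval y p = 0) \<or> (\<forall>y\<in>Y. poly_eval y q = 0)"
proof -
  from assms(1) obtain P where P: "Y = zero_locus P"
    unfolding irreducible_variety_def algebraic_set_def by blast
  have "Y = zero_locus (P \<union> {p}) \<union> zero_locus (P \<union> {q})"
    using assms(2) unfolding P zero_locus_def by (auto simp: eval.hom_mult)
  then have "zero_locus (P \<union> {p}) = Y \<or> zero_locus (P \<union> {q}) = Y"
    using assms(1) unfolding irreducible_variety_def algebraic_set_def by blast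
  then show ?thesis unfolding zero_locus_def by auto
qed

text \<open>\<open>vanishing\<close> is the Nullstellensatz for \<open>f\<close>. Both instances
  have an elementary proof: for generic \<open>f\<close> by counting roots on lines, for a point in
  dimension one by the factor theorem.\<close>

locale prime_hypersurface =
  fixes X :: "('n::finite \<Rightarrow> complex) set" and f :: "'n mpoly"
  assumes X: "X = zero_locus {f}" and vanishing: "\<And>p. (\<And>z. z \<in> X \<Longrightarrow> poly_eval z p = 0) \<Longrightarrow> f dvd p"
    and prime: "\<And>p q. f dvd p * q \<Longrightarrow> f dvd p \<or> f dvd q"
    and nonempty: "X \<noteq> {}" and nonzero: "f \<noteq> 0"
begin

lemma X_iff: "z \<in> X \<longleftrightarrow> poly_eval z f = 0"
  by (simp add: X zero_locus_def)

lemma vanishing_ideal_eq: "vanishing_ideal X = {p. f dvd p}"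
proof (intro subset_antisym subsetI)
  show "p \<in> {p. f dvd p}" if "p \<in> vanishing_ideal X" for p
    using that vanishing by (simp add: vanishing_ideal_def)
  show "p \<in> vanishing_ideal X" if "p \<in> {p. f dvd p}" for p
    using that by (auto simp: vanishing_ideal_def dvd_def eval.hom_mult X_iff)
qed

lemma irreducible: "irreducible_variety X"
  unfolding irreducible_variety_def
proof (intro conjI allI impI)
  show "algebraic_set X" unfolding algebraic_set_def X by blast
  show "X \<noteq> {}" by (rule nonempty)
  fix Y Y' :: "('n \<Rightarrow> complex) set"
  assume *: "algebraic_set Y \<and> algebraic_set Y' \<and> X = Y \<union> Y'"
  then obtain P P' where P: "Y = zero_locus P" "Y' = zero_locus P'" unfolding algebraic_set_def by blast
  show "Y = X \<or> Y' = X"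
  proof (rule ccontr)
    assume "\<not> (Y = X \<or> Y' = X)"
    then obtain y y' where y: "y \<in> X" "y' \<in> X" "y \<notin> Y" "y' \<notin> Y'" using * by blast
    then obtain p p' where p: "p \<in> P" "poly_eval y p \<noteq> 0" "p' \<in> P'" "poly_eval y' p' \<noteq> 0"
      unfolding P zero_locus_def by blast
    have "poly_eval z (p * p') = 0" if "z \<in> X" for z
    proof -
      have "z \<in> Y \<or> z \<in> Y'" using * that by blast
      then show ?thesis using p(1,3) unfolding P zero_locus_def by (auto simp: eval.hom_mult)
    qed
    then have "f dvd p \<or> f dvd p'" by (intro prime vanishing)
    then have "p \<in> vanishing_ideal X \<or> p' \<in> vanishing_ideal X" by (simp add: vanishing_ideal_eq)
    then show False using p y by (auto simp: vanishing_ideal_def)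
  qed
qed

lemma components: "irreducible_components X = {X}"
  unfolding irreducible_components_def using irreducible by blast

text \<open>An equation of \<open>Y\<close> can be divided by \<open>f\<close> for ever, but its degree along a line
  meeting \<open>X\<close> drops each time.\<close>

lemma larger_is_UNIV:
  assumes "irreducible_variety Y" "X \<subset> Y"
  shows "Y = UNIV"
proof (rule ccontr)
  assume "Y \<noteq> UNIV"
  obtain P where P: "Y = zero_locus P"
    using assms(1) unfolding irreducible_variety_def algebraic_set_def by blast
  from \<open>Y \<noteq> UNIV\<close> obtain b where "b \<notin> Y" by blast
  then obtain g0 where g0: "g0 \<in> P" "poly_eval b g0 \<noteq> 0" unfolding P zero_locus_def by blast
  obtain a where a: "a \<in> X" using nonempty by blast
  define L where "L = line_poly a (\<lambda>v. b v - a v)"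
  define S where "S = {g. (\<forall>y\<in>Y. poly_eval y g = 0) \<and> L g \<noteq> 0}"
  have "poly (L g0) 1 \<noteq> 0" using g0(2) by (simp add: L_def)
  then have "L g0 \<noteq> 0" by auto
  then have "g0 \<in> S" using g0(1) unfolding S_def P zero_locus_def by auto
  from ex_has_least_nat[of "\<lambda>g. g \<in> S", OF this, of "\<lambda>g. degree (L g)"]
  obtain g where g: "g \<in> S" "\<And>h. h \<in> S \<Longrightarrow> degree (L g) \<le> degree (L h)" by blast
  have "f dvd g" using g(1) assms(2) by (intro vanishing) (auto simp: S_def)
  then obtain h where h: "g = f * h" by (elim dvdE)
  have "(\<forall>y\<in>Y. poly_eval y f = 0) \<or> (\<forall>y\<in>Y. poly_eval y h = 0)"
    using g(1) by (intro irreducible_variety_prime[OF assms(1)]) (simp add: S_def h)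
  moreover have "\<not> (\<forall>y\<in>Y. poly_eval y f = 0)" using assms(2) X_iff by blast
  ultimately have "\<forall>y\<in>Y. poly_eval y h = 0" by blast
  have Lg: "L g = L f * L h" by (simp add: h L_def line.hom_mult)
  then have nz: "L f \<noteq> 0" "L h \<noteq> 0" using g(1) by (auto simp: S_def)
  then have "h \<in> S" using \<open>\<forall>y\<in>Y. poly_eval y h = 0\<close> by (simp add: S_def)
  have "poly (L f) 0 = 0" using a by (simp add: L_def X_iff)
  have "degree (L f) \<noteq> 0"
  proof
    assume "degree (L f) = 0"
    then obtain c where "L f = [:c:]" using degree_eq_zeroE by blast
    then show False using \<open>poly (L f) 0 = 0\<close> nz(1) by simp
  qed
  then have "degree (L h) < degree (L g)" using nz by (simp add: Lg degree_mult_eq)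
  then show False using g(2)[OF \<open>h \<in> S\<close>] by simp
qed

text \<open>A chain starting at \<open>X\<close> can only continue with the whole space, and this
  step is strict because \<open>f\<close> is nonzero.\<close>

lemma codimension_eq_1: "codimension X = 1"
  unfolding codimension_def
proof (rule cSup_eq_maximum)
  have "X \<noteq> UNIV" using nonzero mpoly_eq_0_iff[of f] X_iff by blast
  then show "1 \<in> {k. \<exists>Y. Y 0 = X \<and> (\<forall>i\<le>k. irreducible_variety (Y i)) \<and> (\<forall>i<k. Y i \<subset> Y (Suc i))}"
    by (intro CollectI exI[of _ "\<lambda>i::nat. if i = 0 then X else UNIV"])
      (auto simp: irreducible irreducible_variety_UNIV)
  fix k assume "k \<in> {k. \<exists>Y. Y 0 = X \<and> (\<forall>i\<le>k. irreducible_variety (Y i)) \<and> (\<forall>i<k. Y i \<subset> Y (Suc i))}"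
  then obtain Y where Y: "Y 0 = X" "\<forall>i\<le>k. irreducible_variety (Y i)" "\<forall>i<k. Y i \<subset> Y (Suc i)" by blast
  show "k \<le> 1"
  proof (rule ccontr)
    assume "\<not> k \<le> 1"
    then have k: "0 < k" "1 < k" "1 \<le> k" by simp_all
    have Y1: "Y 0 \<subset> Y (Suc 0)" using Y(3) k(1) by blast
    have Y2: "Y 1 \<subset> Y (Suc 1)" using Y(3) k(2) by blast
    have I1: "irreducible_variety (Y 1)" using Y(2) k(3) by blast
    have "Y 1 = UNIV" using I1 Y1 by (intro larger_is_UNIV) (simp_all add: Y(1))
    then show False using Y2 by blast
  qed
qed

lemma smooth_hypersurfaceI:
  assumes "\<And>z. poly_eval z f = 0 \<Longrightarrow> \<exists>k. poly_eval z (partial_deriv k f) \<noteq> 0"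
  shows "smooth_hypersurface X f"
  by unfold_locales (use X vanishing_ideal_eq codimension_eq_1 assms in auto)

end

section \<open>The virtual degree\<close>

lemma zariski_dense_complement:
  fixes c :: "'v mpoly"
  assumes "c \<noteq> 0"
  shows "zariski_dense_in UNIV (UNIV - zero_locus {c})"
  unfolding zariski_dense_in_def
proof (intro conjI allI impI)
  fix S :: "('v \<Rightarrow> complex) set" assume "zariski_open_in UNIV S \<and> S \<noteq> {}"
  then obtain P x where "S = UNIV - zero_locus P" "x \<in> S" unfolding zariski_open_in_def by blast
  then obtain p where p: "p \<in> P" "poly_eval x p \<noteq> 0" "S = UNIV - zero_locus P"
    unfolding zero_locus_def by blast
  have "p \<noteq> 0" using p by auto
  then have "c * p \<noteq> 0" using assms by (simp add: mpoly_mult_eq_0_iff)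
  then obtain y where "poly_eval y (c * p) \<noteq> 0" using mpoly_eq_0_iff[of "c * p"] by blast
  then have "y \<in> (UNIV - zero_locus {c}) \<inter> S"
    using p(1) unfolding p(3) zero_locus_def by (auto simp: eval.hom_mult)
  then show "(UNIV - zero_locus {c}) \<inter> S \<noteq> {}" by blast
qed simp

text \<open>Any competing set is dense and therefore meets the complement of the zeros of
  \<open>c\<close>, so the two cardinalities agree.\<close>

lemma vHDdeg_irreducible_eqI:
  fixes X :: "('n::finite \<Rightarrow> complex) set"
  assumes "c \<noteq> 0" "\<And>u v. poly_eval (case_sum u v) c \<noteq> 0 \<Longrightarrow>
    finite (critical_points X u v) \<and> card (critical_points X u v) = m"
  shows "vHDdeg_irreducible X = m"
  unfolding vHDdeg_irreducible_def
proof (rule the_equality)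
  let ?\<Omega> = "UNIV - zero_locus {c}"
  have op: "zariski_open_in UNIV ?\<Omega>" unfolding zariski_open_in_def by blast
  show "\<exists>\<Omega>. zariski_open_in UNIV \<Omega> \<and> zariski_dense_in UNIV \<Omega> \<and>
        (\<forall>u v. case_sum u v \<in> \<Omega> \<longrightarrow>
           finite (critical_points X u v) \<and> card (critical_points X u v) = m)"
  proof (intro exI[of _ ?\<Omega>] conjI allI impI)
    fix u v assume "case_sum u v \<in> ?\<Omega>"
    then have "poly_eval (case_sum u v) c \<noteq> 0" by (simp add: zero_locus_def)
    from assms(2)[OF this]
    show "finite (critical_points X u v)" "card (critical_points X u v) = m" by simp_all
  qed (fact op, rule zariski_dense_complement[OF assms(1)])
  fix m' assume "\<exists>\<Omega>. zariski_open_in UNIV \<Omega> \<and> zariski_dense_in UNIV \<Omega> \<and>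
        (\<forall>u v. case_sum u v \<in> \<Omega> \<longrightarrow>
           finite (critical_points X u v) \<and> card (critical_points X u v) = m')"
  then obtain \<Omega> where \<Omega>: "zariski_dense_in UNIV \<Omega>"
    "\<And>u v. case_sum u v \<in> \<Omega> \<Longrightarrow> card (critical_points X u v) = m'" by blast
  obtain y0 where "poly_eval y0 c \<noteq> 0" using assms(1) mpoly_eq_0_iff[of c] by blast
  then have "y0 \<in> ?\<Omega>" by (simp add: zero_locus_def)
  then have "\<Omega> \<inter> ?\<Omega> \<noteq> {}" using \<Omega>(1) op unfolding zariski_dense_in_def by blast
  then obtain y where y: "y \<in> \<Omega>" "poly_eval y c \<noteq> 0" by (auto simp: zero_locus_def)
  have "case_sum (\<lambda>k. y (Inl k)) (\<lambda>k. y (Inr k)) = y" by (auto simp: fun_eq_iff split: sum.splits)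
  then show "m' = m" using \<Omega>(2)[of "\<lambda>k. y (Inl k)" "\<lambda>k. y (Inr k)"]
      assms(2)[of "\<lambda>k. y (Inl k)" "\<lambda>k. y (Inr k)"] y by simp
qed

text \<open>Trades the unknown multiplier for polynomial equations, so that only \<open>z\<close>
  and \<open>w\<close> remain unknown when critical points are counted as points of a fibre.\<close>

lemma proportional_iff:
  fixes a b :: "'n \<Rightarrow> complex"
  assumes "\<exists>k. b k \<noteq> 0"
  shows "(\<exists>\<mu>. \<forall>k. a k = \<mu> * b k) \<longleftrightarrow> (\<forall>i j. a i * b j = a j * b i)"
proof
  assume *: "\<forall>i j. a i * b j = a j * b i"
  obtain k0 where k0: "b k0 \<noteq> 0" using assms ..
  have "a k = a k0 / b k0 * b k" for k using *[rule_format, of k k0] k0 by (simp add: field_simps)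
  then show "\<exists>\<mu>. \<forall>k. a k = \<mu> * b k" by blast
qed (auto simp: ac_simps)

lemma at_least_inj:
  assumes "at_least m S" "inj_on \<phi> S" "\<phi> ` S \<subseteq> T"
  shows "at_least m T"
proof -
  from assms(1) obtain g where g: "inj_on g {..<m}" "g ` {..<m} \<subseteq> S" unfolding at_least_def by blast
  have "inj_on (\<lambda>i. \<phi> (g i)) {..<m}"
    using comp_inj_on[OF g(1) inj_on_subset[OF assms(2) g(2)]] by (simp add: comp_def)
  moreover have "(\<lambda>i. \<phi> (g i)) ` {..<m} \<subseteq> T" using g(2) assms(3) by blast
  ultimately show ?thesis unfolding at_least_def by blast
qed

definition conj_poly :: "'v mpoly \<Rightarrow> 'v mpoly" where
  "conj_poly p = (\<Sum>m\<in>keys p. single m (cnj (lookup p m)))"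

lemma lookup_conj_poly: "lookup (conj_poly p) m = cnj (lookup p m)"
  by (simp add: conj_poly_def lookup_sum lookup_single when_def sum.delta in_keys_iff)

lemma keys_conj_poly: "keys (conj_poly p) = keys p"
  by (auto simp: in_keys_iff lookup_conj_poly)

lemma cnj_mval: "cnj (mval y m) = mval (\<lambda>k. cnj (y k)) m"
  by (rule hom_mval[OF comm_ring_hom_cnj])

lemma poly_eval_conj_poly: "poly_eval y (conj_poly p) = cnj (poly_eval (\<lambda>k. cnj (y k)) p)"
  by (simp add: poly_eval_alt keys_conj_poly lookup_conj_poly cnj_mval)

lemma poly_eval_partial_deriv_conj_poly:
  "poly_eval y (partial_deriv k (conj_poly p)) = cnj (poly_eval (\<lambda>k. cnj (y k)) (partial_deriv k p))"
  by (simp add: poly_eval_partial_deriv[of "keys p"] keys_conj_poly lookup_conj_poly cnj_mval)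

context smooth_hypersurface
begin

abbreviation "uv k \<equiv> Var (Inl k) :: (('n + 'n) + ('n + 'n)) mpoly"
abbreviation "zw k \<equiv> Var (Inr k) :: (('n + 'n) + ('n + 'n)) mpoly"
abbreviation "in_z p \<equiv> subst Const (\<lambda>k. zw (Inl k)) p"
abbreviation "in_w p \<equiv> subst Const (\<lambda>k. zw (Inr k)) p"

text \<open>A finite system with the same zeros as the saturated ideal, as quantifier elimination
  requires. The outer \<open>Inl\<close> holds the parameters \<open>(u, v)\<close>, the outer
  \<open>Inr\<close> the unknowns \<open>(z, w)\<close>.\<close>

definition crit_equations :: "(('n + 'n) + ('n + 'n)) mpoly set" where
  "crit_equations = {in_z f, in_w (conj_poly f)} \<union>
    (\<lambda>(i, j). (uv (Inr i) - zw (Inr i)) * in_z (partial_deriv j f)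
            - (uv (Inr j) - zw (Inr j)) * in_z (partial_deriv i f)) ` UNIV \<union>
    (\<lambda>(i, j). (uv (Inl i) - zw (Inl i)) * in_w (partial_deriv j (conj_poly f))
            - (uv (Inl j) - zw (Inl j)) * in_w (partial_deriv i (conj_poly f))) ` UNIV"

lemma finite_crit_equations: "finite crit_equations"
  by (simp add: crit_equations_def)

lemma critical_points_conj_iff:
  "x \<in> critical_points X u v \<longleftrightarrow>
    poly_eval (\<lambda>k. x (Inl k)) f = 0 \<and> poly_eval (\<lambda>k. x (Inr k)) (conj_poly f) = 0 \<and>
    (\<exists>\<mu>. \<forall>k. v k - x (Inr k) = \<mu> * poly_eval (\<lambda>k. x (Inl k)) (partial_deriv k f)) \<and>
    (\<exists>\<mu>. \<forall>k. u k - x (Inl k) = \<mu> * poly_eval (\<lambda>k. x (Inr k)) (partial_deriv k (conj_poly f)))"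
proof -
  have "(\<exists>\<mu>. \<forall>k. cnj (u k) - cnj (x (Inl k)) = \<mu> * b k) \<longleftrightarrow> (\<exists>\<mu>. \<forall>k. u k - x (Inl k) = \<mu> * cnj (b k))"
    for b
  proof
    assume "\<exists>\<mu>. \<forall>k. cnj (u k) - cnj (x (Inl k)) = \<mu> * b k"
    then obtain \<mu> where \<mu>: "\<And>k. cnj (u k) - cnj (x (Inl k)) = \<mu> * b k" by blast
    have "u k - x (Inl k) = cnj \<mu> * cnj (b k)" for k
      using arg_cong[OF \<mu>[of k], of cnj] by simp
    then show "\<exists>\<mu>. \<forall>k. u k - x (Inl k) = \<mu> * cnj (b k)" by blast
  next
    assume "\<exists>\<mu>. \<forall>k. u k - x (Inl k) = \<mu> * cnj (b k)"
    then obtain \<mu> where \<mu>: "\<And>k. u k - x (Inl k) = \<mu> * cnj (b k)" by blast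
    have "cnj (u k) - cnj (x (Inl k)) = cnj \<mu> * b k" for k
      using arg_cong[OF \<mu>[of k], of cnj] by simp
    then show "\<exists>\<mu>. \<forall>k. cnj (u k) - cnj (x (Inl k)) = \<mu> * b k" by blast
  qed
  then show ?thesis
    unfolding critical_points_iff by (simp add: poly_eval_conj_poly poly_eval_partial_deriv_conj_poly)
qed

lemma fibre_crit_equations: "fibre crit_equations (case_sum u v) = critical_points X u v"
proof (rule Set.set_eqI)
  fix x :: "'n + 'n \<Rightarrow> complex"
  let ?z = "\<lambda>k. x (Inl k)" and ?w = "\<lambda>k. x (Inr k)"
  let ?y = "case_sum (case_sum u v) x"
  have ez: "poly_eval ?y (in_z p) = poly_eval ?z p" and ew: "poly_eval ?y (in_w p) = poly_eval ?w p" for p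
    by simp_all
  have "x \<in> fibre crit_equations (case_sum u v) \<longleftrightarrow> poly_eval ?z f = 0 \<and> poly_eval ?w (conj_poly f) = 0 \<and>
    (\<forall>i j. (v i - ?w i) * poly_eval ?z (partial_deriv j f) = (v j - ?w j) * poly_eval ?z (partial_deriv i f)) \<and>
    (\<forall>i j. (u i - ?z i) * poly_eval ?w (partial_deriv j (conj_poly f)) = (u j - ?z j) * poly_eval ?w (partial_deriv i (conj_poly f)))"
    unfolding fibre_def crit_equations_def
    by (simp add: ball_Un eval.hom_minus eval.hom_mult ez ew)
  also have "\<dots> \<longleftrightarrow> x \<in> critical_points X u v"
  proof (cases "poly_eval ?z f = 0 \<and> poly_eval ?w (conj_poly f) = 0")
    case True
    then have 1: "\<exists>k. poly_eval ?z (partial_deriv k f) \<noteq> 0" using smooth by blast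
    have "poly_eval (\<lambda>k. cnj (?w k)) f = 0" using True by (simp add: poly_eval_conj_poly)
    from smooth[OF this] have 2: "\<exists>k. poly_eval ?w (partial_deriv k (conj_poly f)) \<noteq> 0"
      by (simp add: poly_eval_partial_deriv_conj_poly)
    show ?thesis unfolding critical_points_conj_iff
      by (simp only: proportional_iff[OF 1, of "\<lambda>k. v k - ?w k"] proportional_iff[OF 2, of "\<lambda>k. u k - ?z k"])
  qed (auto simp: critical_points_conj_iff)
  finally show "x \<in> fibre crit_equations (case_sum u v) \<longleftrightarrow> x \<in> critical_points X u v" .
qed

text \<open>A critical point is recovered from \<open>w\<close> and its multiplier \<mu>, since
  \<open>z = u - \<mu> \<nabla>g(w)\<close>. Hence it is enough to count pairs
  \<open>(w, \<mu>)\<close>.\<close>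

lemma critical_points_at_least_slice:
  assumes "hypersurface_slice f (conj_poly f) u x1 d" "at_least m (critical_points X u v)"
  shows "at_least m (hypersurface_slice.slice_fibre f (conj_poly f) u v)"
proof -
  interpret hypersurface_slice f "conj_poly f" u x1 d by fact
  let ?P = "critical_points X u v"
  have "\<forall>x\<in>?P. \<exists>\<mu>. \<forall>k. u k - x (Inl k) = \<mu> * poly_eval (\<lambda>k. x (Inr k)) (partial_deriv k (conj_poly f))"
    by (simp add: critical_points_conj_iff)
  from bchoice[OF this] obtain \<mu> where \<mu>: "\<And>x k. x \<in> ?P \<Longrightarrow>
    u k - x (Inl k) = \<mu> x * poly_eval (\<lambda>k. x (Inr k)) (partial_deriv k (conj_poly f))" by blast
  define \<phi> where "\<phi> x i = (case i of None \<Rightarrow> \<mu> x | Some k \<Rightarrow> x (Inr k))" for x i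
  show ?thesis
  proof (rule at_least_inj[OF assms(2)])
    show "inj_on \<phi> ?P"
    proof (rule inj_onI)
      fix x x' assume x: "x \<in> ?P" "x' \<in> ?P" "\<phi> x = \<phi> x'"
      have "\<mu> x = \<mu> x'" using fun_cong[OF x(3), of None] by (simp add: \<phi>_def)
      moreover have w: "x (Inr k) = x' (Inr k)" for k
        using fun_cong[OF x(3), of "Some k"] by (simp add: \<phi>_def)
      ultimately have "u k - x (Inl k) = u k - x' (Inl k)" for k
        using \<mu>[OF x(1), of k] \<mu>[OF x(2), of k] by simp
      then have z: "x (Inl k) = x' (Inl k)" for k by simp
      show "x = x'"
      proof
        fix i show "x i = x' i" by (cases i) (simp_all add: w z)
      qed
    qed
    show "\<phi> ` ?P \<subseteq> slice_fibre v"
    proof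
      fix y assume "y \<in> \<phi> ` ?P"
      then obtain x where x: "x \<in> ?P" "y = \<phi> x" by blast
      then obtain l where l: "\<And>k. v k - x (Inr k) = l * poly_eval (\<lambda>k. x (Inl k)) (partial_deriv k f)"
        unfolding critical_points_conj_iff by blast
      define s where "s i = (case i of Inl k \<Rightarrow> x (Inr k) | Inr b \<Rightarrow> if b then l else \<mu> x)" for i
      have z: "(\<lambda>k. poly_eval s (zpol k)) = (\<lambda>k. x (Inl k))"
      proof
        fix k
        show "poly_eval s (zpol k) = x (Inl k)"
          using \<mu>[OF x(1), of k] by (simp add: poly_eval_zpol s_def algebra_simps)
      qed
      have "s \<in> slice"
        using x(1) z by (simp add: slice_def lift_def fz_def s_def[of "Inl _"] critical_points_conj_iff)
      moreover have "poly_eval s (vpol k) = v k" for k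
        using l[of k] by (simp add: vpol_def eval.hom_add eval.hom_mult z s_def algebra_simps)
      moreover have "y = (\<lambda>i. s (wm_var i))"
        by (auto simp: x(2) \<phi>_def s_def wm_var_def fun_eq_iff split: option.splits)
      ultimately show "y \<in> slice_fibre v" unfolding slice_fibre_def by blast
    qed
  qed
qed

text \<open>The slice bounds the fibre only for \<open>u\<close> off \<open>X\<close> and one
  suitable \<open>v\<close>, which however may be taken off the zeros of any given polynomial. By
  the dichotomy this rules out more points for almost all pairs.\<close>

theorem vHDdeg_irreducible_le:
  assumes d: "d \<ge> 1" and f: "keys f \<subseteq> monoms UNIV d" and lead: "lookup f (single x1 d) \<noteq> 0"
  shows "vHDdeg_irreducible X \<le> d\<^sup>2 * (\<Sum>k<CARD('n). ((d - 1)\<^sup>2) ^ k)"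
proof -
  let ?B = "d\<^sup>2 * (\<Sum>k<CARD('n). ((d - 1)\<^sup>2) ^ k)"
  have slice: "hypersurface_slice f (conj_poly f) u x1 d" if "poly_eval u f \<noteq> 0" for u
    by unfold_locales (use d f lead that in \<open>simp_all add: keys_conj_poly lookup_conj_poly\<close>)
  show ?thesis
  proof (rule at_least_fibre_dichotomy[OF finite_crit_equations, of "Suc ?B"])
    fix p
    assume "p \<noteq> 0" and dich: "(\<forall>y. poly_eval y p \<noteq> 0 \<longrightarrow> at_least (Suc ?B) (fibre crit_equations y)) \<or>
      (\<forall>y. poly_eval y p \<noteq> 0 \<longrightarrow> \<not> at_least (Suc ?B) (fibre crit_equations y))"
    have "\<not> (\<forall>y. poly_eval y p \<noteq> 0 \<longrightarrow> at_least (Suc ?B) (fibre crit_equations y))"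
    proof
      assume *: "\<forall>y. poly_eval y p \<noteq> 0 \<longrightarrow> at_least (Suc ?B) (fibre crit_equations y)"
      have "f \<noteq> 0" using lead by auto
      \<comment> \<open>Read as a polynomial in the pair, so that \<open>u\<close> can be chosen off
        \<open>X\<close> and on the generic side of \<open>p\<close> at once.\<close>
      define fu where "fu = subst Const (\<lambda>k. Var (Inl k :: 'n + 'n)) f"
      obtain u1 where "poly_eval u1 f \<noteq> 0" using \<open>f \<noteq> 0\<close> mpoly_eq_0_iff[of f] by blast
      then have "poly_eval (case_sum u1 u1) fu \<noteq> 0" by (simp add: fu_def)
      then have "fu \<noteq> 0" by auto
      then have "p * fu \<noteq> 0" using \<open>p \<noteq> 0\<close> by (simp add: mpoly_mult_eq_0_iff)
      then obtain y where y: "poly_eval y (p * fu) \<noteq> 0" using mpoly_eq_0_iff[of "p * fu"] by blast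
      define u where "u = (\<lambda>k. y (Inl k))"
      have u: "poly_eval u f \<noteq> 0" using y by (simp add: u_def fu_def eval.hom_mult)
      \<comment> \<open>The condition \<open>p\<close> with \<open>u\<close> fixed; the second half
        of \<open>y\<close> shows that it is nonzero.\<close>
      define c where "c = subst Const (case_sum (\<lambda>k. Const (u k)) Var) p"
      have c: "poly_eval v c = poly_eval (case_sum u v) p" for v
        unfolding c_def by simp (intro poly_eval_cong, auto split: sum.splits)
      have "case_sum u (\<lambda>k. y (Inr k)) = y" by (auto simp: u_def fun_eq_iff split: sum.splits)
      then have "poly_eval (\<lambda>k. y (Inr k)) c \<noteq> 0" using y by (simp add: c eval.hom_mult)
      then have "c \<noteq> 0" by auto
      interpret S: hypersurface_slice f "conj_poly f" u x1 d by (rule slice[OF u])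
      obtain v where v: "poly_eval v c \<noteq> 0" "\<not> at_least (Suc S.bound) (S.slice_fibre v)"
        by (rule S.slice_fibre_bound[OF \<open>c \<noteq> 0\<close>])
      have "at_least (Suc ?B) (critical_points X u v)"
        using * v(1) unfolding c fibre_crit_equations[symmetric] by blast
      from critical_points_at_least_slice[OF slice[OF u] this] v(2)
      show False by (simp add: S.bound_def S.\<delta>_def)
    qed
    with dich have small: "\<not> at_least (Suc ?B) (fibre crit_equations y)" if "poly_eval y p \<noteq> 0" for y
      using that by blast
    show ?thesis
    proof (rule generic_fibre_card[OF finite_crit_equations \<open>p \<noteq> 0\<close> small])
      fix m c assume m: "m \<le> ?B" and c: "c \<noteq> 0"
        "\<And>y. poly_eval y c \<noteq> 0 \<Longrightarrow> finite (fibre crit_equations y) \<and> card (fibre crit_equations y) = m"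
      have "vHDdeg_irreducible X = m"
        by (rule vHDdeg_irreducible_eqI[OF c(1)]) (simp only: fibre_crit_equations[symmetric] c(2) simp_thms)
      with m show ?thesis by simp
    qed
  qed
qed

end

section \<open>The generic coefficients\<close>

lemma total_deg_le_iff: "total_deg f \<le> d \<longleftrightarrow> keys f \<subseteq> monoms UNIV d"
  unfolding total_deg_def by (subst Max_le_iff) (auto simp: monoms_def)

lemma coeff_space_iff:
  fixes x :: "('n::finite \<Rightarrow>\<^sub>0 nat) \<Rightarrow> complex"
  shows "x \<in> coeff_space d \<longleftrightarrow> (\<forall>m. m \<notin> monoms UNIV d \<longrightarrow> x m = 0)"
proof
  assume "x \<in> coeff_space d"
  then obtain f where "x = lookup f" "total_deg f \<le> d" unfolding coeff_space_def by blast
  then show "\<forall>m. m \<notin> monoms UNIV d \<longrightarrow> x m = 0" by (auto simp: total_deg_le_iff in_keys_iff)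
next
  assume x: "\<forall>m. m \<notin> monoms UNIV d \<longrightarrow> x m = 0"
  define f where "f = (\<Sum>m\<in>monoms (UNIV :: 'n set) d. single m (x m))"
  have "lookup f m = x m" for m
    using x by (simp add: f_def lookup_sum lookup_single when_def finite_monoms)
  then have "x = lookup f" "keys f \<subseteq> monoms UNIV d"
    using x by (auto simp: fun_eq_iff in_keys_iff)
  then show "x \<in> coeff_space d" unfolding coeff_space_def by (auto simp: total_deg_le_iff)
qed

text \<open>\<open>c\<close> involves only coefficients up to degree \<open>d\<close>, so truncating
  a point where it is nonzero gives one in the coefficient space. Density follows by joining this
  point to one of the other open set: the line stays in the linear space.\<close>

lemma for_generic_polyI:
  fixes c :: "('n::finite \<Rightarrow>\<^sub>0 nat) mpoly"
  assumes "c \<noteq> 0" "\<And>m. m \<in> keys c \<Longrightarrow> keys m \<subseteq> monoms UNIV d"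
    "\<And>f. poly_eval (lookup f) c \<noteq> 0 \<Longrightarrow> total_deg f = d \<Longrightarrow> P f"
  shows "for_generic_poly d P"
  unfolding for_generic_poly_def
proof (intro exI[of _ "coeff_space d - zero_locus {c}"] conjI allI impI)
  let ?\<Omega> = "coeff_space d - zero_locus {c}"
  show "zariski_open_in (coeff_space d) ?\<Omega>" unfolding zariski_open_in_def by blast
  obtain x where x: "poly_eval x c \<noteq> 0" using assms(1) mpoly_eq_0_iff[of c] by blast
  define a where "a m = (if m \<in> monoms UNIV d then x m else 0)" for m
  have "poly_eval a c = poly_eval x c"
    by (rule poly_eval_cong) (use assms(2) in \<open>auto simp: a_def\<close>)
  then have a: "poly_eval a c \<noteq> 0" "a \<in> coeff_space d" using x by (auto simp: coeff_space_iff a_def)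
  show "zariski_dense_in (coeff_space d) ?\<Omega>"
    unfolding zariski_dense_in_def
  proof (intro conjI allI impI)
    fix S :: "(('n \<Rightarrow>\<^sub>0 nat) \<Rightarrow> complex) set"
    assume S: "zariski_open_in (coeff_space d) S \<and> S \<noteq> {}"
    then obtain B where B: "S = coeff_space d - zero_locus B" unfolding zariski_open_in_def by blast
    then obtain b where b: "b \<in> coeff_space d" "b \<notin> zero_locus B" using S by blast
    then obtain p where p: "p \<in> B" "poly_eval b p \<noteq> 0" unfolding zero_locus_def by blast
    show "?\<Omega> \<inter> S \<noteq> {}"
    proof (rule common_nonzero_on_line[OF a(1) p(2)])
      fix t
      let ?x = "\<lambda>v. a v + t * (b v - a v)"
      assume nz: "poly_eval ?x c \<noteq> 0" "poly_eval ?x p \<noteq> 0"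
      have "?x \<in> coeff_space d" using a(2) b(1) by (simp add: coeff_space_iff)
      then have "?x \<in> ?\<Omega> \<inter> S" using nz p(1) by (auto simp: B zero_locus_def)
      then show ?thesis by blast
    qed
  qed simp
  show "P f" if "lookup f \<in> ?\<Omega> \<and> total_deg f = d" for f
    using that assms(3) by (simp add: zero_locus_def)
qed

lemma for_generic_poly_mono:
  assumes "for_generic_poly d P" "\<And>f. P f \<Longrightarrow> P' f"
  shows "for_generic_poly d P'"
  using assms unfolding for_generic_poly_def by blast

lemma (in generic_hypersurface) prime_hypersurface: "prime_hypersurface (zero_locus {f}) f"
proof unfold_locales
  show v: "f dvd p" if "\<And>z. z \<in> zero_locus {f} \<Longrightarrow> poly_eval z p = 0" for p
    using that by (intro vanishing_imp_dvd) (simp add: zero_locus_def)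
  show "zero_locus {f} \<noteq> {}"
  proof
    assume "zero_locus {f} = {}"
    then have "f dvd 1" by (intro v) simp
    then obtain k where "1 = f * k" by (elim dvdE)
    then have "1 = rs (\<lambda>k. if k = x2 then 1 else 0) f * rs (\<lambda>k. if k = x2 then 1 else 0) k"
      by (simp flip: rs.hom_mult)
    then have "rs (\<lambda>k. if k = x2 then 1 else 0) f dvd 1" by (rule dvdI)
    then show False using irreducible_rs(2)[OF plane_disc_nonzero] by (simp add: irreducible_not_unit)
  qed
qed (use prime_f lead in auto)

lemma (in generic_hypersurface) vHDdeg_le:
  "vHDdeg (zero_locus {f}) \<le> d\<^sup>2 * (\<Sum>k<CARD('n). ((d - 1)\<^sup>2) ^ k)"
proof -
  interpret P: prime_hypersurface "zero_locus {f}" f by (rule prime_hypersurface)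
  interpret S: smooth_hypersurface "zero_locus {f}" f by (rule P.smooth_hypersurfaceI[OF smooth])
  show ?thesis using S.vHDdeg_irreducible_le[OF d f lead] by (simp add: vHDdeg_def P.components)
qed

lemma generic_bound:
  fixes x1 x2 :: "'n::finite"
  assumes x12: "x1 \<noteq> x2" and d: "d \<ge> 1"
  shows "for_generic_poly d (\<lambda>f :: 'n mpoly.
    vHDdeg (zero_locus {f}) \<le> d\<^sup>2 * (\<Sum>k<CARD('n). ((d - 1)\<^sup>2) ^ k))"
proof -
  \<comment> \<open>\<Delta> is for the axis of \<open>x1\<close>, \<open>D\<close> for the whole
    space.\<close>
  obtain \<Delta> where \<Delta>: "detects_singular {x1} d \<Delta>" using singular_hypersurface[OF _ d] by blast
  obtain D :: "('n \<Rightarrow>\<^sub>0 nat) mpoly" where D: "detects_singular UNIV d D"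
    using singular_hypersurface[OF finite d] by blast
  have "\<forall>a\<in>{1..<d}. \<exists>Q. detects_product a (d - a) Q"
    by (intro ballI product_hypersurface) auto
  from bchoice[OF this] obtain Q where "\<forall>a\<in>{1..<d}. detects_product a (d - a) (Q a)" by blast
  then have Q: "\<And>a. 1 \<le> a \<Longrightarrow> a < d \<Longrightarrow> detects_product a (d - a) (Q a)" by simp
  define mm where "mm = (\<lambda>(i, j). single x1 i + single x2 j :: 'n \<Rightarrow>\<^sub>0 nat)"
  define q where "q a = subst Const (\<lambda>k. Var (mm k)) (Q a)" for a
  have q_eval: "poly_eval x (q a) = poly_eval (\<lambda>k. x (mm k)) (Q a)" for x a
    by (simp add: q_def)
  have q_nz: "q a \<noteq> 0" if a: "1 \<le> a" "a < d" for a
  proof -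
    obtain y where y: "poly_eval y (Q a) \<noteq> 0" using Q[OF a] mpoly_eq_0_iff[of "Q a"] by (auto simp: detects_product_def)
    \<comment> \<open>Because \<open>x1 \<noteq> x2\<close>, distinct pairs of exponents give
      distinct monomials, and so arbitrary values \<open>y\<close> extend to a coefficient
      vector.\<close>
    have "(\<lambda>k. y (lookup (mm k) x1, lookup (mm k) x2)) = y"
      using x12 by (auto simp: fun_eq_iff mm_def lookup_add lookup_single)
    then have "poly_eval (\<lambda>m. y (lookup m x1, lookup m x2)) (q a) \<noteq> 0" using y by (simp add: q_eval)
    then show ?thesis by auto
  qed
  have q_keys: "keys m \<subseteq> monoms UNIV d" if "m \<in> keys (q a)" "1 \<le> a" "a < d" for a m
  proof -
    interpret monom_grading "\<lambda>_. {m. keys m \<subseteq> monoms (UNIV :: 'n set) d}" by (rule vars_in_grading)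
    \<comment> \<open>The sum is just some bound on the degree of \<open>Q a\<close>; the filtration
      in use is constant.\<close>
    have "keys (Q a) \<subseteq> monoms (tri d) (\<Sum>m\<in>keys (Q a). monom_degree m)"
      using Q[OF that(2,3)] that(2,3) by (auto simp: detects_product_def monoms_def intro!: member_le_sum)
    then have "keys (q a) \<subseteq> {m. keys m \<subseteq> monoms UNIV d}"
      unfolding q_def by (rule keys_subst) (auto simp: keys_Var mm_def tri_def monoms_def)
    then show ?thesis using that(1) by blast
  qed
  \<comment> \<open>All conditions at once: the pure power of \<open>x1\<close>, the constant term,
    distinct roots on the axis, smoothness, and irreducibility on the coordinate plane.\<close>
  define c where "c = Var (single x1 d) * (Var 0 * (\<Delta> * (D * (\<Prod>a\<in>{1..<d}. q a))))"
  have prod_nz: "(\<Prod>a\<in>{1..<d}. q a) \<noteq> 0"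
  proof -
    have "\<exists>x. \<forall>a\<in>{1..<d}. poly_eval x (q a) \<noteq> 0"
    proof (rule common_nonzero_finite)
      fix a assume "a \<in> {1..<d}"
      then show "\<exists>x. poly_eval x (q a) \<noteq> 0" using q_nz[of a] mpoly_eq_0_iff[of "q a"] by auto
    qed simp
    then obtain x where "\<forall>a\<in>{1..<d}. poly_eval x (q a) \<noteq> 0" ..
    then have "poly_eval x (\<Prod>a\<in>{1..<d}. q a) \<noteq> 0" by (simp add: eval.hom_prod)
    then show ?thesis by auto
  qed
  show ?thesis
  proof (rule for_generic_polyI[of c])
    have "Var m \<noteq> (0 :: ('n \<Rightarrow>\<^sub>0 nat) mpoly)" for m :: "'n \<Rightarrow>\<^sub>0 nat"
    proof
      assume "Var m = (0 :: ('n \<Rightarrow>\<^sub>0 nat) mpoly)"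
      from arg_cong[OF this, of "poly_eval (\<lambda>_. 1)"] show False by simp
    qed
    then show "c \<noteq> 0" using \<Delta> D prod_nz by (simp add: c_def mpoly_mult_eq_0_iff detects_singular_def)
    have "monoms {x1} d \<subseteq> monoms (UNIV :: 'n set) d" by (rule monoms_mono) auto
    then have "keys \<Delta> \<subseteq> {m. keys m \<subseteq> monoms UNIV d}" using \<Delta> by (auto simp: detects_singular_def)
    moreover have "keys D \<subseteq> {m. keys m \<subseteq> monoms UNIV d}" using D by (auto simp: detects_singular_def)
    moreover have "keys (\<Prod>a\<in>{1..<d}. q a) \<subseteq> {m. keys m \<subseteq> monoms (UNIV :: 'n set) d}"
      by (rule monom_grading.keys_prod[OF vars_in_grading]) (use q_keys in auto)
    ultimately have "keys c \<subseteq> {m. keys m \<subseteq> monoms UNIV d}"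
      unfolding c_def by (intro vars_in_mult vars_in_Var) (auto simp: monoms_def)
    then show "keys m \<subseteq> monoms UNIV d" if "m \<in> keys c" for m using that by blast
    fix f :: "'n mpoly"
    assume nz: "poly_eval (lookup f) c \<noteq> 0" and td: "total_deg f = d"
    have f: "keys f \<subseteq> monoms UNIV d" using td by (simp flip: total_deg_le_iff)
    have nzs: "lookup f (single x1 d) \<noteq> 0" "lookup f 0 \<noteq> 0" "poly_eval (lookup f) \<Delta> \<noteq> 0"
      "poly_eval (lookup f) D \<noteq> 0" "\<And>a. a \<in> {1..<d} \<Longrightarrow> poly_eval (lookup f) (q a) \<noteq> 0"
      using nz by (auto simp: c_def eval.hom_mult eval.hom_prod)
    have fin: "finite (monoms (UNIV :: 'n set) d)" by (rule finite_monoms) simp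
    interpret generic_hypersurface x1 f x2 d \<Delta> Q
    proof unfold_locales
      fix z assume z: "poly_eval z f = 0"
      show "\<exists>k. poly_eval z (partial_deriv k f) \<noteq> 0"
      proof (rule ccontr)
        assume "\<not> ?thesis"
        then have 0: "poly_eval z (partial_deriv k f) = 0" for k by blast
        have "(\<Sum>m\<in>monoms UNIV d. lookup f m * mval z m) = 0"
          using z poly_eval_superset[OF fin f, of z] by simp
        moreover have "(\<Sum>m\<in>monoms UNIV d. of_nat (lookup m v) * lookup f m * mval z (m - single v 1)) = 0" for v
          using 0[of v] poly_eval_partial_deriv[OF fin f, of z v] by simp
        ultimately have "poly_eval (lookup f) D = 0" using D unfolding detects_singular_def by blast
        then show False using nzs(4) by simp
      qed
    next
      fix a assume a: "1 \<le> a" "a < d"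
      have "(\<lambda>(i, j). lookup f (single x1 i + single x2 j)) = (\<lambda>k. lookup f (mm k))"
        by (auto simp: mm_def fun_eq_iff)
      then show "poly_eval (\<lambda>(i, j). lookup f (single x1 i + single x2 j)) (Q a) \<noteq> 0"
        using nzs(5)[of a] a by (simp add: q_eval)
    qed (fact x12 d f nzs \<Delta> Q)+
    show "vHDdeg (zero_locus {f}) \<le> d\<^sup>2 * (\<Sum>k<CARD('n). ((d - 1)\<^sup>2) ^ k)" by (rule vHDdeg_le)
  qed
qed

section \<open>Dimension one\<close>

lemma degree_line_poly_le:
  assumes "keys p \<subseteq> monoms UNIV d"
  shows "degree (line_poly a b p) \<le> d"
  unfolding line_poly_def subst_def
proof (rule degree_sum_le)
  fix m assume "m \<in> keys p"
  then have "monom_degree m \<le> d" using assms by (auto simp: monoms_def)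
  have "degree ([:lookup p m:] * (\<Prod>v\<in>keys m. [:a v, b v:] ^ lookup m v))
      \<le> 0 + degree (\<Prod>v\<in>keys m. [:a v, b v:] ^ lookup m v)"
    by (rule order.trans[OF degree_mult_le]) simp
  also have "\<dots> \<le> (\<Sum>v\<in>keys m. degree ([:a v, b v:] ^ lookup m v))"
    using degree_prod_sum_le[of "keys m" "\<lambda>v. [:a v, b v:] ^ lookup m v"] by (simp add: comp_def)
  also have "\<dots> \<le> (\<Sum>v\<in>keys m. lookup m v)"
  proof (rule sum_mono)
    fix v
    have d1: "degree [:a v, b v:] \<le> 1" by simp
    show "degree ([:a v, b v:] ^ lookup m v) \<le> lookup m v"
      by (rule order.trans[OF degree_power_le], rule order.trans[OF mult_le_mono1[OF d1]], simp)
  qed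
  also have "\<dots> \<le> d" using \<open>monom_degree m \<le> d\<close> by (simp add: monom_degree_def)
  finally show "degree ([:lookup p m:] * (\<Prod>v\<in>keys m. [:a v, b v:] ^ lookup m v)) \<le> d" .
qed simp

lemma dim_one_const:
  assumes "CARD('n::finite) = 1"
  shows "(x :: 'n \<Rightarrow> 'a) = (\<lambda>_. x i)"
proof
  fix j
  obtain k :: 'n where "UNIV = {k}" using assms by (auto simp: card_1_singleton_iff)
  then have "j = k" "i = k" by blast+
  then show "x j = x i" by simp
qed

text \<open>With one variable there is no plane to restrict to, and a polynomial of degree above one
  is never irreducible. The hypersurface is a finite set, treated point by point.\<close>

context
  fixes x0 :: "'n::finite"
  assumes one: "CARD('n) = 1"
begin

definition lin :: "('n \<Rightarrow> complex) \<Rightarrow> 'n mpoly" where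
  "lin a = Var x0 - Const (a x0)"

lemma poly_eval_lin [simp]: "poly_eval z (lin a) = z x0 - a x0"
  by (simp add: lin_def eval.hom_minus)

lemma const_eq: "(\<lambda>_. z x0) = z" for z :: "'n \<Rightarrow> 'a"
  by (rule dim_one_const[OF one, symmetric])

lemma point_iff: "z = a \<longleftrightarrow> z x0 = a x0" for z a :: "'n \<Rightarrow> 'a"
proof
  assume "z x0 = a x0"
  then have "(\<lambda>_ :: 'n. z x0) = (\<lambda>_. a x0)" by simp
  then show "z = a" by (simp only: const_eq)
qed simp

lemma zero_locus_lin: "zero_locus {lin a} = {a}"
  by (auto simp: zero_locus_def point_iff[of _ a])

text \<open>The factor theorem: the only variable is made that of a univariate polynomial and is
  then substituted back.\<close>

lemma lin_dvd_iff: "lin a dvd p \<longleftrightarrow> poly_eval a p = 0"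
proof
  assume p: "poly_eval a p = 0"
  define P where "P = as_poly x0 p"
  \<comment> \<open>The coefficients of \<open>P\<close> do not involve \<open>x0\<close>, hence are
    constants; evaluating them at \<open>a\<close> makes this explicit.\<close>
  define Q :: "'n mpoly poly" where "Q = map_poly (\<lambda>c. Const (poly_eval a c)) P"
  have eQ: "poly_eval z (poly Q (Var x0)) = poly (peval a P) (z x0)" for z
  proof -
    have "poly_eval z (poly (map_poly (\<lambda>c. Const (poly_eval a c) :: 'n mpoly) G) (Var x0)) = poly (peval a G) (z x0)" for G
      by (induction G) (simp_all add: map_poly_pCons eval.hom_add eval.hom_mult)
    then show ?thesis by (simp add: Q_def)
  qed
  have "poly Q (Var x0) = p"
  proof (rule mpoly_eqI)
    fix z
    have "a(x0 := z x0) = z" by (subst point_iff) simp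
    then show "poly_eval z (poly Q (Var x0)) = poly_eval z p" by (simp add: eQ P_def)
  qed
  moreover have "lin a dvd poly Q (Var x0) - poly Q (Const (a x0))"
  proof -
    have "Var x0 - Const (a x0) dvd poly Q (Var x0) - poly Q (Const (a x0))"
    proof (induction Q)
      case (pCons c Q)
      have "poly (pCons c Q) (Var x0) - poly (pCons c Q) (Const (a x0))
        = Var x0 * (poly Q (Var x0) - poly Q (Const (a x0))) + (Var x0 - Const (a x0)) * poly Q (Const (a x0))"
        by (simp add: algebra_simps)
      then show ?case using pCons.IH by (simp add: dvd_add dvd_mult)
    qed simp
    then show ?thesis by (simp add: lin_def)
  qed
  moreover have "poly Q (Const (a x0)) = 0"
  proof -
    have "poly (map_poly (\<lambda>c. Const (poly_eval a c) :: 'n mpoly) G) (Const (a x0)) = Const (poly (peval a G) (a x0))" for G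
      by (induction G) (simp_all add: map_poly_pCons Const.hom_add Const.hom_mult)
    moreover have "a(x0 := a x0) = a" by simp
    ultimately show ?thesis using p by (simp add: Q_def P_def)
  qed
  ultimately show "lin a dvd p" by simp
qed (auto simp: dvd_def eval.hom_mult)

lemma point_hypersurface: "prime_hypersurface {a} (lin a)"
proof unfold_locales
  show "lin a \<noteq> 0"
  proof
    assume "lin a = 0"
    from arg_cong[OF this, of "poly_eval (\<lambda>_. a x0 + 1)"] show False by simp
  qed
qed (auto simp: zero_locus_lin lin_dvd_iff eval.hom_mult)

text \<open>The gradient is \<open>1\<close> and there is a single coordinate, so both multipliers
  always exist. Whatever \<open>(u, v)\<close> is, the point \<open>a\<close> paired with its
  conjugate is the only critical point.\<close>

lemma vHDdeg_point:
  fixes a :: "'n \<Rightarrow> complex"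
  shows "vHDdeg_irreducible {a} = 1"
proof -
  interpret P: prime_hypersurface "{a}" "lin a" by (rule point_hypersurface)
  have pd: "poly_eval z (partial_deriv k (lin a)) = 1" for z k
  proof -
    obtain i :: 'n where "UNIV = {i}" using one by (auto simp: card_1_singleton_iff)
    then have "k = i" "x0 = i" by blast+
    then have k: "k = x0" by simp
    have "partial_deriv x0 (lin a) = partial_deriv x0 (single (single x0 1) 1 + single 0 (- a x0) :: 'n mpoly)"
      by (simp add: lin_def Var_def Const_def single_uminus)
    also have "\<dots> = single 0 1" by (simp add: partial_deriv_add partial_deriv_single)
    finally show ?thesis by (simp add: k)
  qed
  interpret S: smooth_hypersurface "{a}" "lin a" by (rule P.smooth_hypersurfaceI) (simp add: pd)
  have "critical_points {a} u v = {case_sum a (\<lambda>k. cnj (a k))}" for u v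
  proof (rule Set.set_eqI)
    fix x :: "'n + 'n \<Rightarrow> complex"
    have const: "\<exists>\<mu>. \<forall>k. b k = \<mu> * 1" for b :: "'n \<Rightarrow> complex"
    proof (intro exI[of _ "b x0"] allI)
      show "b k = b x0 * 1" for k using fun_cong[OF const_eq[of b], of k] by simp
    qed
    have "x \<in> critical_points {a} u v \<longleftrightarrow> x (Inl x0) = a x0 \<and> cnj (x (Inr x0)) = a x0"
      unfolding S.critical_points_iff pd using const[of "\<lambda>k. v k - x (Inr k)"]
        const[of "\<lambda>k. cnj (u k) - cnj (x (Inl k))"] by simp
    also have "\<dots> \<longleftrightarrow> (\<lambda>k. x (Inl k)) = a \<and> (\<lambda>k. cnj (x (Inr k))) = a"
      by (simp only: point_iff)
    also have "\<dots> \<longleftrightarrow> x = case_sum a (\<lambda>k. cnj (a k))"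
    proof
      assume *: "(\<lambda>k. x (Inl k)) = a \<and> (\<lambda>k. cnj (x (Inr k))) = a"
      show "x = case_sum a (\<lambda>k. cnj (a k))"
      proof
        fix i show "x i = case_sum a (\<lambda>k. cnj (a k)) i"
        proof (cases i)
          case (Inl b)
          then show ?thesis using fun_cong[OF conjunct1[OF *], of b] by simp
        next
          case (Inr b)
          then show ?thesis using arg_cong[OF fun_cong[OF conjunct2[OF *], of b], of cnj] by simp
        qed
      qed
    qed auto
    finally show "x \<in> critical_points {a} u v \<longleftrightarrow> x \<in> {case_sum a (\<lambda>k. cnj (a k))}" by simp
  qed
  then show ?thesis by (intro vHDdeg_irreducible_eqI[of 1]) simp_all
qed

lemma finite_set_algebraic:
  assumes "finite (B :: ('n \<Rightarrow> complex) set)"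
  shows "algebraic_set B"
proof -
  have "z \<in> B \<longleftrightarrow> (\<exists>b\<in>B. z x0 = b x0)" for z
  proof
    assume "\<exists>b\<in>B. z x0 = b x0"
    then obtain b where b: "b \<in> B" "z x0 = b x0" ..
    have "z = b" using point_iff[of z b] b(2) by simp
    then show "z \<in> B" using b(1) by simp
  qed (rule bexI[of _ z], simp_all)
  moreover have "z \<in> zero_locus {\<Prod>b\<in>B. lin b} \<longleftrightarrow> (\<exists>b\<in>B. z x0 = b x0)" for z
    using assms by (simp add: zero_locus_def eval.hom_prod)
  ultimately have "B = zero_locus {\<Prod>b\<in>B. lin b}" by (intro Set.set_eqI) (simp only:)
  then show ?thesis unfolding algebraic_set_def by (rule exI)
qed

text \<open>The components are single points, and these are the roots of a nonzero univariate
  polynomial of degree at most \<open>d\<close>.\<close>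

lemma dim_one_bound:
  fixes f :: "'n mpoly"
  assumes d: "d \<ge> 1" and f: "total_deg f = d"
  shows "vHDdeg (zero_locus {f}) \<le> d"
proof -
  let ?X = "zero_locus {f}"
  define F where "F = line_poly (\<lambda>_. 0) (\<lambda>_. 1) f"
  have F: "poly F t = poly_eval (\<lambda>_. t) f" for t by (simp add: F_def)
  have "keys f \<subseteq> monoms UNIV d" using f by (simp flip: total_deg_le_iff)
  then have degF: "degree F \<le> d" unfolding F_def by (rule degree_line_poly_le)
  have "f \<noteq> 0" using f d by (auto simp: total_deg_def)
  then obtain z where z: "poly_eval z f \<noteq> 0" using mpoly_eq_0_iff[of f] by blast
  then have "poly F (z x0) \<noteq> 0" using F by (simp add: const_eq)
  then have "F \<noteq> 0" by auto
  have X: "?X \<subseteq> (\<lambda>t _. t) ` {t. poly F t = 0}"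
  proof
    fix z assume "z \<in> ?X"
    then have "poly_eval (\<lambda>_. z x0) f = 0"
      by (simp add: const_eq zero_locus_def)
    then show "z \<in> (\<lambda>t _. t) ` {t. poly F t = 0}"
      using F by (intro image_eqI[of _ _ "z x0"]) (simp_all add: const_eq)
  qed
  have finR: "finite {t. poly F t = 0}" by (rule poly_roots_finite[OF \<open>F \<noteq> 0\<close>])
  then have finX: "finite ?X" using X by (rule finite_subset[OF _ finite_imageI, rotated])
  have "card ?X \<le> card {t. poly F t = 0}"
    using card_mono[OF finite_imageI[OF finR] X] card_image_le[OF finR, of "\<lambda>t _ :: 'n. t"] by (rule order.trans)
  then have cX: "card ?X \<le> d" using card_poly_roots_bound[OF \<open>F \<noteq> 0\<close>] degF by simp
  have comp: "irreducible_components ?X \<subseteq> (\<lambda>a. {a}) ` ?X"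
  proof
    fix Y assume "Y \<in> irreducible_components ?X"
    then have Y: "irreducible_variety Y" "Y \<subseteq> ?X" unfolding irreducible_components_def by blast+
    then obtain a where a: "a \<in> Y" unfolding irreducible_variety_def by blast
    have "finite Y" using Y(2) finX by (rule finite_subset)
    then have "algebraic_set {a}" "algebraic_set (Y - {a})" by (simp_all add: finite_set_algebraic)
    moreover have "Y = {a} \<union> (Y - {a})" using a by blast
    ultimately have "{a} = Y \<or> Y - {a} = Y" using Y(1) unfolding irreducible_variety_def by blast
    then have "Y = {a}" using a by blast
    then show "Y \<in> (\<lambda>a. {a}) ` ?X" using a Y(2) by blast
  qed
  have "vHDdeg ?X = (\<Sum>Y\<in>irreducible_components ?X. 1)"
    unfolding vHDdeg_def by (rule sum.cong) (use comp vHDdeg_point in auto)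
  also have "\<dots> \<le> card ((\<lambda>a. {a}) ` ?X)" using comp finX by (simp add: card_mono)
  also have "\<dots> \<le> d" using card_image_le[OF finX] cX by (rule order.trans)
  finally show ?thesis .
qed

end

theorem proposition3p14:
  fixes d :: nat
  assumes "d \<ge> 1"
  shows "for_generic_poly d (\<lambda>f :: 'n::finite mpoly.
    vHDdeg (zero_locus {f})
      \<le> d ^ 2 * (\<Sum>k = 0..CARD('n) - 1. ((CARD('n) - 1) choose k) ^ 2 * (d - 1) ^ (2 * k)))"
proof -
  let ?B = "d ^ 2 * (\<Sum>k = 0..CARD('n) - 1. ((CARD('n) - 1) choose k) ^ 2 * (d - 1) ^ (2 * k))"
  \<comment> \<open>The sums are compared term by term: every binomial coefficient that occurs is at
    least one.\<close>
  have "(\<Sum>k<CARD('n). ((d - 1)\<^sup>2) ^ k) \<le> (\<Sum>k = 0..CARD('n) - 1. ((CARD('n) - 1) choose k) ^ 2 * (d - 1) ^ (2 * k))"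
  proof -
    obtain N where N: "CARD('n) = Suc N" using gr0_implies_Suc[OF zero_less_card_finite] by blast
    have "((d - 1)\<^sup>2) ^ k \<le> (N choose k) ^ 2 * (d - 1) ^ (2 * k)" if "k \<in> {0..N}" for k
    proof -
      have "1 \<le> (N choose k) ^ 2" using that by (simp add: Suc_le_eq zero_less_binomial)
      from mult_le_mono1[OF this, of "(d - 1) ^ (2 * k)"] show ?thesis by (simp add: power_mult)
    qed
    then have "(\<Sum>k\<in>{0..N}. ((d - 1)\<^sup>2) ^ k) \<le> (\<Sum>k\<in>{0..N}. (N choose k) ^ 2 * (d - 1) ^ (2 * k))"
      by (rule sum_mono)
    moreover have "{..<CARD('n)} = {0..N}" by (auto simp: N)
    ultimately show ?thesis by (simp only: N diff_Suc_1)
  qed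
  then have B: "d\<^sup>2 * (\<Sum>k<CARD('n). ((d - 1)\<^sup>2) ^ k) \<le> ?B" by (rule mult_le_mono2)
  show ?thesis
  proof (cases "CARD('n) = 1")
    case True
    \<comment> \<open>Here the bound holds for every \<open>f\<close> of degree \<open>d\<close>, so
      the open set is the whole coefficient space.\<close>
    show ?thesis
    proof (rule for_generic_polyI[of 1])
      fix f :: "'n mpoly" assume "total_deg f = d"
      then have "vHDdeg (zero_locus {f}) \<le> d" using dim_one_bound[OF True assms] by simp
      also have "d \<le> d ^ 2" using assms by (simp add: power2_eq_square)
      finally show "vHDdeg (zero_locus {f}) \<le> ?B" by (simp add: True)
    qed simp_all
  next
    case False
    define i :: 'n where "i = undefined"
    have "\<exists>x2. i \<noteq> x2"
    proof (rule ccontr)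
      assume "\<not> ?thesis"
      then have "x = i" for x by metis
      then have "(UNIV :: 'n set) = {i}" by blast
      then have "CARD('n) = card {i}" by (rule arg_cong)
      then show False using False by simp
    qed
    then obtain x2 where "i \<noteq> x2" ..
    from generic_bound[OF this assms] show ?thesis
      by (rule for_generic_poly_mono) (rule order.trans[OF _ B])
  qed
qed

end
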